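(* Let $r\ge 1$ and let $\det:\mathrm{GL}_r\to\mathbb G_m$ be the determinant. Pullback along $\det$ defines an equivalence of tensor categories \[ \det{}^*:\mathcal D_{\mathbb G_m}\text{-mod}^{\mathbb G_m}\xrightarrow{\ \sim\ }\mathcal D_{\mathrm{GL}_r}\text{-mod}^{\mathrm{GL}_r}. \]
   Context: For a complex affine algebraic group $G$, $\mathcal D_G\text{-mod}^G$ denotes the category of finite-rank left-translation invariant algebraic $D$-modules on $G$, with arbitrary $\mathcal D_G$-module morphisms and tensor product of flat connections. Its objects are the $\mathcal D_G$-modules $M_\alpha$, where $\alpha$ is an $n\times n$ matrix of left-invariant Kähler $1$-forms on $G$ with $d\alpha+\alpha\wedge\alpha=0$, and $M_\alpha=\mathbb C[G]^{\oplus n}$ with vector fields acting on the standard basis by $v(e_1,\dots,e_n)=(e_1,\dots,e_n)\alpha(v)$, extended by the Leibniz rule (the flat connection $d+\alpha$). Pullback along $\det$ sends $d+\alpha$ to $d+\det^*\alpha$. *)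

theory Defs
  imports "Jordan_Normal_Form.Determinant" "HOL-Computational_Algebra.Polynomial"
begin

definition GL :: "nat \<Rightarrow> complex mat set" where
  "GL r = {g \<in> carrier_mat r r. det g \<noteq> 0}"

inductive_set poly_fun :: "nat \<Rightarrow> (complex mat \<Rightarrow> complex) set" for r :: nat where
  const: "(\<lambda>g. c) \<in> poly_fun r"
| entry: "i < r \<Longrightarrow> j < r \<Longrightarrow> (\<lambda>g. g $$ (i, j)) \<in> poly_fun r"
| add: "f \<in> poly_fun r \<Longrightarrow> h \<in> poly_fun r \<Longrightarrow> (\<lambda>g. f g + h g) \<in> poly_fun r"
| mult: "f \<in> poly_fun r \<Longrightarrow> h \<in> poly_fun r \<Longrightarrow> (\<lambda>g. f g * h g) \<in> poly_fun r"

definition regular_GL :: "nat \<Rightarrow> (complex mat \<Rightarrow> complex) \<Rightarrow> bool" where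
  "regular_GL r f \<longleftrightarrow> (\<exists>p k. p \<in> poly_fun r \<and> (\<forall>g \<in> GL r. f g = p g / det g ^ k))"

definition regular_Gm :: "(complex \<Rightarrow> complex) \<Rightarrow> bool" where
  "regular_Gm f \<longleftrightarrow> (\<exists>(p :: complex poly) k. \<forall>z. z \<noteq> 0 \<longrightarrow> f z = poly p z / z ^ k)"

definition livf :: "nat \<Rightarrow> complex mat \<Rightarrow> (complex mat \<Rightarrow> complex) \<Rightarrow> complex mat \<Rightarrow> complex" where
  "livf r X f g = (SOME D. ((\<lambda>t. f (g + t \<cdot>\<^sub>m (g * X))) has_field_derivative D) (at 0))"

definition livf_Gm :: "(complex \<Rightarrow> complex) \<Rightarrow> complex \<Rightarrow> complex" where
  "livf_Gm f z = z * (SOME D. (f has_field_derivative D) (at z))"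

section \<open>Objects: flat connections d + alpha with alpha a matrix of left-invariant 1-forms\<close>

text \<open>An n x n matrix alpha of left-invariant 1-forms on GL_r is recorded by its values on the
  left-invariant vector fields, i.e. by a linear map a : gl_r -> gl_n (a X = alpha(L_X)).
  For left-invariant forms and fields, (d alpha)(L_X, L_Y) = - alpha(L_[X,Y]) and
  (alpha /\ alpha)(L_X, L_Y) = a X a Y - a Y a X, so d alpha + alpha /\ alpha = 0 reads as below.\<close>
definition obj_GL :: "nat \<Rightarrow> nat \<Rightarrow> (complex mat \<Rightarrow> complex mat) \<Rightarrow> bool" where
  "obj_GL r n a \<longleftrightarrow>
     (\<forall>X \<in> carrier_mat r r. a X \<in> carrier_mat n n) \<and>
     (\<forall>X \<in> carrier_mat r r. \<forall>Y \<in> carrier_mat r r. \<forall>c d.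
         a (c \<cdot>\<^sub>m X + d \<cdot>\<^sub>m Y) = c \<cdot>\<^sub>m a X + d \<cdot>\<^sub>m a Y) \<and>
     (\<forall>X \<in> carrier_mat r r. \<forall>Y \<in> carrier_mat r r.
         - a (X * Y - Y * X) + (a X * a Y - a Y * a X) = 0\<^sub>m n n)"

text \<open>On G_m (one-dimensional, so flatness is automatic) an n x n matrix of left-invariant
  1-forms is A dz/z with A a constant n x n matrix; we record A = alpha(z d/dz).\<close>
definition obj_Gm :: "nat \<Rightarrow> complex mat \<Rightarrow> bool" where
  "obj_Gm n A \<longleftrightarrow> A \<in> carrier_mat n n"

text \<open>A D-module morphism M_a -> M_b (ranks n, m) is O-linear, hence given by an m x n matrix F of
  regular functions (phi(e_j) = sum_i e'_i F_ij), and commutes with the vector fields: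
  v(F) + b(v) F = F a(v). Since vector fields are O-combinations of left-invariant ones and this
  condition is O-linear in v, it suffices to impose it for left-invariant v.\<close>
definition hom_GL :: "nat \<Rightarrow> nat \<Rightarrow> (complex mat \<Rightarrow> complex mat) \<Rightarrow> nat \<Rightarrow> (complex mat \<Rightarrow> complex mat)
                      \<Rightarrow> (complex mat \<Rightarrow> complex mat) \<Rightarrow> bool" where
  "hom_GL r n a m b F \<longleftrightarrow>
     (\<forall>g \<in> GL r. F g \<in> carrier_mat m n) \<and>
     (\<forall>i < m. \<forall>j < n. regular_GL r (\<lambda>g. F g $$ (i, j))) \<and>
     (\<forall>X \<in> carrier_mat r r. \<forall>g \<in> GL r.
        mat m n (\<lambda>(i, j). livf r X (\<lambda>h. F h $$ (i, j)) g) + b X * F g = F g * a X)"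

definition hom_Gm :: "nat \<Rightarrow> complex mat \<Rightarrow> nat \<Rightarrow> complex mat \<Rightarrow> (complex \<Rightarrow> complex mat) \<Rightarrow> bool" where
  "hom_Gm n A m B F \<longleftrightarrow>
     (\<forall>z. z \<noteq> 0 \<longrightarrow> F z \<in> carrier_mat m n) \<and>
     (\<forall>i < m. \<forall>j < n. regular_Gm (\<lambda>z. F z $$ (i, j))) \<and>
     (\<forall>z. z \<noteq> 0 \<longrightarrow>
        mat m n (\<lambda>(i, j). livf_Gm (\<lambda>w. F w $$ (i, j)) z) + B * F z = F z * A)"

text \<open>det^*(A dz/z) is left-invariant; its value on L_X is (d det)_1(X) / det 1 times A.\<close>
definition pullback_obj :: "nat \<Rightarrow> complex mat \<Rightarrow> complex mat \<Rightarrow> complex mat" where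
  "pullback_obj r A X = (SOME D. ((\<lambda>t. det (1\<^sub>m r + t \<cdot>\<^sub>m X)) has_field_derivative D) (at 0)) \<cdot>\<^sub>m A"

definition pullback_hom :: "(complex \<Rightarrow> complex mat) \<Rightarrow> complex mat \<Rightarrow> complex mat" where
  "pullback_hom F g = F (det g)"

definition kron :: "complex mat \<Rightarrow> complex mat \<Rightarrow> complex mat" where
  "kron P Q = mat (dim_row P * dim_row Q) (dim_col P * dim_col Q)
     (\<lambda>(i, j). P $$ (i div dim_row Q, j div dim_col Q) * Q $$ (i mod dim_row Q, j mod dim_col Q))"

definition tensor_GL :: "nat \<Rightarrow> (complex mat \<Rightarrow> complex mat) \<Rightarrow> nat \<Rightarrow> (complex mat \<Rightarrow> complex mat)
                         \<Rightarrow> complex mat \<Rightarrow> complex mat" where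
  "tensor_GL n a m b X = kron (a X) (1\<^sub>m m) + kron (1\<^sub>m n) (b X)"

definition tensor_Gm :: "nat \<Rightarrow> complex mat \<Rightarrow> nat \<Rightarrow> complex mat \<Rightarrow> complex mat" where
  "tensor_Gm n A m B = kron A (1\<^sub>m m) + kron (1\<^sub>m n) B"

definition tensor_hom_GL :: "(complex mat \<Rightarrow> complex mat) \<Rightarrow> (complex mat \<Rightarrow> complex mat) \<Rightarrow> complex mat \<Rightarrow> complex mat" where
  "tensor_hom_GL F G g = kron (F g) (G g)"

definition tensor_hom_Gm :: "(complex \<Rightarrow> complex mat) \<Rightarrow> (complex \<Rightarrow> complex mat) \<Rightarrow> complex \<Rightarrow> complex mat" where
  "tensor_hom_Gm F G z = kron (F z) (G z)"

end

theory Submission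
  imports Defs
begin

text \<open>
  Fullness. A morphism between pullbacks is determined by its value at \<open>1\<close>: on the
  line through \<open>1\<close> and \<open>g\<close> the equation is a polynomial linear ODE that is regular at the starting point.
  So a morphism \<open>G\<close> agrees with \<open>g \<mapsto> G (diag (det g, 1, \<dots>, 1))\<close>, which factors through the determinant.

  Essential surjectivity. Given a flat \<open>a\<close>, that is a representation of \<open>gl\<^sub>r\<close>, put
  \<open>A = a E\<^sub>1\<^sub>1 + K\<close> for a large integer \<open>K\<close>. A morphism from \<open>det\<^sup>* A\<close> to \<open>a\<close> is a solution \<open>F\<close> of
  \<open>L\<^sub>X F = tr X F A - a X F\<close>. The right-hand side defines a representation of \<open>gl\<^sub>r\<close> on matrices, and
  the Taylor coefficients of \<open>F\<close> at \<open>1\<close> in the linear coordinates \<open>g - 1\<close> satisfy a recursion that is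
  consistent by the bracket relation. A Taylor coefficient with many indices in one row vanishes: those
  off the diagonal act by commuting nilpotent matrices, and those on the diagonal contribute a falling
  factorial of an operator with finitely many nonnegative integral eigenvalues and no Jordan blocks (by
  \<open>sl\<^sub>2\<close> theory and since \<open>K\<close> is large). Hence \<open>F\<close> is a polynomial, so no analytic integration of the
  representation is needed. The dual representation yields the inverse of \<open>F\<close>, up to a power of \<open>det\<close>.
\<close>

section \<open>Integrality of weights\<close>

text \<open>Formally the sought morphism is F(g) = rho(g)^(-1) det(g)^A, where rho integrates
  \<open>a\<close>. On the diagonal matrix with z at place p and 1 elsewhere this is z^(K - H) with
  H = a(E_pp) - a(E_11). So the multivalued factors cancel once H is diagonalizable with integral
  eigenvalues, and poles disappear once K is at least as large as these; the falling factorials are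
  the derivatives of z^(K - H) at 1. The choice of E_11 is explained by the section z -> diag(z, 1,
  ..., 1) of det, whose velocity it is; the rest of \<open>a\<close> lives on sl_r, whose
  representations integrate to SL_r. To replace this integration by algebra, the integrality of H is
  derived from an identity in an associative algebra. Hence the class \<open>real_algebra_1\<close>
  below, and hence the later embedding of matrices of every size into one type of that
  class.\<close>

definition nexp :: "nat \<Rightarrow> 'a::real_algebra_1 \<Rightarrow> 'a" where
  "nexp N x = (\<Sum>k<N. x ^ k /\<^sub>R fact k)"

lemma power_zero_le:
  fixes x :: "'a::ring_1"
  assumes "x ^ N = 0" "N \<le> k" shows "x ^ k = 0"
proof -
  have "x ^ k = x ^ N * x ^ (k - N)" using assms(2) by (simp flip: power_add)
  then show ?thesis using assms(1) by simp
qed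

lemma nexp_extend:
  fixes x :: "'a::real_algebra_1"
  assumes "x ^ N = 0" "N \<le> M"
  shows "nexp M x = nexp N x"
  unfolding nexp_def
  by (rule sum.mono_neutral_right) (use assms in \<open>auto intro!: power_zero_le[of x N]\<close>)

text \<open>This is the Leibniz rule for iterated commutators with \<open>x\<close>:
  \<open>c\<close> is the first, \<open>2 d\<close> the second, and the third is zero. The binomial
  coefficient at \<open>d\<close> is doubled because \<open>d\<close> is half of the second
  commutator.\<close>

lemma power_commutator:
  fixes x y c d :: "'a::real_algebra_1"
  assumes xy: "x * y = y * x + c" and xc: "x * c = c * x + 2 *\<^sub>R d" and xd: "x * d = d * x"
  shows "x ^ Suc (Suc k) * y = y * x ^ Suc (Suc k) + real (Suc (Suc k)) *\<^sub>R (c * x ^ Suc k)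
           + real (Suc k * Suc (Suc k)) *\<^sub>R (d * x ^ k)"
proof (induction k)
  case 0
  have "x * (x * y) = x * (y * x + c)" using xy by simp
  also have "\<dots> = (x * y) * x + x * c" by (simp add: distrib_left mult.assoc)
  finally show ?case by (simp add: xy xc algebra_simps scaleR_2)
next
  case (Suc k)
  have "x ^ Suc (Suc (Suc k)) * y = x * (x ^ Suc (Suc k) * y)" by (simp add: mult.assoc)
  also have "\<dots> = (x * y) * x ^ Suc (Suc k) + real (Suc (Suc k)) *\<^sub>R ((x * c) * x ^ Suc k)
           + real (Suc k * Suc (Suc k)) *\<^sub>R ((x * d) * x ^ k)"
    unfolding Suc by (simp only: distrib_left mult_scaleR_right mult.assoc)
  also have "\<dots> = y * x ^ Suc (Suc (Suc k)) + (1 + real (Suc (Suc k))) *\<^sub>R (c * x ^ Suc (Suc k))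
           + (2 * real (Suc (Suc k)) + real (Suc k * Suc (Suc k))) *\<^sub>R (d * x ^ Suc k)"
    unfolding xy xc xd
    by (simp only: distrib_right scaleR_add_left scaleR_add_right scaleR_one mult_scaleR_left scaleR_scaleR
        mult.assoc power_Suc add.assoc mult.commute[of _ "2::real"] add_ac)
  finally show ?case by (simp add: algebra_simps)
qed

text \<open>For nilpotent \<open>x\<close> this is \<open>exp(x) y exp(-x) = exp(ad x) y\<close>, in the case \<open>(ad x)\<^sup>3 y = 0\<close>.\<close>
lemma nexp_commutator:
  fixes x y c d :: "'a::real_algebra_1"
  assumes xy: "x * y = y * x + c" and xc: "x * c = c * x + 2 *\<^sub>R d" and xd: "x * d = d * x"
    and nil: "x ^ N = 0"
  shows "nexp N x * y = (y + c + d) * nexp N x"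
proof -
  have summand: "(x ^ Suc (Suc k) /\<^sub>R fact (Suc (Suc k))) * y = y * (x ^ Suc (Suc k) /\<^sub>R fact (Suc (Suc k)))
      + c * (x ^ Suc k /\<^sub>R fact (Suc k)) + d * (x ^ k /\<^sub>R fact k)" for k
  proof -
    have "inverse (fact (Suc (Suc k))) * real (Suc (Suc k)) = inverse (fact (Suc k) :: real)"
      "inverse (fact (Suc (Suc k))) * real (Suc k * Suc (Suc k)) = inverse (fact k :: real)"
      unfolding fact_Suc[of "Suc k"] by (simp_all add: inverse_eq_divide divide_simps mult_ac del: of_nat_Suc mult_Suc mult_Suc_right)
    then show ?thesis
      unfolding mult_scaleR_left mult_scaleR_right power_commutator[OF xy xc xd] scaleR_add_right scaleR_scaleR
      by (simp only:)
  qed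
  \<comment> \<open>Padding by two zero terms allows one or two terms to be peeled off, so that the
    contributions of \<open>y\<close>, \<open>c\<close> and \<open>d\<close>, shifted by 0, 1 and 2
    in the exponent, all become full exponentials.\<close>
  have ext: "nexp (Suc N) x = nexp N x" "nexp (Suc (Suc N)) x = nexp N x"
    using nexp_extend[OF nil, of "Suc N"] nexp_extend[OF nil, of "Suc (Suc N)"] by simp_all
  have "nexp N x * y = nexp (Suc (Suc N)) x * y" unfolding ext ..
  also have "\<dots> = y + x * y + (\<Sum>k<N. (x ^ Suc (Suc k) /\<^sub>R fact (Suc (Suc k))) * y)"
    unfolding nexp_def sum.lessThan_Suc_shift by (simp add: distrib_right sum_distrib_right add.assoc del: fact_Suc power_Suc)
  also have "\<dots> = (y + y * x + y * (\<Sum>k<N. x ^ Suc (Suc k) /\<^sub>R fact (Suc (Suc k))))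
      + (c + c * (\<Sum>k<N. x ^ Suc k /\<^sub>R fact (Suc k))) + d * (\<Sum>k<N. x ^ k /\<^sub>R fact k)"
    unfolding summand xy by (simp add: sum.distrib sum_distrib_left add_ac del: fact_Suc power_Suc)
  also have "\<dots> = y * nexp (Suc (Suc N)) x + c * nexp (Suc N) x + d * nexp N x"
    unfolding nexp_def sum.lessThan_Suc_shift by (simp add: distrib_left add_ac del: fact_Suc power_Suc)
  also have "\<dots> = (y + c + d) * nexp N x" unfolding ext by (simp add: distrib_right)
  finally show ?thesis .
qed

lemma power_mult_commuting:
  fixes x y :: "'a::monoid_mult"
  assumes "x * y = y * x" shows "(x * y) ^ k = x ^ k * y ^ k"
proof (induction k)
  case (Suc k)
  have "x * y * (x ^ k * y ^ k) = x * (y * x ^ k) * y ^ k" by (simp add: mult.assoc)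
  also have "y * x ^ k = x ^ k * y" using power_commuting_commutes[OF assms] by simp
  finally show ?case using Suc by (simp add: mult.assoc)
qed simp

text \<open>The truncated exponential is 1 plus a nilpotent multiple of \<open>x\<close>, so a
  finite geometric series inverts it; no product of two exponentials has to be expanded.\<close>

lemma nexp_right_inverse:
  fixes x :: "'a::real_algebra_1"
  assumes "x ^ Suc N = 0"
  obtains y where "nexp (Suc N) x * y = 1"
proof -
  define q where "q = (\<Sum>k<N. x ^ k /\<^sub>R fact (Suc k))"
  have ex: "nexp (Suc N) x = 1 + x * q"
    unfolding nexp_def sum.lessThan_Suc_shift q_def by (simp add: sum_distrib_left del: fact_Suc)
  have comm: "x * q = q * x"
    unfolding q_def by (simp add: sum_distrib_left sum_distrib_right power_commutes)
  have "(- (x * q)) ^ Suc N = (-1) ^ Suc N * (x ^ Suc N * q ^ Suc N)"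
    by (subst power_mult_commuting[OF comm, of "Suc N", symmetric]) (rule power_minus)
  then have nil: "(- (x * q)) ^ Suc N = 0" using assms by simp
  have tel: "(1 - z) * (\<Sum>k<M. z ^ k) = 1 - z ^ M" for z :: 'a and M
  proof (induction M)
    case (Suc M)
    then show ?case unfolding sum.lessThan_Suc distrib_left Suc by (simp add: left_diff_distrib)
  qed simp
  have "nexp (Suc N) x * (\<Sum>k<Suc N. (- (x * q)) ^ k) = 1"
    using tel[of "- (x * q)" "Suc N"] unfolding nil ex by simp
  then show thesis by (rule that)
qed

lemma prod_list_commute:
  fixes x :: "'a::monoid_mult"
  assumes "\<And>y. y \<in> set ys \<Longrightarrow> x * y = y * x"
  shows "x * prod_list ys = prod_list ys * x"
  using assms
proof (induction ys)
  case (Cons y ys)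
  have "x * (y * prod_list ys) = y * (x * prod_list ys)"
    using Cons.prems[of y] by (simp flip: mult.assoc)
  then show ?case using Cons by (simp add: mult.assoc)
qed simp

lemma power_ad_eigenvector:
  fixes h x :: "'a::real_algebra_1"
  assumes "h * x = x * h + m *\<^sub>R x"
  shows "h * x ^ k = x ^ k * h + (real k * m) *\<^sub>R x ^ k"
proof (induction k)
  case (Suc k)
  have "h * x ^ Suc k = (h * x) * x ^ k" by (simp add: mult.assoc)
  also have "\<dots> = x * (h * x ^ k) + m *\<^sub>R x ^ Suc k" unfolding assms by (simp add: distrib_right mult.assoc)
  also have "\<dots> = x ^ Suc k * h + (real (Suc k) * m) *\<^sub>R x ^ Suc k"
    unfolding Suc by (simp add: distrib_left mult.assoc algebra_simps)
  finally show ?case .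
qed simp

text \<open>Here \<open>w = exp(e) exp(-f) exp(e)\<close> represents the Weyl element, so that \<open>h w = - w h\<close>. Writing
  \<open>w\<close> as a sum of monomials \<open>T\<close> with \<open>h T = T h + 2 m T\<close>, this forces \<open>p(h) w = \<Sum> p(m) T\<close>
  for every polynomial \<open>p\<close>.\<close>
lemma sl2_integral_semisimple:
  fixes e f h :: "'a::real_algebra_1"
  assumes ef: "e * f = f * e + h" and he: "h * e = e * h + 2 *\<^sub>R e" and hf: "h * f = f * h - 2 *\<^sub>R f"
    and nil: "e ^ Suc N = 0" "f ^ Suc N = 0"
  shows "(\<Prod>k\<leftarrow>[- int N..2 * int N]. h - of_int k) = 0"
proof -
  define M where "M = Suc N"
  define w where "w = nexp M e * (nexp M (- f) * nexp M e)"
  define T where "T = (\<lambda>(a, b, c). (inverse (fact a * fact b * fact c) :: real) *\<^sub>R (e ^ a * ((- f) ^ b * e ^ c)))"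
  define I where "I = {..<M} \<times> {..<M} \<times> {..<M}"
  \<comment> \<open>Each factor \<open>e\<close> raises the weight under commutation with
    \<open>h\<close> by 2 and each \<open>f\<close> lowers it by 2; \<open>m\<close> is half the
    total. Exponents are at most \<open>N\<close>, so \<open>m\<close> lies between
    \<open>- N\<close> and \<open>2 * N\<close>: this is the range of the product in the
    conclusion.\<close>
  define m :: "nat \<times> nat \<times> nat \<Rightarrow> int" where "m = (\<lambda>(a, b, c). int a - int b + int c)"
  have w_sum: "w = sum T I"
  proof -
    have "w = (\<Sum>a<M. \<Sum>b<M. \<Sum>c<M. T (a, b, c))"
      unfolding w_def nexp_def T_def sum_distrib_right
      by (simp add: sum_distrib_left scaleR_sum_right mult_ac)
    then show ?thesis unfolding I_def by (simp add: sum.cartesian_product case_prod_beta')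
  qed
  have hT: "h * T t = T t * h + (2 * real_of_int (m t)) *\<^sub>R T t" for t
  proof -
    obtain a b c where t: "t = (a, b, c)" by (cases t) auto
    have 1: "h * e ^ k = e ^ k * h + (real k * 2) *\<^sub>R e ^ k" for k
      by (rule power_ad_eigenvector[OF he])
    have 2: "h * (- f) ^ k = (- f) ^ k * h + (real k * - 2) *\<^sub>R (- f) ^ k" for k
      by (rule power_ad_eigenvector) (simp add: hf)
    have "h * (e ^ a * ((- f) ^ b * e ^ c)) = (h * e ^ a) * ((- f) ^ b * e ^ c)" by (simp add: mult.assoc)
    also have "\<dots> = e ^ a * ((h * (- f) ^ b) * e ^ c) + (real a * 2) *\<^sub>R (e ^ a * ((- f) ^ b * e ^ c))"
      unfolding 1 by (simp add: distrib_right mult.assoc)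
    also have "\<dots> = e ^ a * ((- f) ^ b * (h * e ^ c)) + (real a * 2 - real b * 2) *\<^sub>R (e ^ a * ((- f) ^ b * e ^ c))"
      unfolding 2 by (simp add: distrib_right distrib_left mult.assoc algebra_simps)
    also have "\<dots> = e ^ a * ((- f) ^ b * e ^ c) * h + (real a * 2 - real b * 2 + real c * 2) *\<^sub>R (e ^ a * ((- f) ^ b * e ^ c))"
      unfolding 1 by (simp add: distrib_left mult.assoc scaleR_add_left)
    finally have "h * (e ^ a * ((- f) ^ b * e ^ c)) = e ^ a * ((- f) ^ b * e ^ c) * h
        + (2 * real_of_int (m t)) *\<^sub>R (e ^ a * ((- f) ^ b * e ^ c))"
      by (simp add: m_def t algebra_simps)
    then show ?thesis unfolding t T_def
      by (simp only: mult_scaleR_left mult_scaleR_right scaleR_add_right scaleR_scaleR case_prod_conv)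
        (simp add: mult.commute)
  qed
  have nile: "e ^ M = 0" and nilf: "(- f) ^ M = 0" using nil unfolding M_def power_minus[of f] by simp_all
  have eh: "nexp M e * h = (h + (- (2 *\<^sub>R e)) + 0) * nexp M e"
    by (rule nexp_commutator) (simp_all add: nile he)
  have fh: "nexp M (- f) * h = (h + (- (2 *\<^sub>R f)) + 0) * nexp M (- f)"
    by (rule nexp_commutator) (simp_all add: nilf hf)
  have fe: "nexp M (- f) * e = (e + h + (- f)) * nexp M (- f)"
    by (rule nexp_commutator) (simp_all add: nilf hf ef)
  have ee: "nexp M e * e = e * nexp M e"
    unfolding nexp_def by (simp add: sum_distrib_left sum_distrib_right power_commutes)
  \<comment> \<open>The Weyl reflection: conjugating \<open>h\<close> by the three exponentials in
    turn gives h - 2e, then - h - 2e, then - h.\<close>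
  have wh: "w * h = - (h * w)"
  proof -
    have "w * h = nexp M e * (nexp M (- f) * (h - 2 *\<^sub>R e) * nexp M e)"
      unfolding w_def mult.assoc eh by simp
    also have "nexp M (- f) * (h - 2 *\<^sub>R e) = (- h - 2 *\<^sub>R e) * nexp M (- f)"
    proof -
      have "nexp M (- f) * (h - 2 *\<^sub>R e) = nexp M (- f) * h - 2 *\<^sub>R (nexp M (- f) * e)"
        by (simp add: right_diff_distrib)
      then show ?thesis unfolding fh fe by (simp add: algebra_simps scaleR_2)
    qed
    also have "nexp M e * ((- h - 2 *\<^sub>R e) * nexp M (- f) * nexp M e)
       = - (nexp M e * h + 2 *\<^sub>R (nexp M e * e)) * (nexp M (- f) * nexp M e)"
      by (simp add: algebra_simps mult.assoc)
    also have "\<dots> = - (h * w)" unfolding eh ee w_def by (simp add: algebra_simps mult.assoc)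
    finally show ?thesis .
  qed
  have key: "(\<Prod>k\<leftarrow>ks. h - of_int k) * w = (\<Sum>t\<in>I. (\<Prod>k\<leftarrow>ks. real_of_int (m t - k)) *\<^sub>R T t)" for ks
  proof (induction ks)
    case (Cons k ks)
    define Q where "Q = (\<Prod>k\<leftarrow>ks. h - of_int k)"
    define q where "q t = (\<Prod>k\<leftarrow>ks. real_of_int (m t - k))" for t
    have Qw: "Q * w = (\<Sum>t\<in>I. q t *\<^sub>R T t)" using Cons unfolding Q_def q_def .
    have hQ: "h * Q = Q * h" unfolding Q_def
      by (rule prod_list_commute) (auto simp: left_diff_distrib right_diff_distrib mult_of_int_commute)
    have "h * (Q * w) = (\<Sum>t\<in>I. q t *\<^sub>R (h * T t))" unfolding Qw by (simp add: sum_distrib_left)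
    also have "\<dots> = (Q * w) * h + 2 *\<^sub>R (\<Sum>t\<in>I. (q t * m t) *\<^sub>R T t)"
      unfolding hT Qw by (simp add: sum_distrib_right scaleR_sum_right sum.distrib algebra_simps)
    also have "(Q * w) * h = - (Q * h * w)" by (simp add: wh mult.assoc)
    also have "Q * h * w = h * (Q * w)" unfolding hQ[symmetric] by (rule mult.assoc)
    \<comment> \<open>The factor \<open>h\<close> on the right has come back as
      \<open>- h * (Q * w)\<close>. Both sides are therefore doubled, and after halving
      \<open>h\<close> acts in the sum as if by the scalar \<open>m t\<close> on
      \<open>T t\<close>.\<close>
    finally have "h * (Q * w) + h * (Q * w) = 2 *\<^sub>R (\<Sum>t\<in>I. (q t * m t) *\<^sub>R T t)"
      by (metis add_minus_cancel)
    then have "2 *\<^sub>R (h * (Q * w)) = 2 *\<^sub>R (\<Sum>t\<in>I. (q t * m t) *\<^sub>R T t)" unfolding scaleR_2 .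
    then have hQw: "h * (Q * w) = (\<Sum>t\<in>I. (q t * m t) *\<^sub>R T t)" by (rule scaleR_left_imp_eq[rotated]) simp
    have "(h - of_int k) * Q * w = h * (Q * w) - real_of_int k *\<^sub>R (Q * w)"
      by (simp add: left_diff_distrib mult.assoc scaleR_conv_of_real)
    also have "\<dots> = (\<Sum>t\<in>I. (q t * m t - k * q t) *\<^sub>R T t)"
      unfolding hQw by (simp add: Qw scaleR_sum_right sum_subtractf scaleR_diff_left)
    finally show ?case unfolding Q_def q_def by (simp add: algebra_simps)
  qed (simp add: w_sum)
  have zero: "(\<Prod>k\<leftarrow>[- int N..2 * int N]. real_of_int (m t - k)) = 0" if "t \<in> I" for t
    using that unfolding prod_list_zero_iff by (auto simp: I_def M_def m_def image_iff)
  have Qw: "(\<Prod>k\<leftarrow>[- int N..2 * int N]. h - of_int k) * w = 0" (is "?Q * w = 0")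
    unfolding key by (intro sum.neutral ballI) (simp only: zero scaleR_zero_left)
  \<comment> \<open>The right inverse \<open>y * (z * y)\<close> of \<open>w\<close> strips
    \<open>w\<close> from \<open>?Q * w = 0\<close>.\<close>
  obtain y where y: "nexp M e * y = 1"
    using nexp_right_inverse[OF nil(1)] unfolding M_def by blast
  obtain z where z: "nexp M (- f) * z = 1"
    using nexp_right_inverse[OF nilf[unfolded M_def]] unfolding M_def by blast
  have "w * (y * (z * y)) = nexp M e * (nexp M (- f) * (nexp M e * y) * z) * y"
    unfolding w_def by (simp only: mult.assoc)
  also have "\<dots> = 1" using y z by simp
  finally have "?Q = ?Q * w * (y * (z * y))" by (simp only: mult.assoc mult_1_right)
  then show ?thesis unfolding Qw by simp
qed

section \<open>Nilpotency, and matrices as linear operators\<close>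

text \<open>As in the proof that eigenvectors for distinct eigenvalues are independent, commuting a
  relation with \<open>h\<close> and subtracting \<open>l * m\<close> times the relation removes the
  power \<open>l\<close>. The last power left over must itself vanish.\<close>

lemma vanishing_power_of_dependence:
  fixes h x :: "'a::real_algebra_1"
  assumes hx: "h * x = x * h + m *\<^sub>R x" and "m \<noteq> 0" and "finite S" "S \<noteq> {}"
    and "\<And>k. k \<in> S \<Longrightarrow> c k \<noteq> 0" and "(\<Sum>k\<in>S. c k *\<^sub>R x ^ k) = 0"
  shows "\<exists>k\<in>S. x ^ k = 0"
  using assms(3-)
proof (induction S arbitrary: c rule: finite_psubset_induct)
  case (psubset S)
  then obtain l where l: "l \<in> S" by auto
  show ?case
  proof (cases "S = {l}")
    case True
    then show ?thesis using psubset.prems by auto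
  next
    case False
    have "0 = h * (\<Sum>k\<in>S. c k *\<^sub>R x ^ k) - (\<Sum>k\<in>S. c k *\<^sub>R x ^ k) * h - (real l * m) *\<^sub>R (\<Sum>k\<in>S. c k *\<^sub>R x ^ k)"
      using psubset.prems by simp
    also have "\<dots> = (\<Sum>k\<in>S. c k *\<^sub>R (h * x ^ k) - c k *\<^sub>R (x ^ k * h) - (real l * m * c k) *\<^sub>R x ^ k)"
      by (simp add: sum_distrib_left sum_distrib_right scaleR_sum_right sum_subtractf)
    also have "\<dots> = (\<Sum>k\<in>S. (c k * (real k - real l) * m) *\<^sub>R x ^ k)"
      unfolding power_ad_eigenvector[OF hx] by (rule sum.cong) (auto simp: algebra_simps)
    also have "\<dots> = (\<Sum>k\<in>S - {l}. (c k * (real k - real l) * m) *\<^sub>R x ^ k)"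
      using psubset.hyps l by (intro sum.mono_neutral_right) auto
    finally have "\<exists>k\<in>S - {l}. x ^ k = 0"
      using psubset.prems l False \<open>m \<noteq> 0\<close>
      by (intro psubset.IH[of "S - {l}" "\<lambda>k. c k * (real k - real l) * m"]) auto
    then show ?thesis by auto
  qed
qed

text \<open>Otherwise the powers of \<open>x\<close> would be infinitely many independent
  eigenvectors in a finite-dimensional space. Exponents start at 1 because the unit of the algebra
  may lie outside the span, as it does for matrices inside \<open>linop\<close>.\<close>

lemma nilpotent_of_finite_span:
  fixes h x :: "'a::real_algebra_1"
  assumes hx: "h * x = x * h + m *\<^sub>R x" and "m \<noteq> 0" and "finite B"
    and span: "\<And>k. x ^ Suc k \<in> span B"
  shows "\<exists>N. x ^ Suc N = 0"
proof (rule ccontr)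
  assume "\<not> ?thesis"
  then have nz: "x ^ Suc N \<noteq> 0" for N by auto
  have nd: False if S: "finite S" "S \<noteq> {}" "S \<subseteq> {0<..}" "\<And>k. k \<in> S \<Longrightarrow> c k \<noteq> 0" "(\<Sum>k\<in>S. c k *\<^sub>R x ^ k) = 0" for S c
  proof -
    obtain k where "k \<in> S" "x ^ k = 0"
      using vanishing_power_of_dependence[OF hx \<open>m \<noteq> 0\<close> S(1,2,4,5)] by blast
    then show False using S(3) nz[of "k - 1"] by (cases k) auto
  qed
  define I where "I = {1..Suc (card B)}"
  have inj: "inj_on (\<lambda>k. x ^ k) I"
  proof (rule inj_onI, rule ccontr)
    fix k l assume kl: "k \<in> I" "l \<in> I" "x ^ k = x ^ l" "k \<noteq> l"
    then show False by (intro nd[of "{k, l}" "\<lambda>j. if j = k then 1 else -1"]) (auto simp: I_def split: if_splits)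
  qed
  have "independent ((\<lambda>k. x ^ k) ` I)"
  proof (rule ccontr)
    assume "\<not> independent ((\<lambda>k. x ^ k) ` I)"
    then have "dependent ((\<lambda>k. x ^ k) ` I)" by simp
    then obtain u where u: "\<exists>v\<in>(\<lambda>k. x ^ k) ` I. u v \<noteq> 0" "(\<Sum>v\<in>(\<lambda>k. x ^ k) ` I. u v *\<^sub>R v) = 0"
      by (subst (asm) dependent_finite) (auto simp: I_def)
    define S where "S = {k \<in> I. u (x ^ k) \<noteq> 0}"
    have "(\<Sum>k\<in>S. u (x ^ k) *\<^sub>R x ^ k) = (\<Sum>k\<in>I. u (x ^ k) *\<^sub>R x ^ k)"
      unfolding S_def by (rule sum.mono_neutral_left) (auto simp: I_def)
    also have "\<dots> = 0" using u(2) by (simp add: sum.reindex[OF inj])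
    finally show False using u(1) by (intro nd[of S "\<lambda>k. u (x ^ k)"]) (auto simp: S_def I_def)
  qed
  moreover have "(\<lambda>k. x ^ k) ` I \<subseteq> span B"
  proof
    fix y assume "y \<in> (\<lambda>k. x ^ k) ` I"
    then obtain k where "y = x ^ k" "k \<ge> 1" by (auto simp: I_def)
    then show "y \<in> span B" using span[of "k - 1"] by simp
  qed
  ultimately have "card ((\<lambda>k. x ^ k) ` I) \<le> card B"
    using independent_span_bound[OF \<open>finite B\<close>] by blast
  then show False unfolding card_image[OF inj] by (simp add: I_def)
qed

section \<open>Linear operators on complex sequences, an algebra containing all matrix
  algebras\<close>

text \<open>Matrices of arbitrary size do not satisfy the ring axioms as a type. Letting every size
  act on the one space of sequences gives a single type to which the preceding results
  apply.\<close>

typedef linop = "{f :: (nat \<Rightarrow> complex) \<Rightarrow> nat \<Rightarrow> complex.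
    (\<forall>x y. f (\<lambda>i. x i + y i) = (\<lambda>i. f x i + f y i)) \<and> (\<forall>c x. f (\<lambda>i. c * x i) = (\<lambda>i. c * f x i))}"
  by (rule exI[of _ "\<lambda>x. x"]) simp

setup_lifting type_definition_linop

lemma Rep_linop_add: "Rep_linop f (\<lambda>i. x i + y i) = (\<lambda>i. Rep_linop f x i + Rep_linop f y i)"
  and Rep_linop_mult: "Rep_linop f (\<lambda>i. c * x i) = (\<lambda>i. c * Rep_linop f x i)"
  using Rep_linop[of f] by auto

lemma Rep_linop_0: "Rep_linop f (\<lambda>i. 0) = (\<lambda>i. 0)"
  using Rep_linop_mult[of f 0 "\<lambda>i. 0"] by simp

lemma Rep_linop_sum: "Rep_linop f (\<lambda>i. \<Sum>s\<in>S. x s i) = (\<lambda>i. \<Sum>s\<in>S. Rep_linop f (x s) i)"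
  by (induction S rule: infinite_finite_induct) (auto simp: Rep_linop_0 Rep_linop_add)

instantiation linop :: real_algebra_1
begin

lift_definition zero_linop :: linop is "\<lambda>x i. 0" by simp
lift_definition one_linop :: linop is "\<lambda>x. x" by simp
lift_definition plus_linop :: "linop \<Rightarrow> linop \<Rightarrow> linop" is "\<lambda>f g x i. f x i + g x i"
  by (auto simp: algebra_simps)
lift_definition minus_linop :: "linop \<Rightarrow> linop \<Rightarrow> linop" is "\<lambda>f g x i. f x i - g x i"
  by (auto simp: algebra_simps)
lift_definition uminus_linop :: "linop \<Rightarrow> linop" is "\<lambda>f x i. - f x i"
  by (auto simp: algebra_simps)
lift_definition times_linop :: "linop \<Rightarrow> linop \<Rightarrow> linop" is "\<lambda>f g x. f (g x)"
  by auto
lift_definition scaleR_linop :: "real \<Rightarrow> linop \<Rightarrow> linop" is "\<lambda>c f x i. of_real c * f x i"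
  by (auto simp: algebra_simps)

lemmas linop_eqI = Rep_linop_inject[THEN iffD1, OF ext, OF ext]

lemmas Rep_linop_simps = zero_linop.rep_eq one_linop.rep_eq plus_linop.rep_eq minus_linop.rep_eq
  uminus_linop.rep_eq times_linop.rep_eq scaleR_linop.rep_eq

instance
proof
  have "Rep_linop 0 (\<lambda>_. 1) 0 \<noteq> Rep_linop 1 (\<lambda>_. 1) 0" by (simp add: Rep_linop_simps)
  then show "(0::linop) \<noteq> 1" by metis
qed (rule linop_eqI; simp add: Rep_linop_simps algebra_simps Rep_linop_add Rep_linop_mult)+

end

text \<open>The matrix acts on the first \<open>n\<close> coordinates and kills the others. On
  square matrices of size \<open>n\<close> this is multiplicative but not unital: the identity
  matrix becomes a projection.\<close>

lift_definition of_mat :: "nat \<Rightarrow> complex mat \<Rightarrow> linop" is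
  "\<lambda>n A x i. if i < n then \<Sum>j<n. A $$ (i, j) * x j else 0"
  by (auto simp: algebra_simps sum.distrib sum_distrib_left)

definition entry :: "nat \<Rightarrow> nat \<Rightarrow> linop \<Rightarrow> complex" where
  "entry i j f = Rep_linop f (\<lambda>k. if k = j then 1 else 0) i"

lemma entry_simps [simp]:
  "entry i j 0 = 0" "entry i j (f + g) = entry i j f + entry i j g"
  "entry i j (f - g) = entry i j f - entry i j g" "entry i j (- f) = - entry i j f"
  "entry i j (c *\<^sub>R f) = of_real c * entry i j f"
  by (simp_all add: entry_def Rep_linop_simps)

lemma of_mat_apply_unit:
  "v < n \<Longrightarrow> Rep_linop (of_mat n A) (\<lambda>k. if k = v then 1 else 0) = (\<lambda>i. if i < n then A $$ (i, v) else 0)"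
  by (rule ext) (simp add: of_mat.rep_eq if_distrib cong: if_cong)

lemma entry_of_mat [simp]: "i < n \<Longrightarrow> j < n \<Longrightarrow> entry i j (of_mat n A) = A $$ (i, j)"
  by (simp add: entry_def of_mat_apply_unit)

lemma entry_of_mat_mult:
  "u < n \<Longrightarrow> entry u v (of_mat n A * f) = (\<Sum>s<n. A $$ (u, s) * entry s v f)"
  by (simp add: entry_def Rep_linop_simps of_mat.rep_eq)

lemma entry_mult_of_mat:
  assumes "v < n"
  shows "entry u v (f * of_mat n A) = (\<Sum>s<n. entry u s f * A $$ (s, v))"
proof -
  have "(\<lambda>i. if i < n then A $$ (i, v) else 0) = (\<lambda>i. \<Sum>s<n. A $$ (s, v) * (if i = s then 1 else 0))"
    by (auto simp: if_distrib cong: if_cong)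
  then show ?thesis using assms
    by (simp add: entry_def Rep_linop_simps of_mat_apply_unit Rep_linop_sum Rep_linop_mult mult.commute)
qed

lemma of_mat_diff: "A \<in> carrier_mat n n \<Longrightarrow> B \<in> carrier_mat n n \<Longrightarrow> of_mat n (A - B) = of_mat n A - of_mat n B"
  by (rule linop_eqI) (auto simp: Rep_linop_simps of_mat.rep_eq algebra_simps sum_subtractf intro!: sum.cong)

lemma of_mat_0: "of_mat n (0\<^sub>m n n) = 0"
  by (rule linop_eqI) (auto simp: Rep_linop_simps of_mat.rep_eq)

lemma of_mat_mult:
  assumes "A \<in> carrier_mat n n" "B \<in> carrier_mat n n"
  shows "of_mat n (A * B) = of_mat n A * of_mat n B"
proof (rule linop_eqI)
  fix x i
  have "(\<Sum>j<n. (A * B) $$ (i, j) * x j) = (\<Sum>k<n. A $$ (i, k) * (\<Sum>j<n. B $$ (k, j) * x j))" if "i < n"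
  proof -
    have "(\<Sum>j<n. (A * B) $$ (i, j) * x j) = (\<Sum>j<n. \<Sum>k<n. A $$ (i, k) * B $$ (k, j) * x j)"
      using assms that
      by (intro sum.cong) (auto simp: scalar_prod_def sum_distrib_right atLeast0LessThan intro!: sum.cong)
    also have "\<dots> = (\<Sum>k<n. \<Sum>j<n. A $$ (i, k) * B $$ (k, j) * x j)" by (rule sum.swap)
    finally show ?thesis by (simp add: sum_distrib_left mult.assoc)
  qed
  then show "Rep_linop (of_mat n (A * B)) x i = Rep_linop (of_mat n A * of_mat n B) x i"
    by (simp add: Rep_linop_simps of_mat.rep_eq)
qed

lemma of_mat_one_left: "of_mat n (1\<^sub>m n) * of_mat n A = of_mat n A"
  by (rule linop_eqI) (simp add: Rep_linop_simps of_mat.rep_eq if_distrib if_distribR cong: if_cong)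

lemma of_mat_one_right: "of_mat n A * of_mat n (1\<^sub>m n) = of_mat n A"
  by (rule linop_eqI) (simp add: Rep_linop_simps of_mat.rep_eq if_distrib if_distribR cong: if_cong)

text \<open>Spans are taken over the reals, so each matrix unit enters twice, with coefficients 1
  and i.\<close>

lemma of_mat_finite_span: "\<exists>B. finite B \<and> range (of_mat n) \<subseteq> span B"
proof -
  define E where "E = (\<lambda>(c, i, j). of_mat n (mat n n (\<lambda>p. if p = (i, j) then c else 0)))"
  define B where "B = E ` ({1, \<i>} \<times> {..<n} \<times> {..<n})"
  have "of_mat n A \<in> span B" for A
  proof -
    have "of_mat n A = (\<Sum>i<n. \<Sum>j<n. Re (A $$ (i, j)) *\<^sub>R E (1, i, j) + Im (A $$ (i, j)) *\<^sub>R E (\<i>, i, j))" (is "_ = ?S")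
    proof (rule linop_eqI)
      fix x k
      have Rs: "Rep_linop (sum f S) x k = (\<Sum>s\<in>S. Rep_linop (f s) x k)" for f :: "nat \<Rightarrow> linop" and S
        by (induction S rule: infinite_finite_induct) (auto simp: Rep_linop_simps)
      have "Rep_linop (E (c, i, j)) x k = (if k = i then c * x j else 0)" if "i < n" "j < n" for c i j
        using that by (auto simp: E_def of_mat.rep_eq if_distrib if_distribR sum.If_cases cong: if_cong)
      then have "Rep_linop ?S x k = (\<Sum>i<n. \<Sum>j<n. if k = i then (of_real (Re (A $$ (i, j))) + of_real (Im (A $$ (i, j))) * \<i>) * x j else 0)"
        by (auto simp: Rs Rep_linop_simps algebra_simps intro!: sum.cong)
      also have "\<dots> = (\<Sum>i<n. if k = i then \<Sum>j<n. A $$ (i, j) * x j else 0)"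
        by (intro sum.cong) (auto simp: mult.commute simp flip: complex_eq)
      finally show "Rep_linop (of_mat n A) x k = Rep_linop ?S x k" by (simp add: of_mat.rep_eq)
    qed
    also have "\<dots> \<in> span B"
      by (intro span_sum span_add span_scale span_base) (auto simp: B_def)
    finally show ?thesis .
  qed
  then show ?thesis by (intro exI[of _ B]) (auto simp: B_def)
qed

lemma of_mat_power: "A \<in> carrier_mat n n \<Longrightarrow> \<exists>C\<in>carrier_mat n n. of_mat n A ^ Suc k = of_mat n C"
  by (induction k) (auto simp flip: of_mat_mult intro: mult_carrier_mat)

lemma of_mat_nilpotent:
  assumes "A \<in> carrier_mat n n" "h * of_mat n A = of_mat n A * h + m *\<^sub>R of_mat n A" "m \<noteq> 0"
  shows "\<exists>N. of_mat n A ^ Suc N = 0"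
proof -
  obtain B where "finite B" "range (of_mat n) \<subseteq> span B" using of_mat_finite_span by blast
  then show ?thesis
    using nilpotent_of_finite_span[OF assms(2,3) \<open>finite B\<close>] of_mat_power[OF assms(1)] by (metis rangeI subsetD)
qed

section \<open>Iterated derivatives of a solution at the identity\<close>

primrec shift :: "nat \<Rightarrow> nat \<Rightarrow> ((nat \<times> nat) list \<Rightarrow> 'a::ab_group_add) \<Rightarrow> (nat \<times> nat) list \<Rightarrow> 'a" where
  "shift i j \<psi> [] = 0"
| "shift i j \<psi> (z # w) = (if snd z = i then \<psi> ((fst z, j) # w) else 0) + shift i j (\<lambda>v. \<psi> (z # v)) w"

lemma shift_add: "shift i j (\<lambda>v. \<psi> v + \<phi> v) w = shift i j \<psi> w + shift i j \<phi> w"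
  by (induction w arbitrary: \<psi> \<phi>) auto

lemma shift_hom:
  assumes "\<And>x y. f (x + y) = f x + f y"
  shows "f (shift i j \<psi> w) = shift i j (\<lambda>v. f (\<psi> v)) w"
proof -
  have "f 0 = 0" using assms[of 0 0] by simp
  then show ?thesis by (induction w arbitrary: \<psi>) (auto simp: assms)
qed

lemma shift_diff: "shift i j (\<lambda>v. \<psi> v - \<phi> v) w = shift i j \<psi> w - shift i j \<phi> w"
  by (induction w arbitrary: \<psi> \<phi>) auto

text \<open>A shift rewrites one column index and leaves all row indices in place. This is why the
  vanishing argument below can count letters by rows.\<close>

lemma shift_cong:
  assumes "\<And>v. map fst v = map fst w \<Longrightarrow> set (map snd v) \<subseteq> insert j (set (map snd w)) \<Longrightarrow> \<psi> v = \<phi> v"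
  shows "shift i j \<psi> w = shift i j \<phi> w"
  using assms
proof (induction w arbitrary: \<psi> \<phi>)
  case (Cons z w)
  have "shift i j (\<lambda>v. \<psi> (z # v)) w = shift i j (\<lambda>v. \<phi> (z # v)) w"
    by (rule Cons.IH) (rule Cons.prems, auto)
  moreover have "\<psi> ((fst z, j) # w) = \<phi> ((fst z, j) # w)" by (rule Cons.prems) auto
  ultimately show ?case by simp
qed simp

lemma shift_zero: "shift i j (\<lambda>v. 0) w = 0"
  by (induction w) auto

text \<open>Identifying the letter \<open>(p, q)\<close> with the elementary matrix \<open>E\<^sub>p\<^sub>q\<close>, \<open>shift i j\<close> is
  the derivation induced by right multiplication with \<open>E\<^sub>i\<^sub>j\<close>.\<close>
lemma shift_commutator:
  "shift i j (shift p q \<psi>) w - shift p q (shift i j \<psi>) w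
     = (if j = p then shift i q \<psi> w else 0) - (if q = i then shift p j \<psi> w else 0)"
proof (induction w arbitrary: \<psi>)
  case (Cons z w)
  show ?case using Cons[of "\<lambda>v. \<psi> (z # v)"] by (auto simp: shift_add algebra_simps shift_zero)
qed simp

section \<open>Functions of words that are invariant under permutation\<close>

definition symm :: "((nat \<times> nat) list \<Rightarrow> 'a) \<Rightarrow> bool" where
  "symm \<psi> \<longleftrightarrow> (\<forall>v w. mset v = mset w \<longrightarrow> \<psi> v = \<psi> w)"

lemma symmD: "symm \<psi> \<Longrightarrow> mset v = mset w \<Longrightarrow> \<psi> v = \<psi> w"
  unfolding symm_def by blast

lemma symm_Cons: "symm \<psi> \<Longrightarrow> symm (\<lambda>v. \<psi> (z # v))"
  unfolding symm_def by auto

text \<open>Exchanging the first two entries, after any common prefix, generates all permutations.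
  If the heads x and y differ, the two lists are linked through x # y # u and y # x # u for a
  suitable rest u.\<close>

lemma mset_eq_list_induct [consumes 1, case_names Nil Cons swap trans]:
  assumes "mset xs = mset ys" and "P [] []"
    and cons: "\<And>x xs ys. mset xs = mset ys \<Longrightarrow> P xs ys \<Longrightarrow> P (x # xs) (x # ys)"
    and swap: "\<And>x y zs. P (x # y # zs) (y # x # zs)"
    and trans: "\<And>xs ys zs. P xs ys \<Longrightarrow> P ys zs \<Longrightarrow> P xs zs"
  shows "P xs ys"
  using assms(1)
proof (induction xs arbitrary: ys rule: length_induct)
  case (1 xs)
  show ?case
  proof (cases xs)
    case Nil
    then show ?thesis using 1(2) assms(2) by simp
  next
    case xs: (Cons x xs')
    then obtain y ys' where ys: "ys = y # ys'" using 1(2) by (cases ys) auto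
    show ?thesis
    proof (cases "x = y")
      case True
      then have "mset xs' = mset ys'" using 1(2) xs ys by simp
      then show ?thesis using 1(1) xs ys True by (auto intro: cons)
    next
      case False
      obtain u where u: "mset ys' = mset (x # u)" "mset xs' = mset (y # u)"
      proof -
        have e: "add_mset x (mset xs') = add_mset y (mset ys')" using 1(2) xs ys by simp
        then obtain C where "mset ys' = add_mset x C" "mset xs' = add_mset y C"
          using False by (auto simp: add_eq_conv_ex)
        then show thesis using that ex_mset[of C] by auto
      qed
      have "length ys' = length xs'" using 1(2) xs ys by (metis length_Cons nat.inject size_mset)
      have "P (x # xs') (x # y # u)" using 1(1) xs u(2) by (auto intro!: cons)
      moreover have "P (y # x # u) (y # ys')"
      proof (rule cons)
        have "length (x # u) = length ys'" using u(1) by (metis size_mset)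
        then have "length (x # u) < length xs" using xs \<open>length ys' = length xs'\<close> by simp
        then show "P (x # u) ys'" using 1(1) u(1) by metis
      qed (use u in simp)
      ultimately show ?thesis unfolding xs ys using swap trans by blast
    qed
  qed
qed

lemma symm_shift: 
  assumes "symm \<psi>" shows "symm (shift i j \<psi>)"
proof -
  have "shift i j \<psi> v = shift i j \<psi> w" if "mset v = mset w" "symm \<psi>" for v w and \<psi> :: "(nat \<times> nat) list \<Rightarrow> 'a"
    using that
  proof (induction arbitrary: \<psi> rule: mset_eq_list_induct)
    case (swap x y zs)
    have "(\<lambda>v. \<psi> (x # y # v)) = (\<lambda>v. \<psi> (y # x # v))"
      by (intro ext symmD[OF swap]) simp
    moreover have "\<psi> (a # b # zs) = \<psi> (b # a # zs)" for a b by (rule symmD[OF swap]) simp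
    ultimately show ?case by simp
  next
    case (Cons z xs ys)
    have "shift i j (\<lambda>v. \<psi> (z # v)) xs = shift i j (\<lambda>v. \<psi> (z # v)) ys"
      using Cons symm_Cons by blast
    moreover have "\<psi> ((fst z, j) # xs) = \<psi> ((fst z, j) # ys)"
      by (rule symmD[OF Cons.prems]) (simp add: Cons.hyps)
    ultimately show ?case by simp
  qed auto
  then show ?thesis using assms unfolding symm_def by blast
qed

lemma shift_in_range:
  assumes "set w \<subseteq> {..<r} \<times> {..<r}" "map fst v = map fst w" "set (map snd v) \<subseteq> insert j (set (map snd w))" "j < r"
  shows "set v \<subseteq> {..<r} \<times> {..<r}"
proof
  fix z assume "z \<in> set v"
  then have "fst z \<in> set (map fst w)" "snd z \<in> insert j (set (map snd w))"
    using assms(2,3) by (metis image_eqI set_map) (use \<open>z \<in> set v\<close> assms(3) in auto)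
  then show "z \<in> {..<r} \<times> {..<r}" using assms(1,4) by (cases z) auto
qed

section \<open>Taylor coefficients of a solution: consistency and propagation of zeros\<close>

text \<open>A solution satisfies L_X (L_Y F) = act Y (act X F), with the order reversed.
  Integrability, [L_X, L_Y] = L_[X,Y], therefore asks for an action that reverses brackets;
  \<open>act_commutator\<close> is this condition on matrix units.\<close>

locale gl_action =
  fixes r :: nat and act :: "nat \<Rightarrow> nat \<Rightarrow> 'a::ab_group_add \<Rightarrow> 'a" and P :: 'a
  assumes act_add: "act i j (x + y) = act i j x + act i j y"
    and act_commutator: "\<lbrakk>i < r; j < r; p < r; q < r\<rbrakk> \<Longrightarrow>
      act i j (act p q x) - act p q (act i j x) = (if q = i then act p j x else 0) - (if j = p then act i q x else 0)"
begin

lemma act_0 [simp]: "act i j 0 = 0"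
  using act_add[of i j 0 0] by simp

lemma act_diff: "act i j (x - y) = act i j x - act i j y"
  using act_add[of i j "x - y" y] by (simp add: algebra_simps)

text \<open>\<open>D k [z\<^sub>1, \<dots>, z\<^sub>k]\<close> is the iterated derivative at the identity, in the directions \<open>z\<^sub>i\<close> of
  the space of matrices, of the solution \<open>F\<close> of \<open>L\<^sub>X F = act X F\<close>, \<open>F 1 = P\<close>: differentiating this
  equation at \<open>1 + Y\<close> yields the recursion.\<close>
primrec D :: "nat \<Rightarrow> (nat \<times> nat) list \<Rightarrow> 'a" where
  "D 0 w = (if w = [] then P else 0)"
| "D (Suc k) w = (case w of [] \<Rightarrow> 0 | z # v \<Rightarrow>
     if set w \<subseteq> {..<r} \<times> {..<r} then act (fst z) (snd z) (D k v) - shift (fst z) (snd z) (D k) v else 0)"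

lemma D_Suc_Cons:
  "set ((i, j) # v) \<subseteq> {..<r} \<times> {..<r} \<Longrightarrow> D (Suc k) ((i, j) # v) = act i j (D k v) - shift i j (D k) v"
  by simp

declare D.simps(2) [simp del]

lemma D_out_of_range: "\<not> set w \<subseteq> {..<r} \<times> {..<r} \<Longrightarrow> D k w = 0"
  by (cases k) (auto simp: D.simps(2) split: list.splits)

text \<open>The counter \<open>k\<close> makes the recursion primitive, since \<open>shift\<close>
  takes all of \<open>D k\<close> as a function of words. It carries no information beyond the
  length of the word.\<close>

lemma D_length: "length w \<noteq> k \<Longrightarrow> D k w = 0"
proof (induction k arbitrary: w)
  case (Suc k)
  show ?case
  proof (cases w)
    case (Cons z v)
    have "shift (fst z) (snd z) (D k) v = shift (fst z) (snd z) (\<lambda>v. 0) v"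
    proof (rule shift_cong)
      fix u :: "(nat \<times> nat) list" assume "map fst u = map fst v"
      then have "length u = length v" by (metis length_map)
      then show "D k u = 0" using Suc Cons by auto
    qed
    then show ?thesis using Suc Cons by (simp add: D.simps(2) shift_zero)
  qed (simp add: D.simps(2))
qed simp

text \<open>The two orders differ by the commutator of the actions, by the terms in which one letter
  shifts the other, and by the commutator of the shifts. \<open>act_commutator\<close> and
  \<open>shift_commutator\<close> make these cancel; the mixed terms agree because
  \<open>act\<close> is additive and so passes through \<open>shift\<close>.\<close>

lemma D_swap: "D (Suc (Suc k)) (x # y # w) = D (Suc (Suc k)) (y # x # w)"
proof (cases "set (x # y # w) \<subseteq> {..<r} \<times> {..<r}")
  case True
  obtain i j p q where x: "x = (i, j)" and y: "y = (p, q)" by (cases x, cases y) auto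
  have ran: "i < r" "j < r" "p < r" "q < r" "set w \<subseteq> {..<r} \<times> {..<r}" using True x y by auto
  have step: "D (Suc (Suc k)) ((i, j) # (p, q) # w) = act i j (act p q (D k w)) - shift i j (\<lambda>v. act p q (D k v)) w
      - act i j (shift p q (D k) w) - (if q = i then act p j (D k w) - shift p j (D k) w else 0)
      + shift i j (shift p q (D k)) w"
    if ran: "i < r" "j < r" "p < r" "q < r" for i j p q
  proof -
    have "shift i j (\<lambda>v. D (Suc k) ((p, q) # v)) w = shift i j (\<lambda>v. act p q (D k v) - shift p q (D k) v) w"
      using shift_in_range[OF \<open>set w \<subseteq> {..<r} \<times> {..<r}\<close>] ran by (intro shift_cong D_Suc_Cons) auto
    then have 1: "shift i j (\<lambda>v. D (Suc k) ((p, q) # v)) w = shift i j (\<lambda>v. act p q (D k v)) w - shift i j (shift p q (D k)) w"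
      by (simp add: shift_diff)
    have 2: "D (Suc k) ((p, s) # w) = act p s (D k w) - shift p s (D k) w" if "s < r" for s
      using that ran \<open>set w \<subseteq> {..<r} \<times> {..<r}\<close> by (intro D_Suc_Cons) auto
    have "D (Suc (Suc k)) ((i, j) # (p, q) # w) = act i j (D (Suc k) ((p, q) # w)) - shift i j (D (Suc k)) ((p, q) # w)"
      using ran \<open>set w \<subseteq> {..<r} \<times> {..<r}\<close> by (intro D_Suc_Cons) auto
    then show ?thesis
      unfolding shift.simps fst_conv snd_conv 1 2[OF ran(4)] 2[OF ran(2)] act_diff by (simp add: algebra_simps)
  qed
  have h: "act i j (shift p q (D k) w) = shift p q (\<lambda>v. act i j (D k v)) w" for i j p q
    by (rule shift_hom) (rule act_add)
  have "D (Suc (Suc k)) ((i, j) # (p, q) # w) - D (Suc (Suc k)) ((p, q) # (i, j) # w)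
     = (act i j (act p q (D k w)) - act p q (act i j (D k w)))
       - (if q = i then act p j (D k w) - shift p j (D k) w else 0)
       + (if j = p then act i q (D k w) - shift i q (D k) w else 0)
       + (shift i j (shift p q (D k)) w - shift p q (shift i j (D k)) w)"
    unfolding step[OF ran(1-4)] step[OF ran(3,4,1,2)] h by (simp add: algebra_simps)
  also have "\<dots> = 0" unfolding shift_commutator act_commutator[OF ran(1-4)] by simp
  finally show ?thesis unfolding x y by simp
next
  case False
  moreover have "\<not> set (y # x # w) \<subseteq> {..<r} \<times> {..<r}" using False by auto
  ultimately show ?thesis using D_out_of_range by metis
qed

lemma symm_D: "symm (D k)"
proof (induction k)
  case (Suc k)
  have "D (Suc k) v = D (Suc k) w" if "mset v = mset w" for v w
    using that
  proof (induction rule: mset_eq_list_induct)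
    case (Cons x xs ys)
    have "D k xs = D k ys" "shift i j (D k) xs = shift i j (D k) ys" for i j
      using Cons symmD[OF Suc] symmD[OF symm_shift[OF Suc]] by metis+
    moreover have "set xs = set ys" using Cons by (metis set_mset_mset)
    ultimately show ?case by (simp add: D.simps(2))
  next
    case (swap x y zs)
    show ?case
    proof (cases k)
      case 0
      then show ?thesis by (simp add: D_length)
    next
      case (Suc k')
      then show ?thesis by (simp add: D_swap)
    qed
  qed auto
  then show ?case unfolding symm_def by blast
qed (auto simp: symm_def)

text \<open>Symmetry brings a letter outside row \<open>p\<close> to the front, and the recursion
  removes it while preserving the rows of the other letters. Words inside row \<open>p\<close> thus
  decide.\<close>

lemma D_row_vanish:
  assumes row: "\<And>v. set v \<subseteq> {p} \<times> {..<r} \<Longrightarrow> length v \<ge> m \<Longrightarrow> D (length v) v = 0"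
    and "m \<le> length (filter (\<lambda>z. fst z = p) w)"
  shows "D (length w) w = 0"
  using assms(2)
proof (induction "length w" arbitrary: w)
  case 0
  then show ?case by (intro row) auto
next
  case (Suc k)
  show ?case
  proof (cases "set w \<subseteq> {..<r} \<times> {..<r}")
    case ran: True
    show ?thesis
    proof (cases "set w \<subseteq> {p} \<times> {..<r}")
      case True
      then have "filter (\<lambda>z. fst z = p) w = w" by (auto intro!: filter_True)
      then show ?thesis using True Suc.prems row by metis
    next
      case False
      then obtain z where z: "z \<in> set w" "fst z \<noteq> p" using ran by fastforce
      define v where "v = remove1 z w"
      have ms: "mset (z # v) = mset w" using z unfolding v_def by simp
      have "set v \<subseteq> set w" unfolding v_def by (rule set_remove1_subset)
      have len: "length v = k" "Suc (length v) = length w" using Suc(2) z unfolding v_def by (auto simp: length_remove1)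
      have "length (filter (\<lambda>z. fst z = p) v) = size (mset (filter (\<lambda>z. fst z = p) (z # v)))"
        unfolding size_mset using z(2) by simp
      also have "\<dots> = length (filter (\<lambda>z. fst z = p) w)" unfolding mset_filter ms by (metis mset_filter size_mset)
      finally have cnt: "m \<le> length (filter (\<lambda>z. fst z = p) v)" using Suc.prems by simp
      have D0: "D k u = 0" if "map fst u = map fst v" for u
      proof -
        have "length (filter (\<lambda>z. fst z = p) u) = length (filter (\<lambda>i. i = p) (map fst u))"
          "length (filter (\<lambda>z. fst z = p) v) = length (filter (\<lambda>i. i = p) (map fst v))" by (simp_all add: filter_map o_def)
        moreover have "length u = k" using that len by (metis length_map)
        ultimately show ?thesis using Suc.hyps(1)[of u] cnt that by simp
      qed
      have "shift i j (D k) v = shift i j (\<lambda>v. 0) v" for i j by (rule shift_cong) (rule D0)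
      then have "D (Suc k) (z # v) = 0" using D0[of v] by (simp add: D.simps(2) shift_zero)
      then show ?thesis using symmD[OF symm_D ms] len by metis
    qed
  qed (rule D_out_of_range)
qed

end

lemma length_eq_sum_filter:
  assumes "\<And>z. z \<in> set w \<Longrightarrow> f z < (r::nat)"
  shows "length w = (\<Sum>p<r. length (filter (\<lambda>z. f z = p) w))"
  using assms
proof (induction w)
  case (Cons z w)
  have "(\<Sum>p<r. length (filter (\<lambda>z. f z = p) (z # w)))
     = (\<Sum>p<r. (if f z = p then 1 else 0) + length (filter (\<lambda>z. f z = p) w))" by (rule sum.cong) auto
  also have "\<dots> = Suc (length w)" using Cons by (auto simp: sum.distrib)
  finally show ?case by simp
qed simp

lemma filter_pigeonhole:
  assumes "\<And>z. z \<in> set w \<Longrightarrow> f z < (r::nat)" and "length w > r * m"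
  shows "\<exists>p<r. m < length (filter (\<lambda>z. f z = p) w)"
proof (rule ccontr)
  assume "\<not> ?thesis"
  then have "(\<Sum>p<r. length (filter (\<lambda>z. f z = p) w)) \<le> (\<Sum>p<r. m)" by (intro sum_mono) auto
  then show False using length_eq_sum_filter[of w f r, OF assms(1)] assms(2) by simp
qed

lemma (in gl_action) D_vanish:
  assumes row: "\<And>p v. p < r \<Longrightarrow> set v \<subseteq> {p} \<times> {..<r} \<Longrightarrow> length v \<ge> m \<Longrightarrow> D (length v) v = 0"
    and "k > r * m"
  shows "D k w = 0"
proof (cases "set w \<subseteq> {..<r} \<times> {..<r} \<and> length w = k")
  case True
  then have "fst z < r" if "z \<in> set w" for z using that by auto
  then obtain p where "p < r" "m < length (filter (\<lambda>z. fst z = p) w)"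
    using filter_pigeonhole[of w fst r m] assms(2) True by auto
  then show ?thesis using D_row_vanish[of p m w] row True by auto
qed (auto intro: D_out_of_range D_length)

text \<open>The extension of \<open>\<psi>\<close> from \<open>k\<close>-tuples of elementary matrices to a \<open>k\<close>-linear form, evaluated
  at \<open>(Y, \<dots>, Y)\<close>.\<close>
primrec wsum :: "nat \<Rightarrow> nat \<Rightarrow> (nat \<times> nat \<Rightarrow> complex) \<Rightarrow> ((nat \<times> nat) list \<Rightarrow> complex) \<Rightarrow> complex" where
  "wsum r 0 Y \<psi> = \<psi> []"
| "wsum r (Suc k) Y \<psi> = (\<Sum>z\<in>{..<r} \<times> {..<r}. Y z * wsum r k Y (\<lambda>w. \<psi> (z # w)))"

lemma wsum_add: "wsum r k Y (\<lambda>w. \<psi> w + \<phi> w) = wsum r k Y \<psi> + wsum r k Y \<phi>"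
  by (induction k arbitrary: \<psi> \<phi>) (simp_all add: sum.distrib distrib_left)

lemma wsum_diff: "wsum r k Y (\<lambda>w. \<psi> w - \<phi> w) = wsum r k Y \<psi> - wsum r k Y \<phi>"
  by (induction k arbitrary: \<psi> \<phi>) (simp_all add: sum_subtractf right_diff_distrib)

lemma wsum_zero: "wsum r k Y (\<lambda>w. 0) = 0"
  by (induction k) simp_all

lemma wsum_mult: "wsum r k Y (\<lambda>w. c * \<psi> w) = c * wsum r k Y \<psi>"
  by (induction k arbitrary: \<psi>) (simp_all add: sum_distrib_left mult_ac)

lemma wsum_sum: "wsum r k Y (\<lambda>w. \<Sum>s\<in>A. \<psi> s w) = (\<Sum>s\<in>A. wsum r k Y (\<psi> s))"
  by (induction A rule: infinite_finite_induct) (simp_all add: wsum_zero wsum_add)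

lemma wsum_cong:
  assumes "\<And>w. set w \<subseteq> {..<r} \<times> {..<r} \<Longrightarrow> length w = k \<Longrightarrow> \<psi> w = \<phi> w"
  shows "wsum r k Y \<psi> = wsum r k Y \<phi>"
  using assms
proof (induction k arbitrary: \<psi> \<phi>)
  case (Suc k)
  have "wsum r k Y (\<lambda>w. \<psi> (z # w)) = wsum r k Y (\<lambda>w. \<phi> (z # w))" if "z \<in> {..<r} \<times> {..<r}" for z
    using that by (intro Suc.IH Suc.prems) auto
  then show ?case by simp
qed simp

text \<open>Symmetry lets the differentiated letter be moved to the front.\<close>
lemma wsum_deriv:
  assumes "symm \<psi>"
    and Y: "\<And>z. z \<in> {..<r} \<times> {..<r} \<Longrightarrow> ((\<lambda>t. Y t z) has_field_derivative Z z) (at s)"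
  shows "((\<lambda>t. wsum r (Suc k) (Y t) \<psi>) has_field_derivative
           of_nat (Suc k) * (\<Sum>z\<in>{..<r} \<times> {..<r}. Z z * wsum r k (Y s) (\<lambda>w. \<psi> (z # w)))) (at s)"
  using assms(1)
proof (induction k arbitrary: \<psi>)
  case 0
  show ?case by (auto intro!: derivative_eq_intros Y)
next
  case (Suc k)
  let ?L = "{..<r} \<times> {..<r}"
  have 1: "((\<lambda>t. wsum r (Suc (Suc k)) (Y t) \<psi>) has_field_derivative
      (\<Sum>z\<in>?L. Y s z * (of_nat (Suc k) * (\<Sum>y\<in>?L. Z y * wsum r k (Y s) (\<lambda>w. \<psi> (z # y # w))))
         + Z z * wsum r (Suc k) (Y s) (\<lambda>w. \<psi> (z # w)))) (at s)"
    unfolding wsum.simps(2)[of r "Suc k"]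
    by (intro DERIV_sum DERIV_mult'[OF Y Suc.IH] symm_Cons Suc.prems)
  have "(\<Sum>z\<in>?L. Y s z * (of_nat (Suc k) * (\<Sum>y\<in>?L. Z y * wsum r k (Y s) (\<lambda>w. \<psi> (z # y # w)))))
     = (\<Sum>z\<in>?L. \<Sum>y\<in>?L. of_nat (Suc k) * (Z y * (Y s z * wsum r k (Y s) (\<lambda>w. \<psi> (z # y # w)))))"
    by (simp only: sum_distrib_left mult_ac)
  also have "\<dots> = (\<Sum>y\<in>?L. \<Sum>z\<in>?L. of_nat (Suc k) * (Z y * (Y s z * wsum r k (Y s) (\<lambda>w. \<psi> (y # z # w)))))"
  proof -
    have "\<psi> (z # y # w) = \<psi> (y # z # w)" for z y w by (rule symmD[OF Suc.prems]) simp
    then show ?thesis by (subst sum.swap) simp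
  qed
  also have "\<dots> = of_nat (Suc k) * (\<Sum>y\<in>?L. Z y * wsum r (Suc k) (Y s) (\<lambda>w. \<psi> (y # w)))"
    by (simp only: wsum.simps sum_distrib_left)
  finally have 3: "(\<Sum>z\<in>?L. Y s z * (of_nat (Suc k) * (\<Sum>y\<in>?L. Z y * wsum r k (Y s) (\<lambda>w. \<psi> (z # y # w)))))
     = of_nat (Suc k) * (\<Sum>y\<in>?L. Z y * wsum r (Suc k) (Y s) (\<lambda>w. \<psi> (y # w)))" .
  show ?case using 1 unfolding sum.distrib 3 by (simp only: sum.distrib of_nat_Suc[of "Suc k"] distrib_right mult_1 add.commute)
qed

text \<open>By symmetry every position contributes as much as the first. There \<open>Y\<close> is
  replaced by the product of \<open>Y\<close> with E_ij, whose column \<open>j\<close> is column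
  \<open>i\<close> of \<open>Y\<close>.\<close>

lemma wsum_shift:
  assumes "symm \<psi>" "i < r"
  shows "wsum r (Suc k) Y (shift i j \<psi>) = of_nat (Suc k) * (\<Sum>p<r. Y (p, i) * wsum r k Y (\<lambda>w. \<psi> ((p, j) # w)))"
  using assms(1)
proof (induction k arbitrary: \<psi>)
  have pick: "(\<Sum>z\<in>{..<r} \<times> {..<r}. Y z * (if snd z = i then f (fst z) else 0)) = (\<Sum>p<r. Y (p, i) * f p)" for f
    using assms(2) by (simp add: sum.cartesian_product' if_distrib cong: if_cong)
  case 0
  show ?case using pick[of "\<lambda>p. \<psi> [(p, j)]"] by simp
  case (Suc k)
  let ?L = "{..<r} \<times> {..<r}"
  have "wsum r (Suc (Suc k)) Y (shift i j \<psi>)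
     = (\<Sum>z\<in>?L. Y z * (if snd z = i then wsum r (Suc k) Y (\<lambda>w. \<psi> ((fst z, j) # w)) else 0))
       + (\<Sum>z\<in>?L. Y z * wsum r (Suc k) Y (shift i j (\<lambda>w. \<psi> (z # w))))"
    unfolding wsum.simps(2)[of r "Suc k"] shift.simps
    by (subst sum.distrib[symmetric], rule sum.cong) (auto simp: wsum_add wsum_zero distrib_left simp del: wsum.simps)
  also have "(\<Sum>z\<in>?L. Y z * wsum r (Suc k) Y (shift i j (\<lambda>w. \<psi> (z # w))))
     = (\<Sum>z\<in>?L. \<Sum>p<r. of_nat (Suc k) * (Y (p, i) * (Y z * wsum r k Y (\<lambda>w. \<psi> (z # (p, j) # w)))))"
    unfolding Suc.IH[OF symm_Cons[OF Suc.prems]] by (simp only: sum_distrib_left mult_ac)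
  also have "\<dots> = (\<Sum>p<r. \<Sum>z\<in>?L. of_nat (Suc k) * (Y (p, i) * (Y z * wsum r k Y (\<lambda>w. \<psi> ((p, j) # z # w)))))"
  proof -
    have "\<psi> (z # y # w) = \<psi> (y # z # w)" for z y w by (rule symmD[OF Suc.prems]) simp
    then show ?thesis by (subst sum.swap) simp
  qed
  also have "\<dots> = (\<Sum>p<r. of_nat (Suc k) * (Y (p, i) * wsum r (Suc k) Y (\<lambda>w. \<psi> ((p, j) # w))))"
    by (simp add: sum_distrib_left)
  finally show ?case unfolding pick[of "\<lambda>p. wsum r (Suc k) Y (\<lambda>w. \<psi> ((p, j) # w))"] by (simp add: sum_distrib_left algebra_simps sum.distrib del: wsum.simps)
qed

section \<open>The Taylor polynomial as a solution of the differential equation\<close>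

context gl_action
begin

text \<open>The Taylor polynomial of degree \<open>K\<close> at the point 1 + Y, seen through a
  functional \<open>\<phi>\<close> so that only complex-valued functions are differentiated.\<close>

definition sol :: "nat \<Rightarrow> ('a \<Rightarrow> complex) \<Rightarrow> (nat \<times> nat \<Rightarrow> complex) \<Rightarrow> complex" where
  "sol K \<phi> Y = (\<Sum>k<Suc K. wsum r k Y (\<lambda>w. \<phi> (D k w)) / fact k)"

lemma sol_at_0: "sol K \<phi> (\<lambda>z. 0) = \<phi> P"
  unfolding sol_def sum.lessThan_Suc_shift by simp

lemma sol_sum: "sol K (\<lambda>x. \<Sum>s\<in>A. c s * \<phi> s x) Y = (\<Sum>s\<in>A. c s * sol K (\<phi> s) Y)"
  unfolding sol_def wsum_sum wsum_mult
  by (simp only: sum_divide_distrib sum_distrib_left) (subst sum.swap, simp)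

lemma sol_add: "sol K (\<lambda>x. \<phi> x + \<chi> x) Y = sol K \<phi> Y + sol K \<chi> Y"
  unfolding sol_def wsum_add by (simp add: add_divide_distrib sum.distrib)

text \<open>The hypothesis on \<open>Y\<close> says that g = 1 + Y moves with velocity g X. After
  division by the factorials the correction terms of the recursion telescope, and the last one is
  zero because the coefficients of degree \<open>K\<close> vanish; so the truncated series solves
  the equation exactly.\<close>

lemma sol_deriv:
  assumes \<phi>: "\<And>x y. \<phi> (x + y) = \<phi> x + \<phi> y"
    and vanish: "\<And>w. D K w = 0"
    and Y: "\<And>p q. p < r \<Longrightarrow> q < r \<Longrightarrow> ((\<lambda>t. Y t (p, q)) has_field_derivative
              X (p, q) + (\<Sum>i<r. Y s (p, i) * X (i, q))) (at s)"
  shows "((\<lambda>t. sol K \<phi> (Y t)) has_field_derivative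
      (\<Sum>z\<in>{..<r} \<times> {..<r}. X z * sol K (\<lambda>x. \<phi> (act (fst z) (snd z) x)) (Y s))) (at s)"
proof -
  let ?L = "{..<r} \<times> {..<r}"
  define Z where "Z z = X z + (\<Sum>i<r. Y s (fst z, i) * X (i, snd z))" for z
  \<comment> \<open>\<open>T\<close> has a matrix unit in the first slot of the next coefficient,
    \<open>U\<close> has Y times that unit there, and \<open>R\<close> is the action on the present
    coefficient. The recursion becomes T k = R k - k U (k - 1), while the derivative of the term of
    degree k + 1 involves T k + U k.\<close>
  define T where "T k z = wsum r k (Y s) (\<lambda>w. \<phi> (D (Suc k) (z # w)))" for k z
  define U where "U k z = (\<Sum>p<r. Y s (p, fst z) * T k (p, snd z))" for k z
  define R where "R k z = wsum r k (Y s) (\<lambda>w. \<phi> (act (fst z) (snd z) (D k w)))" for k z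
  have l0: "\<phi> 0 = 0" using \<phi>[of 0 0] by simp
  have ldiff: "\<phi> (x - y) = \<phi> x - \<phi> y" for x y using \<phi>[of "x - y" y] by (simp add: algebra_simps)
  have symm: "symm (\<lambda>w. \<phi> (D k w))" for k using symm_D[of k] unfolding symm_def by metis
  have T_Suc: "T k z = R k z - of_nat k * (if k = 0 then 0 else U (k - 1) z)" if L: "z \<in> ?L" for k z
  proof -
    obtain i j where z: "z = (i, j)" "i < r" "j < r" using L by (cases z) auto
    have "T k z = wsum r k (Y s) (\<lambda>w. \<phi> (act i j (D k w)) - shift i j (\<lambda>w. \<phi> (D k w)) w)"
      unfolding T_def z(1) using z(2,3)
      by (intro wsum_cong) (simp add: D_Suc_Cons ldiff shift_hom[of \<phi>, OF \<phi>])
    also have "\<dots> = R k z - wsum r k (Y s) (shift i j (\<lambda>w. \<phi> (D k w)))"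
      unfolding wsum_diff R_def z by simp
    finally show ?thesis
      by (cases k) (simp_all add: wsum_shift[OF symm z(2)] U_def T_def z(1) del: wsum.simps(2))
  qed
  have Zsum: "(\<Sum>z\<in>?L. Z z * T k z) = (\<Sum>z\<in>?L. X z * (T k z + U k z))" for k
  proof -
    have "(\<Sum>z\<in>?L. (\<Sum>i<r. Y s (fst z, i) * X (i, snd z)) * T k z)
      = (\<Sum>p<r. \<Sum>q<r. \<Sum>i<r. X (i, q) * (Y s (p, i) * T k (p, q)))"
      by (simp add: sum.cartesian_product' sum_distrib_left sum_distrib_right mult_ac)
    also have "\<dots> = (\<Sum>i<r. \<Sum>q<r. \<Sum>p<r. X (i, q) * (Y s (p, i) * T k (p, q)))"
      by (subst sum.swap, subst (2) sum.swap, subst sum.swap) (rule refl)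
    also have "\<dots> = (\<Sum>z\<in>?L. X z * U k z)"
      by (simp add: sum.cartesian_product' U_def sum_distrib_left)
    finally show ?thesis unfolding Z_def by (simp add: distrib_right distrib_left sum.distrib)
  qed
  have TK: "T (K - 1) z = 0" if "K > 0" for z using that vanish by (simp add: T_def l0 wsum_zero)
  have "((\<lambda>t. \<Sum>k<K. wsum r (Suc k) (Y t) (\<lambda>w. \<phi> (D (Suc k) w)) / fact (Suc k)) has_field_derivative
      (\<Sum>k<K. (of_nat (Suc k) * (\<Sum>z\<in>?L. Z z * T k z)) / fact (Suc k))) (at s)"
    unfolding T_def
    by (intro DERIV_sum DERIV_cdivide wsum_deriv[OF symm]) (auto simp: Z_def intro: Y)
  from DERIV_add[OF DERIV_const[of "\<phi> (D 0 [])"] this]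
  have "((\<lambda>t. sol K \<phi> (Y t)) has_field_derivative
      (\<Sum>k<K. (of_nat (Suc k) * (\<Sum>z\<in>?L. Z z * T k z)) / fact (Suc k))) (at s)"
    unfolding sol_def sum.lessThan_Suc_shift by (simp only: wsum.simps(1) fact_0 div_by_1 add_0)
  also have "(\<Sum>k<K. (of_nat (Suc k) * (\<Sum>z\<in>?L. Z z * T k z)) / fact (Suc k)) = (\<Sum>k<K. (\<Sum>z\<in>?L. X z * (T k z + U k z)) / fact k)"
    unfolding Zsum by (intro sum.cong refl) (simp only: fact_Suc of_nat_mult, subst mult_divide_mult_cancel_left, simp_all del: of_nat_Suc)
  also have "\<dots> = (\<Sum>z\<in>?L. X z * (\<Sum>k<K. (T k z + U k z) / fact k))"
    by (simp only: sum_divide_distrib sum_distrib_left times_divide_eq_right) (rule sum.swap)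
  also have "\<dots> = (\<Sum>z\<in>?L. X z * sol K (\<lambda>x. \<phi> (act (fst z) (snd z) x)) (Y s))"
  proof (intro sum.cong refl arg_cong2[of _ _ _ _ "(*)"])
    fix z assume z: "z \<in> ?L"
    have "(\<Sum>k<N. (T k z + U k z) / fact k) = (\<Sum>k<N. R k z / fact k) + (if N = 0 then 0 else U (N - 1) z / fact (N - 1))" for N
    proof (induction N)
      case (Suc N)
      show ?case
      proof (cases N)
        case 0
        then show ?thesis using T_Suc[OF z, of 0] by (simp add: add_divide_distrib)
      next
        case (Suc M)
        have "of_nat (Suc M) * U M z / fact (Suc M) = U M z / fact M"
          by (simp only: fact_Suc of_nat_mult, subst mult_divide_mult_cancel_left, simp_all del: of_nat_Suc)
        then show ?thesis using Suc.IH T_Suc[OF z, of N] unfolding Suc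
          by (simp only: sum.lessThan_Suc[of _ "Suc M"] add_divide_distrib diff_divide_distrib nat.distinct if_False diff_Suc_1) simp
      qed
    qed simp
    from this[of K] have "(\<Sum>k<K. (T k z + U k z) / fact k) = (\<Sum>k<K. R k z / fact k)"
      using TK by (auto simp: U_def)
    also have "\<dots> = sol K (\<lambda>x. \<phi> (act (fst z) (snd z) x)) (Y s)"
      unfolding sol_def R_def by (simp add: vanish l0 wsum_zero)
    finally show "(\<Sum>k<K. (T k z + U k z) / fact k) = sol K (\<lambda>x. \<phi> (act (fst z) (snd z) x)) (Y s)" .
  qed
  finally show ?thesis .
qed

end

section \<open>Vanishing of high derivatives\<close>

lemma shift_absent: "(\<And>z. z \<in> set v \<Longrightarrow> snd z \<noteq> i) \<Longrightarrow> shift i j \<psi> v = 0"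
  by (induction v arbitrary: \<psi>) auto

lemma shift_replicate_self:
  fixes \<psi> :: "(nat \<times> nat) list \<Rightarrow> 'a::ring_1"
  assumes "\<And>z. z \<in> set v \<Longrightarrow> snd z \<noteq> p"
  shows "shift p p \<psi> (replicate l (p, p) @ v) = of_nat l * \<psi> (replicate l (p, p) @ v)"
  by (induction l arbitrary: \<psi>) (auto simp: shift_absent[OF assms] algebra_simps)

lemma mset_filter_split: "mset (replicate (length (filter (\<lambda>z. z = x) v)) x @ filter (\<lambda>z. z \<noteq> x) v) = mset v"
proof -
  have "replicate (length (filter (\<lambda>z. z = x) v)) x = filter (\<lambda>z. z = x) v"
    by (induction v) auto
  then show ?thesis by simp
qed

lemma prod_list_upto_zero:
  fixes f :: "int \<Rightarrow> 'a::ring_1"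
  assumes "(\<Prod>k\<leftarrow>[a..b]. f k) = 0" "c \<le> a" "a \<le> b" "b \<le> d"
  shows "(\<Prod>k\<leftarrow>[c..d]. f k) = 0"
proof -
  have "[c..d] = [c..a - 1] @ [a..b] @ [b + 1..d]"
    using assms upto_split1[of c a d] upto_split1[of a "b + 1" d] by (cases "b = d") simp_all
  then show ?thesis using assms(1) by simp
qed

lemma of_int_left_commute: "x * (of_int c * y) = of_int c * (x * (y :: 'a::ring_1))"
  by (metis mult.assoc mult_of_int_commute)

text \<open>Here \<open>n\<close> bounds the order of nilpotency, not the rank. In the bound on
  \<open>K\<close>, \<open>2 * n\<close> dominates the eigenvalues of \<open>b p p - b 0 0\<close>,
  and \<open>r * Suc n\<close> the weight that off-diagonal letters can contribute.\<close>

locale gl_rep =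
  fixes r n K :: nat and b :: "nat \<Rightarrow> nat \<Rightarrow> 'a::real_algebra_1" and P :: 'a
  assumes r_pos: "0 < r"
    and bracket: "\<lbrakk>i < r; j < r; p < r; q < r\<rbrakk> \<Longrightarrow>
      b i j * b p q = b p q * b i j + (if j = p then b i q else 0) - (if i = q then b p j else 0)"
    and nilpotent: "\<lbrakk>i < r; j < r; i \<noteq> j\<rbrakk> \<Longrightarrow> b i j ^ Suc n = 0"
    and b_P: "b 0 0 * P = P * b 0 0"
    and K: "K \<ge> 2 * n + r * Suc n"
begin

text \<open>Without the shift by \<open>K\<close> the solution of \<open>L\<^sub>X F = act X F\<close> could have a pole along \<open>det = 0\<close>.\<close>
definition act :: "nat \<Rightarrow> nat \<Rightarrow> 'a \<Rightarrow> 'a" where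
  "act i j M = (if i = j then M * (b 0 0 + of_nat K) else 0) - b i j * M"

sublocale gl_action r act P
proof
  show "act i j (x + y) = act i j x + act i j y" for i j x y
    by (simp add: act_def algebra_simps)
next
  fix i j p q x assume ran: "i < r" "j < r" "p < r" "q < r"
  let ?A = "b 0 0 + of_nat K"
  have "act i j (act p q x) - act p q (act i j x) = (b i j * b p q - b p q * b i j) * x"
    by (simp add: act_def left_diff_distrib right_diff_distrib mult.assoc)
  also have "\<dots> = ((if j = p then b i q else 0) - (if i = q then b p j else 0)) * x"
    unfolding bracket[OF ran] by simp
  finally show "act i j (act p q x) - act p q (act i j x) = (if q = i then act p j x else 0) - (if j = p then act i q x else 0)"
    by (auto simp: act_def algebra_simps)
qed

text \<open>For p > 0 the elements \<open>b p 0\<close> and \<open>b 0 p\<close> span with their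
  commutator an image of sl_2; for p = 0 the product contains the factor 0.\<close>

lemma semisimple:
  assumes "p < r"
  shows "(\<Prod>k\<leftarrow>[- int n..2 * int n]. (b p p - b 0 0) - of_int k) = 0"
proof (cases "p = 0")
  case True
  show ?thesis unfolding True by (rule prod_list_upto_zero[of _ 0 0]) auto
next
  case False
  note ran = assms r_pos
  show ?thesis
  proof (rule sl2_integral_semisimple[of "b p 0" "b 0 p"])
    show "b p 0 * b 0 p = b 0 p * b p 0 + (b p p - b 0 0)"
      using bracket[OF ran ran(2,1)] by simp
    show "(b p p - b 0 0) * b p 0 = b p 0 * (b p p - b 0 0) + 2 *\<^sub>R b p 0"
      using bracket[OF ran(1,1) ran] bracket[OF ran(2,2) ran] False by (simp add: algebra_simps scaleR_2)
    show "(b p p - b 0 0) * b 0 p = b 0 p * (b p p - b 0 0) - 2 *\<^sub>R b 0 p"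
      using bracket[OF ran(1,1) ran(2,1)] bracket[OF ran(2,2) ran(2,1)] False by (simp add: algebra_simps scaleR_2)
  qed (use nilpotent ran False in auto)
qed

abbreviation row_word :: "nat \<Rightarrow> (nat \<times> nat) list \<Rightarrow> bool" where
  "row_word p v \<equiv> set v \<subseteq> {p} \<times> ({..<r} - {p})"

text \<open>No letter of a row word has column \<open>p\<close>, so the shift term is empty and the
  recursion is left multiplication by \<open>- b p i\<close>.\<close>

lemma D_row_Cons:
  assumes "p < r" "row_word p ((p, i) # v)"
  shows "D (Suc (length v)) ((p, i) # v) = - b p i * D (length v) v"
proof -
  have "shift p i (D (length v)) v = 0" using assms by (intro shift_absent) auto
  moreover have "set ((p, i) # v) \<subseteq> {..<r} \<times> {..<r}" using assms by auto
  ultimately show ?thesis using assms by (auto simp: D_Suc_Cons act_def)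
qed

lemma D_row_replicate:
  assumes "p < r" "row_word p (replicate l (p, i) @ v)"
  shows "D (length (replicate l (p, i) @ v)) (replicate l (p, i) @ v) = (- b p i) ^ l * D (length v) v"
  using assms(2)
proof (induction l)
  case (Suc l)
  then show ?case using D_row_Cons[OF assms(1), of i "replicate l (p, i) @ v"] by (simp add: mult.assoc)
qed simp

text \<open>Some column repeats more than \<open>n\<close> times; gathering its letters in front, by
  symmetry, produces a power of \<open>b p i\<close> that vanishes.\<close>

lemma D_row_long:
  assumes "p < r" "row_word p v" "length v > r * n"
  shows "D (length v) v = 0"
proof -
  have "snd z < r" if "z \<in> set v" for z using that assms(2) by auto
  then obtain i where i: "i < r" "n < length (filter (\<lambda>z. snd z = i) v)"
    using filter_pigeonhole[of v snd r n] assms(3) by auto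
  have "filter (\<lambda>z. snd z = i) v = filter (\<lambda>z. z = (p, i)) v"
    using assms(2) by (intro filter_cong) auto
  then have l: "Suc n \<le> length (filter (\<lambda>z. z = (p, i)) v)" (is "_ \<le> ?l") using i by simp
  then have "(p, i) \<in> set v" by (cases "filter (\<lambda>z. z = (p, i)) v") (auto dest: filter_eq_ConsD)
  then have "i \<noteq> p" using assms(2) by auto
  define w where "w = replicate ?l (p, i) @ filter (\<lambda>z. z \<noteq> (p, i)) v"
  have w: "mset w = mset v" unfolding w_def by (rule mset_filter_split)
  then have "row_word p w" "length w = length v" using assms(2) by (metis set_mset_mset, metis size_mset)
  then have "D (length v) w = (- b p i) ^ ?l * D (length (filter (\<lambda>z. z \<noteq> (p, i)) v)) (filter (\<lambda>z. z \<noteq> (p, i)) v)"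
    using D_row_replicate[OF assms(1), of ?l i "filter (\<lambda>z. z \<noteq> (p, i)) v"] unfolding w_def by simp
  also have "(- b p i) ^ ?l = 0"
    using power_zero_le[OF nilpotent l] assms(1) i(1) \<open>i \<noteq> p\<close> by (simp add: power_minus[of "b p i"])
  finally show ?thesis using symmD[OF symm_D w] by simp
qed

text \<open>Diagonal letters multiply by \<open>b 0 0\<close> from the right; the weight
  \<open>c\<close> serves to move this factor to the left. The initial value has weight 0 and each
  letter changes the weight by at most 1.\<close>

lemma D_row_weight:
  assumes "p < r" "row_word p v"
  obtains c :: int where "\<bar>c\<bar> \<le> length v" "b 0 0 * D (length v) v = D (length v) v * b 0 0 + of_int c * D (length v) v"
proof -
  have "\<exists>c. \<bar>c\<bar> \<le> int (length v) \<and> b 0 0 * D (length v) v = D (length v) v * b 0 0 + of_int c * D (length v) v"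
    using assms(2)
  proof (induction v)
    case Nil
    show ?case using b_P by (intro exI[of _ 0]) simp
  next
    case (Cons z v)
    then obtain i where z: "z = (p, i)" "i < r" "i \<noteq> p" by (cases z) auto
    define M where "M = D (length v) v"
    obtain c where c: "\<bar>c\<bar> \<le> int (length v)" "b 0 0 * M = M * b 0 0 + of_int c * M"
      using Cons unfolding M_def by auto
    define s :: int where "s = (if p = 0 then 1 else if i = 0 then -1 else 0)"
    have "b 0 0 * b p i = b p i * b 0 0 + of_int s * b p i"
      using bracket[OF r_pos r_pos assms(1) z(2)] z(3) by (auto simp: s_def)
    then have "b 0 0 * (b p i * M) = b p i * (b 0 0 * M) + of_int s * (b p i * M)"
      by (simp add: distrib_right flip: mult.assoc)
    also have "\<dots> = b p i * M * b 0 0 + of_int (s + c) * (b p i * M)"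
      unfolding c(2) by (simp add: distrib_left distrib_right mult.assoc of_int_left_commute)
    finally have "b 0 0 * (b p i * M) = b p i * M * b 0 0 + of_int (s + c) * (b p i * M)" .
    moreover have "D (length (z # v)) (z # v) = - (b p i * M)"
      using D_row_Cons[OF assms(1), of i v] Cons.prems unfolding z M_def by simp
    moreover have "\<bar>s + c\<bar> \<le> int (length (z # v))" using c(1) by (auto simp: s_def)
    ultimately show ?case by (intro exI[of _ "s + c"]) simp
  qed
  then show thesis using that by blast
qed

text \<open>A further letter (p, p) multiplies by \<open>b p p\<close> on the left and by
  \<open>b 0 0 + of_nat K\<close> on the right; moving the latter to the left costs
  \<open>c\<close>. The shift counts the \<open>l\<close> diagonal letters already present, so the
  constant falls by one at each step.\<close>

lemma D_diag_replicate:
  assumes "p < r" "row_word p v"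
    and c: "b 0 0 * D (length v) v = D (length v) v * b 0 0 + of_int c * D (length v) v"
  shows "D (length (replicate l (p, p) @ v)) (replicate l (p, p) @ v)
    = (-1) ^ l * (\<Prod>k\<leftarrow>[int K - c - int l + 1..int K - c]. (b p p - b 0 0) - of_int k) * D (length v) v"
proof (induction l)
  case (Suc l)
  let ?H = "b p p - b 0 0"
  define M where "M = D (length v) v"
  define Q where "Q = (\<Prod>k\<leftarrow>[int K - c - int l + 1..int K - c]. ?H - of_int k)"
  define w where "w = replicate l (p, p) @ v"
  have Dw: "D (length w) w = (-1) ^ l * (Q * M)" using Suc unfolding Q_def M_def w_def by (simp only: mult.assoc)
  have "b 0 0 * b p p = b p p * b 0 0" using bracket[OF r_pos r_pos assms(1,1)] by auto
  then have Q0: "b 0 0 * Q = Q * b 0 0" unfolding Q_def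
    by (intro prod_list_commute) (auto simp: left_diff_distrib right_diff_distrib mult_of_int_commute)
  have QM: "Q * M * b 0 0 = b 0 0 * (Q * M) - of_int c * (Q * M)"
  proof -
    have "Q * M * b 0 0 = Q * (b 0 0 * M - of_int c * M)" using c unfolding M_def by (simp add: mult.assoc)
    also have "\<dots> = Q * b 0 0 * M - of_int c * (Q * M)"
      by (simp add: right_diff_distrib mult.assoc of_int_left_commute)
    finally show ?thesis unfolding Q0[symmetric] by (simp add: mult.assoc)
  qed
  have "act p p (Q * M) - of_nat l * (Q * M) = Q * M * b 0 0 + of_nat K * (Q * M) - b p p * (Q * M) - of_nat l * (Q * M)"
    by (simp add: act_def distrib_left mult_of_nat_commute)
  also have "\<dots> = - ((?H - of_int (int K - c - int l)) * (Q * M))"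
    unfolding QM by (simp add: algebra_simps)
  finally have step: "act p p (Q * M) - of_nat l * (Q * M) = - ((?H - of_int (int K - c - int l)) * (Q * M))" .
  have neg: "act p p ((-1) ^ l * x) = (-1) ^ l * act p p x" for x
    by (cases "even l") (auto simp: act_def algebra_simps)
  have "shift p p (D (length w)) w = of_nat l * D (length w) w" unfolding w_def
    by (rule shift_replicate_self) (use assms(2) in auto)
  moreover have "set ((p, p) # w) \<subseteq> {..<r} \<times> {..<r}" using assms unfolding w_def by auto
  ultimately have "D (Suc (length w)) ((p, p) # w) = (-1) ^ l * (act p p (Q * M) - of_nat l * (Q * M))"
    unfolding D_Suc_Cons[OF \<open>set ((p, p) # w) \<subseteq> {..<r} \<times> {..<r}\<close>] Dw neg
    by (cases "even l") (simp_all add: Dw neg)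
  also have "\<dots> = (-1) ^ Suc l * (((?H - of_int (int K - c - int l)) * Q) * M)" unfolding step by (simp add: mult.assoc)
  also have "(?H - of_int (int K - c - int l)) * Q = (\<Prod>k\<leftarrow>[int K - c - int (Suc l) + 1..int K - c]. ?H - of_int k)"
    unfolding Q_def by (subst (2) upto_rec1) (auto simp: algebra_simps)
  finally show ?case unfolding w_def M_def by (simp only: replicate_Suc append_Cons length_Cons mult.assoc)
qed simp

lemma D_eventually_0: "\<exists>m. \<forall>k>m. \<forall>w. D k w = 0"
proof -
  define q where "q = r * Suc n"
  \<comment> \<open>Words with more than \<open>r * n\<close> off-diagonal letters vanish already.
    Otherwise |c| is at most \<open>q\<close> and at least \<open>l\<close> diagonal letters remain.
    The factors then run over consecutive integers whose upper end K - c is at least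
    \<open>2 * n\<close> by the bound on \<open>K\<close>, and whose lower end is at most
    \<open>- n\<close> by the choice of \<open>l\<close>, so they include those of
    \<open>semisimple\<close>.\<close>
  define l where "l = K + q + n + 1"
  have "D (length v) v = 0" if p: "p < r" and v: "set v \<subseteq> {p} \<times> {..<r}" "length v \<ge> l + q" for p v
  proof -
    define d where "d = length (filter (\<lambda>z. z = (p, p)) v)"
    define u where "u = filter (\<lambda>z. z \<noteq> (p, p)) v"
    have ms: "mset (replicate d (p, p) @ u) = mset v" unfolding d_def u_def by (rule mset_filter_split)
    then have len: "length (replicate d (p, p) @ u) = length v" by (metis size_mset)
    have u: "row_word p u" using v unfolding u_def by auto
    obtain c where c: "\<bar>c\<bar> \<le> int (length u)" "b 0 0 * D (length u) u = D (length u) u * b 0 0 + of_int c * D (length u) u"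
      using D_row_weight[OF p u] by blast
    have D: "D (length v) v = (-1) ^ d * (\<Prod>k\<leftarrow>[int K - c - int d + 1..int K - c]. (b p p - b 0 0) - of_int k) * D (length u) u"
      using D_diag_replicate[OF p u c(2), of d] symmD[OF symm_D ms] unfolding len by simp
    show ?thesis
    proof (cases "length u > r * n")
      case True
      then show ?thesis using D_row_long[OF p u] D by simp
    next
      case False
      then have uq: "length u \<le> q" unfolding q_def by simp
      then have "d \<ge> l" using len v(2) by simp
      then have "(\<Prod>k\<leftarrow>[int K - c - int d + 1..int K - c]. (b p p - b 0 0) - of_int k) = 0"
        using c(1) uq K unfolding l_def
        by (intro prod_list_upto_zero[OF semisimple[OF p]]) (auto simp: q_def)
      then show ?thesis using D by simp
    qed
  qed
  then show ?thesis using D_vanish[of "l + q"] by blast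
qed

end

section \<open>Regular functions and invariant vector fields on the general linear group\<close>

lemma poly_fun_sum: "(\<And>s. s \<in> A \<Longrightarrow> f s \<in> poly_fun r) \<Longrightarrow> (\<lambda>g. \<Sum>s\<in>A. f s g) \<in> poly_fun r"
  by (induction A rule: infinite_finite_induct) (auto intro: poly_fun.intros)

lemma poly_fun_prod: "(\<And>s. s \<in> A \<Longrightarrow> f s \<in> poly_fun r) \<Longrightarrow> (\<lambda>g. \<Prod>s\<in>A. f s g) \<in> poly_fun r"
  by (induction A rule: infinite_finite_induct) (auto intro: poly_fun.intros)

lemma poly_fun_power: "f \<in> poly_fun r \<Longrightarrow> (\<lambda>g. f g ^ k) \<in> poly_fun r"
  by (induction k) (auto intro: poly_fun.intros)

lemma poly_fun_line:
  assumes "f \<in> poly_fun r" "G \<in> carrier_mat r r" "Y \<in> carrier_mat r r"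
  shows "\<exists>p. \<forall>t. f (G + t \<cdot>\<^sub>m Y) = poly p t"
  using assms(1)
proof induction
  case (const c)
  show ?case by (intro exI[of _ "[:c:]"]) simp
next
  case (entry i j)
  then show ?case using assms(2,3) by (intro exI[of _ "[:G $$ (i, j), Y $$ (i, j):]"]) auto
next
  case (add f h)
  then show ?case by (metis poly_add)
next
  case (mult f h)
  then show ?case by (metis poly_mult)
qed

lemma det_poly_fun: "\<exists>f\<in>poly_fun r. \<forall>g\<in>carrier_mat r r. det g = f g"
proof (intro bexI ballI)
  show "(\<lambda>g. \<Sum>p\<in>{p. p permutes {0..<r}}. signof p * (\<Prod>i = 0..<r. g $$ (i, p i))) \<in> poly_fun r"
    by (intro poly_fun_sum poly_fun_prod poly_fun.intros) (auto simp: permutes_in_image)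
qed (rule det_def')

lemma det_line:
  assumes "G \<in> carrier_mat r r" "Y \<in> carrier_mat r r"
  obtains p :: "complex poly" where "\<And>t. det (G + t \<cdot>\<^sub>m Y) = poly p t"
proof -
  obtain f where f: "f \<in> poly_fun r" "\<And>g. g \<in> carrier_mat r r \<Longrightarrow> det g = f g" using det_poly_fun by blast
  obtain p where "\<And>t. f (G + t \<cdot>\<^sub>m Y) = poly p t" using poly_fun_line[OF f(1) assms] by blast
  then show thesis using that f(2) assms by simp
qed

lemma GL_carrier: "g \<in> GL r \<Longrightarrow> g \<in> carrier_mat r r" and GL_det: "g \<in> GL r \<Longrightarrow> det g \<noteq> 0"
  by (auto simp: GL_def)

lemma eventually_GL:
  assumes "g \<in> GL r" "Y \<in> carrier_mat r r"
  shows "\<forall>\<^sub>F t in nhds 0. g + t \<cdot>\<^sub>m Y \<in> GL r"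
proof -
  obtain p :: "complex poly" where p: "\<And>t. det (g + t \<cdot>\<^sub>m Y) = poly p t" using det_line GL_carrier assms by blast
  have "g + 0 \<cdot>\<^sub>m Y = g" using GL_carrier[OF assms(1)] assms(2) by (intro eq_matI) auto
  then have "poly p 0 \<noteq> 0" using p[of 0] GL_det[OF assms(1)] by simp
  moreover have "open {t. poly p t \<noteq> 0}"
    by (intro open_Collect_neq continuous_intros)
  ultimately have "\<forall>\<^sub>F t in nhds 0. poly p t \<noteq> 0"
    using eventually_nhds by blast
  then show ?thesis
    by (rule eventually_mono) (use GL_carrier[OF assms(1)] assms(2) in \<open>simp add: GL_def p\<close>)
qed

lemma regular_GL_poly_fun: "f \<in> poly_fun r \<Longrightarrow> regular_GL r f"
  unfolding regular_GL_def by (intro exI[of _ f] exI[of _ 0]) simp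

lemma regular_GL_cong: "regular_GL r f \<Longrightarrow> (\<And>g. g \<in> GL r \<Longrightarrow> f g = h g) \<Longrightarrow> regular_GL r h"
  unfolding regular_GL_def by metis

lemma regular_GL_add:
  assumes "regular_GL r f" "regular_GL r h"
  shows "regular_GL r (\<lambda>g. f g + h g)"
proof -
  obtain p k where p: "p \<in> poly_fun r" "\<And>g. g \<in> GL r \<Longrightarrow> f g = p g / det g ^ k" using assms(1) unfolding regular_GL_def by blast
  obtain q l where q: "q \<in> poly_fun r" "\<And>g. g \<in> GL r \<Longrightarrow> h g = q g / det g ^ l" using assms(2) unfolding regular_GL_def by blast
  obtain d where d: "d \<in> poly_fun r" "\<And>g. g \<in> carrier_mat r r \<Longrightarrow> det g = d g" using det_poly_fun by blast
  have "(\<lambda>g. p g * d g ^ l + q g * d g ^ k) \<in> poly_fun r" by (intro poly_fun.intros poly_fun_power p q d)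
  moreover have "f g + h g = (p g * d g ^ l + q g * d g ^ k) / det g ^ (k + l)" if "g \<in> GL r" for g
    unfolding p(2)[OF that] q(2)[OF that] d(2)[OF GL_carrier[OF that], symmetric]
    using GL_det[OF that] by (simp add: power_add add_divide_distrib)
  ultimately show ?thesis unfolding regular_GL_def by blast
qed

lemma regular_GL_mult:
  assumes "regular_GL r f" "regular_GL r h"
  shows "regular_GL r (\<lambda>g. f g * h g)"
proof -
  obtain p k where p: "p \<in> poly_fun r" "\<And>g. g \<in> GL r \<Longrightarrow> f g = p g / det g ^ k" using assms(1) unfolding regular_GL_def by blast
  obtain q l where q: "q \<in> poly_fun r" "\<And>g. g \<in> GL r \<Longrightarrow> h g = q g / det g ^ l" using assms(2) unfolding regular_GL_def by blast
  have "(\<lambda>g. p g * q g) \<in> poly_fun r" by (intro poly_fun.intros p q)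
  moreover have "f g * h g = (p g * q g) / det g ^ (k + l)" if "g \<in> GL r" for g
    using p(2)[OF that] q(2)[OF that] by (simp add: power_add)
  ultimately show ?thesis unfolding regular_GL_def by (intro exI[of _ "\<lambda>g. p g * q g"] exI[of _ "k + l"]) simp
qed

lemma regular_GL_const: "regular_GL r (\<lambda>g. c)"
  by (intro regular_GL_poly_fun poly_fun.const)

lemma regular_GL_sum: "(\<And>s. s \<in> A \<Longrightarrow> regular_GL r (f s)) \<Longrightarrow> regular_GL r (\<lambda>g. \<Sum>s\<in>A. f s g)"
  by (induction A rule: infinite_finite_induct) (auto intro: regular_GL_add regular_GL_const)

lemma regular_GL_diff: "regular_GL r f \<Longrightarrow> regular_GL r h \<Longrightarrow> regular_GL r (\<lambda>g. f g - h g)"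
  using regular_GL_add[of r f "\<lambda>g. (-1) * h g"] regular_GL_mult[of r "\<lambda>g. -1" h] regular_GL_const[of r "-1"] by simp

lemma regular_GL_line:
  assumes "regular_GL r f" "G \<in> carrier_mat r r" "Y \<in> carrier_mat r r"
    and d: "\<And>t. det (G + t \<cdot>\<^sub>m Y) = poly d t"
  obtains p k where "\<And>t. poly d t \<noteq> 0 \<Longrightarrow> f (G + t \<cdot>\<^sub>m Y) = poly p t / poly d t ^ k"
proof -
  obtain q k where q: "q \<in> poly_fun r" "\<And>g. g \<in> GL r \<Longrightarrow> f g = q g / det g ^ k" using assms(1) unfolding regular_GL_def by blast
  obtain p where p: "\<And>t. q (G + t \<cdot>\<^sub>m Y) = poly p t" using poly_fun_line[OF q(1) assms(2,3)] by blast
  show thesis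
  proof (rule that)
    fix t assume "poly d t \<noteq> 0"
    then have "G + t \<cdot>\<^sub>m Y \<in> GL r" using assms(2,3) d[of t] by (simp add: GL_def)
    then show "f (G + t \<cdot>\<^sub>m Y) = poly p t / poly d t ^ k" using q(2) p d by simp
  qed
qed

section \<open>Derivatives along left-invariant fields, and the derivative of the
  determinant\<close>

lemma livf_eqI: "((\<lambda>t. f (g + t \<cdot>\<^sub>m (g * X))) has_field_derivative D) (at 0) \<Longrightarrow> livf r X f g = D"
  unfolding livf_def by (rule some_equality) (auto intro: DERIV_unique)

text \<open>On a line through \<open>g\<close> a regular function is rational with denominator
  nonzero near the base point, so the choice operator in \<open>livf\<close> selects a genuine
  derivative.\<close>

lemma livf_deriv:
  assumes "regular_GL r f" "g \<in> GL r" "X \<in> carrier_mat r r"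
  shows "((\<lambda>t. f (g + t \<cdot>\<^sub>m (g * X))) has_field_derivative livf r X f g) (at 0)"
proof -
  have Y: "g * X \<in> carrier_mat r r" by (intro mult_carrier_mat[of _ r r] GL_carrier assms)
  obtain d :: "complex poly" where d: "\<And>t. det (g + t \<cdot>\<^sub>m (g * X)) = poly d t" using det_line GL_carrier assms(2) Y by blast
  obtain p k where p: "\<And>t. poly d t \<noteq> 0 \<Longrightarrow> f (g + t \<cdot>\<^sub>m (g * X)) = poly p t / poly d t ^ k"
    using regular_GL_line[OF assms(1) GL_carrier[OF assms(2)] Y d] by blast
  have ev: "\<forall>\<^sub>F t in nhds 0. poly d t \<noteq> 0"
    using eventually_GL[OF assms(2) Y] by (rule eventually_mono) (auto simp: GL_def d)
  then have "poly d 0 \<noteq> 0" by (rule eventually_nhds_x_imp_x)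
  then have "((\<lambda>t. poly p t / poly d t ^ k) has_field_derivative
      (poly (pderiv p) 0 * poly d 0 ^ k - poly p 0 * (of_nat k * (poly (pderiv d) 0 * poly d 0 ^ (k - Suc 0)))) / (poly d 0 ^ k * poly d 0 ^ k)) (at 0)"
    by (intro DERIV_divide DERIV_power poly_DERIV) simp
  moreover have "\<forall>\<^sub>F t in nhds 0. f (g + t \<cdot>\<^sub>m (g * X)) = poly p t / poly d t ^ k"
    using ev by (rule eventually_mono) (rule p)
  ultimately have "((\<lambda>t. f (g + t \<cdot>\<^sub>m (g * X))) has_field_derivative
      (poly (pderiv p) 0 * poly d 0 ^ k - poly p 0 * (of_nat k * (poly (pderiv d) 0 * poly d 0 ^ (k - Suc 0)))) / (poly d 0 ^ k * poly d 0 ^ k)) (at 0)"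
    by (subst DERIV_cong_ev[OF refl _ refl])
  then show ?thesis using livf_eqI by metis
qed

lemma livf_cong:
  assumes "g \<in> GL r" "X \<in> carrier_mat r r" "\<And>h. h \<in> GL r \<Longrightarrow> f h = f' h"
  shows "livf r X f g = livf r X f' g"
proof -
  have Y: "g * X \<in> carrier_mat r r" by (intro mult_carrier_mat[of _ r r] GL_carrier assms)
  have "\<forall>\<^sub>F t in nhds 0. f (g + t \<cdot>\<^sub>m (g * X)) = f' (g + t \<cdot>\<^sub>m (g * X))"
    using eventually_GL[OF assms(1) Y] by (rule eventually_mono) (rule assms(3))
  then show ?thesis unfolding livf_def by (simp add: DERIV_cong_ev[OF refl _ refl])
qed

definition trace :: "nat \<Rightarrow> complex mat \<Rightarrow> complex" where
  "trace r X = (\<Sum>i<r. X $$ (i, i))"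

text \<open>Differentiating a Leibniz term replaces one factor only. A permutation other than the
  identity moves at least two points, so a zero off-diagonal entry of the identity matrix survives
  in each of its terms.\<close>

lemma det_deriv:
  assumes X: "X \<in> carrier_mat r r"
  shows "((\<lambda>t. det (1\<^sub>m r + t \<cdot>\<^sub>m X)) has_field_derivative trace r X) (at 0)"
proof -
  let ?P = "{p. p permutes {0..<r}}"
  let ?f = "\<lambda>p t. \<Prod>i = 0..<r. 1\<^sub>m r $$ (i, p i) + t * X $$ (i, p i)"
  define d where "d p = (\<Sum>i = 0..<r. X $$ (i, p i) * (\<Prod>j\<in>{0..<r} - {i}. 1\<^sub>m r $$ (j, p j)))" for p
  have d_other: "d p = 0" if p: "p permutes {0..<r}" "p \<noteq> id" for p
  proof -
    obtain k where k: "p k \<noteq> k" using p(2) by (auto simp: fun_eq_iff)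
    have "p (p k) \<noteq> p k" using permutes_inj[OF p(1)] k by (simp add: inj_eq)
    have mem: "k \<in> {0..<r}" "p k \<in> {0..<r}" using p(1) k by (metis permutes_not_in, metis permutes_not_in permutes_in_image)
    have zero: "(\<Prod>j\<in>{0..<r} - {i}. 1\<^sub>m r $$ (j, p j)) = (0::complex)" for i
    proof (rule prod_zero)
      show "\<exists>j\<in>{0..<r} - {i}. 1\<^sub>m r $$ (j, p j) = (0::complex)"
      proof (cases "i = k")
        case True
        have "p (p k) < r" using mem(2) p(1) by (metis atLeastLessThan_iff permutes_in_image)
        then show ?thesis using True mem k \<open>p (p k) \<noteq> p k\<close> by (intro bexI[of _ "p k"]) auto
      next
        case False
        then show ?thesis using mem k by (intro bexI[of _ k]) auto
      qed
    qed simp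
    show ?thesis unfolding d_def zero by simp
  qed
  have "((\<lambda>t. \<Sum>p\<in>?P. signof p * ?f p t) has_field_derivative (\<Sum>p\<in>?P. signof p * d p)) (at 0)"
  proof (intro DERIV_sum DERIV_cmult)
    fix p
    have "(?f p has_field_derivative (\<Sum>i = 0..<r. X $$ (i, p i) * (\<Prod>j\<in>{0..<r} - {i}. 1\<^sub>m r $$ (j, p j) + 0 * X $$ (j, p j)))) (at 0)"
      by (rule has_field_derivative_prod) (auto intro!: derivative_eq_intros)
    then show "(?f p has_field_derivative d p) (at 0)" by (simp add: d_def)
  qed
  moreover have "(\<Sum>p\<in>?P. signof p * d p) = trace r X"
  proof -
    have "(\<Sum>p\<in>?P. signof p * d p) = (\<Sum>p\<in>{id}. signof p * d p)"
      by (rule sum.mono_neutral_right) (auto simp: finite_permutations permutes_id d_other)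
    also have "\<dots> = d id" by simp
    also have "\<dots> = trace r X" by (simp add: d_def trace_def atLeast0LessThan)
    finally show ?thesis .
  qed
  moreover have "det (1\<^sub>m r + t \<cdot>\<^sub>m X) = (\<Sum>p\<in>?P. signof p * ?f p t)" for t
  proof -
    have "det (1\<^sub>m r + t \<cdot>\<^sub>m X) = (\<Sum>p\<in>?P. signof p * (\<Prod>i = 0..<r. (1\<^sub>m r + t \<cdot>\<^sub>m X) $$ (i, p i)))"
      using X by (intro det_def') auto
    also have "\<dots> = (\<Sum>p\<in>?P. signof p * ?f p t)"
    proof (intro sum.cong refl arg_cong2[of _ _ _ _ "(*)"] prod.cong)
      fix p i assume "p \<in> ?P" "i \<in> {0..<r}"
      then have "p i < r" "i < r" by (auto simp: permutes_in_image)
      then show "(1\<^sub>m r + t \<cdot>\<^sub>m X) $$ (i, p i) = 1\<^sub>m r $$ (i, p i) + t * X $$ (i, p i)" using X by auto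
    qed
    finally show ?thesis .
  qed
  ultimately show ?thesis by simp
qed

lemma pullback_obj_trace: "X \<in> carrier_mat r r \<Longrightarrow> pullback_obj r A X = trace r X \<cdot>\<^sub>m A"
  unfolding pullback_obj_def using det_deriv[of X r]
  by (intro arg_cong2[of _ _ _ _ "(\<cdot>\<^sub>m)"] some_equality refl) (auto intro: DERIV_unique)

lemma det_translate:
  assumes "g \<in> carrier_mat r r" "X \<in> carrier_mat r r"
  shows "det (g + t \<cdot>\<^sub>m (g * X)) = det g * det (1\<^sub>m r + t \<cdot>\<^sub>m X)"
proof -
  have "g + t \<cdot>\<^sub>m (g * X) = g * (1\<^sub>m r + t \<cdot>\<^sub>m X)"
    using assms by (simp add: mult_add_distrib_mat[of g r r _ r] mult_smult_distrib[of g r r X r])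
  then show ?thesis using assms by (simp add: det_mult)
qed

lemma det_translate_deriv:
  assumes "g \<in> carrier_mat r r" "X \<in> carrier_mat r r"
  shows "((\<lambda>t. det (g + t \<cdot>\<^sub>m (g * X))) has_field_derivative det g * trace r X) (at 0)"
  unfolding det_translate[OF assms] by (intro DERIV_cmult det_deriv assms)

section \<open>Pullback along the determinant\<close>

lemma trace_linear:
  assumes "X \<in> carrier_mat r r" "Y \<in> carrier_mat r r"
  shows "trace r (c \<cdot>\<^sub>m X + d \<cdot>\<^sub>m Y) = c * trace r X + d * trace r Y"
  using assms by (auto simp: trace_def sum.distrib sum_distrib_left)

lemma trace_commutator:
  assumes "X \<in> carrier_mat r r" "Y \<in> carrier_mat r r"
  shows "trace r (X * Y - Y * X) = 0"
proof -
  have "trace r (X * Y - Y * X) = (\<Sum>i<r. \<Sum>k<r. X $$ (i, k) * Y $$ (k, i)) - (\<Sum>i<r. \<Sum>k<r. Y $$ (i, k) * X $$ (k, i))"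
    using assms by (auto simp: trace_def scalar_prod_def sum_subtractf atLeast0LessThan intro!: sum.cong)
  also have "(\<Sum>i<r. \<Sum>k<r. X $$ (i, k) * Y $$ (k, i)) = (\<Sum>k<r. \<Sum>i<r. Y $$ (k, i) * X $$ (i, k))"
    by (subst sum.swap) (simp add: mult.commute)
  finally show ?thesis by simp
qed

lemma mult_mat_entry:
  assumes "A \<in> carrier_mat m k" "B \<in> carrier_mat k n" "i < m" "j < n"
  shows "(A * B) $$ (i, j) = (\<Sum>l<k. A $$ (i, l) * B $$ (l, j))"
  using assms by (auto simp: scalar_prod_def atLeast0LessThan intro!: sum.cong)

lemma pullback_obj_carrier:
  assumes "obj_Gm n A" "X \<in> carrier_mat r r"
  shows "pullback_obj r A X \<in> carrier_mat n n"
  using assms by (simp add: pullback_obj_trace obj_Gm_def)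

lemma pullback_obj_entry:
  assumes "obj_Gm n A" "X \<in> carrier_mat r r" "i < n" "j < n"
  shows "pullback_obj r A X $$ (i, j) = trace r X * A $$ (i, j)"
  using assms by (simp add: pullback_obj_trace obj_Gm_def)

text \<open>The trace kills commutators and multiples of one matrix commute, so both parts of the
  flatness equation vanish separately.\<close>

lemma obj_GL_pullback:
  assumes A: "obj_Gm n A"
  shows "obj_GL r n (pullback_obj r A)"
proof -
  have [simp]: "A \<in> carrier_mat n n" using A by (simp add: obj_Gm_def)
  then have [simp]: "dim_row A = n" "dim_col A = n" by blast+
  have "(c * x + d * y) \<cdot>\<^sub>m A = c \<cdot>\<^sub>m (x \<cdot>\<^sub>m A) + d \<cdot>\<^sub>m (y \<cdot>\<^sub>m A)" for c d x y
    by (intro eq_matI) (auto simp: algebra_simps)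
  moreover have "- ((0::complex) \<cdot>\<^sub>m A) + ((x \<cdot>\<^sub>m A) * (y \<cdot>\<^sub>m A) - (y \<cdot>\<^sub>m A) * (x \<cdot>\<^sub>m A)) = 0\<^sub>m n n" for x y
    by (intro eq_matI) (auto simp: mult_smult_distrib[of _ n n _ n] mult_smult_assoc_mat[of _ n n _ n]
        algebra_simps simp del: index_mult_mat(1))
  moreover have "pullback_obj r A (X * Y - Y * X) = 0 \<cdot>\<^sub>m A" if "X \<in> carrier_mat r r" "Y \<in> carrier_mat r r" for X Y
  proof -
    have "X * Y - Y * X \<in> carrier_mat r r" using that by (intro minus_carrier_mat mult_carrier_mat)
    then show ?thesis using that by (simp add: pullback_obj_trace trace_commutator)
  qed
  ultimately show ?thesis
    unfolding obj_GL_def by (auto simp: pullback_obj_trace trace_linear trace_commutator)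
qed

lemma mat_eq_carrier_iff:
  "X \<in> carrier_mat m n \<Longrightarrow> Y \<in> carrier_mat m n \<Longrightarrow> X = Y \<longleftrightarrow> (\<forall>i<m. \<forall>j<n. X $$ (i, j) = Y $$ (i, j))"
  by (auto simp: mat_eq_iff)

lemma intertwiner_iff:
  assumes "B \<in> carrier_mat m m" "F \<in> carrier_mat m n" "A \<in> carrier_mat n n"
  shows "mat m n (\<lambda>(i, j). c i j) + B * F = F * A \<longleftrightarrow>
    (\<forall>i<m. \<forall>j<n. c i j + (\<Sum>l<m. B $$ (i, l) * F $$ (l, j)) = (\<Sum>l<n. F $$ (i, l) * A $$ (l, j)))"
proof -
  have "(mat m n (\<lambda>(i, j). c i j) + B * F) $$ (i, j) = c i j + (\<Sum>l<m. B $$ (i, l) * F $$ (l, j))" if "i < m" "j < n" for i j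
    unfolding mult_mat_entry[OF assms(1,2) that, symmetric] using that assms by (subst index_add_mat) auto
  moreover have "mat m n (\<lambda>(i, j). c i j) + B * F \<in> carrier_mat m n" "F * A \<in> carrier_mat m n"
    using assms by auto
  ultimately show ?thesis using mult_mat_entry[OF assms(2,3)] by (simp add: mat_eq_carrier_iff del: index_mult_mat(1))
qed

lemma hom_GL_iff:
  assumes "\<And>X. X \<in> carrier_mat r r \<Longrightarrow> a X \<in> carrier_mat n n" "\<And>X. X \<in> carrier_mat r r \<Longrightarrow> b X \<in> carrier_mat m m"
  shows "hom_GL r n a m b F \<longleftrightarrow> (\<forall>g\<in>GL r. F g \<in> carrier_mat m n) \<and>
     (\<forall>i<m. \<forall>j<n. regular_GL r (\<lambda>g. F g $$ (i, j))) \<and>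
     (\<forall>X\<in>carrier_mat r r. \<forall>g\<in>GL r. \<forall>i<m. \<forall>j<n.
        livf r X (\<lambda>h. F h $$ (i, j)) g + (\<Sum>l<m. b X $$ (i, l) * F g $$ (l, j)) = (\<Sum>l<n. F g $$ (i, l) * a X $$ (l, j)))"
  unfolding hom_GL_def
  by (intro conj_cong refl ball_cong intertwiner_iff) (use assms in auto)

lemma hom_GL_pullback_iff:
  assumes A: "obj_Gm n A" and B: "obj_Gm m B"
  shows "hom_GL r n (pullback_obj r A) m (pullback_obj r B) F \<longleftrightarrow> (\<forall>g\<in>GL r. F g \<in> carrier_mat m n) \<and>
     (\<forall>i<m. \<forall>j<n. regular_GL r (\<lambda>g. F g $$ (i, j))) \<and>
     (\<forall>X\<in>carrier_mat r r. \<forall>g\<in>GL r. \<forall>i<m. \<forall>j<n. livf r X (\<lambda>h. F h $$ (i, j)) g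
        = trace r X * ((\<Sum>l<n. F g $$ (i, l) * A $$ (l, j)) - (\<Sum>l<m. B $$ (i, l) * F g $$ (l, j))))"
proof (subst hom_GL_iff)
  show "pullback_obj r A X \<in> carrier_mat n n" "pullback_obj r B X \<in> carrier_mat m m" if "X \<in> carrier_mat r r" for X
    using that pullback_obj_carrier A B by blast+
qed (intro conj_cong refl ball_cong all_cong,
    auto simp: pullback_obj_entry[OF A] pullback_obj_entry[OF B] sum_distrib_left right_diff_distrib eq_diff_eq mult_ac)

lemma hom_Gm_iff:
  assumes "obj_Gm n A" "obj_Gm m B"
  shows "hom_Gm n A m B F \<longleftrightarrow> (\<forall>z. z \<noteq> 0 \<longrightarrow> F z \<in> carrier_mat m n) \<and>
     (\<forall>i<m. \<forall>j<n. regular_Gm (\<lambda>z. F z $$ (i, j))) \<and>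
     (\<forall>z. z \<noteq> 0 \<longrightarrow> (\<forall>i<m. \<forall>j<n.
        livf_Gm (\<lambda>w. F w $$ (i, j)) z + (\<Sum>l<m. B $$ (i, l) * F z $$ (l, j)) = (\<Sum>l<n. F z $$ (i, l) * A $$ (l, j))))"
  unfolding hom_Gm_def
  by (intro conj_cong refl all_cong intertwiner_iff) (use assms in \<open>auto simp: obj_Gm_def\<close>)

lemma livf_Gm_deriv:
  assumes "regular_Gm f" "z \<noteq> 0"
  shows "\<exists>D. (f has_field_derivative D) (at z) \<and> livf_Gm f z = z * D"
proof -
  obtain p k where p: "\<And>z. z \<noteq> 0 \<Longrightarrow> f z = poly p z / z ^ k" using assms(1) unfolding regular_Gm_def by blast
  have "((\<lambda>z. poly p z / z ^ k) has_field_derivative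
      (poly (pderiv p) z * z ^ k - poly p z * (of_nat k * (1 * z ^ (k - Suc 0)))) / (z ^ k * z ^ k)) (at z)"
    using assms(2) by (intro DERIV_divide DERIV_power poly_DERIV DERIV_ident) simp
  moreover have ev: "\<forall>\<^sub>F w in nhds z. f w = poly p w / w ^ k"
  proof (rule eventually_mono)
    have "open (- {0::complex})" by auto
    then show "\<forall>\<^sub>F w in nhds z. w \<in> - {0}" using assms(2) by (intro eventually_nhds_in_open) auto
  qed (use p in auto)
  ultimately obtain D where D: "(f has_field_derivative D) (at z)"
    unfolding DERIV_cong_ev[OF refl ev refl, symmetric] by blast
  moreover have "(SOME D. (f has_field_derivative D) (at z)) = D"
    using D by (intro some_equality) (auto intro: DERIV_unique)
  ultimately show ?thesis unfolding livf_Gm_def by blast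
qed

lemma regular_Gm_pullback:
  assumes "regular_Gm f" shows "regular_GL r (\<lambda>g. f (det g))"
proof -
  obtain p k where p: "\<And>z. z \<noteq> 0 \<Longrightarrow> f z = poly p z / z ^ k" using assms unfolding regular_Gm_def by blast
  obtain d where d: "d \<in> poly_fun r" "\<And>g. g \<in> carrier_mat r r \<Longrightarrow> det g = d g" using det_poly_fun by blast
  have "(\<lambda>g. \<Sum>i\<le>degree p. coeff p i * d g ^ i) \<in> poly_fun r"
    by (intro poly_fun_sum poly_fun.intros poly_fun_power d)
  then have "(\<lambda>g. poly p (d g)) \<in> poly_fun r" by (simp add: poly_altdef)
  moreover have "f (det g) = poly p (d g) / det g ^ k" if "g \<in> GL r" for g
    using p[OF GL_det[OF that]] d(2)[OF GL_carrier[OF that]] by simp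
  ultimately show ?thesis unfolding regular_GL_def by (intro exI[of _ "\<lambda>g. poly p (d g)"] exI[of _ k]) simp
qed

lemma livf_pullback:
  assumes "regular_Gm f" "g \<in> GL r" "X \<in> carrier_mat r r"
  shows "livf r X (\<lambda>h. f (det h)) g = trace r X * livf_Gm f (det g)"
proof -
  obtain D where D: "(f has_field_derivative D) (at (det g))" "livf_Gm f (det g) = det g * D"
    using livf_Gm_deriv[OF assms(1) GL_det[OF assms(2)]] by blast
  have "g + 0 \<cdot>\<^sub>m (g * X) = g" using GL_carrier[OF assms(2)] assms(3) by (intro eq_matI) auto
  then have "(f has_field_derivative D) (at (det (g + 0 \<cdot>\<^sub>m (g * X))))" using D(1) by simp
  from DERIV_chain2[OF this det_translate_deriv[OF GL_carrier[OF assms(2)] assms(3)]]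
  have "((\<lambda>t. f (det (g + t \<cdot>\<^sub>m (g * X)))) has_field_derivative D * (det g * trace r X)) (at 0)" .
  from livf_eqI[of "\<lambda>h. f (det h)", OF this] show ?thesis using D(2) by simp
qed

lemma hom_GL_pullback:
  assumes A: "obj_Gm n A" and B: "obj_Gm m B" and F: "hom_Gm n A m B F"
  shows "hom_GL r n (pullback_obj r A) m (pullback_obj r B) (pullback_hom F)"
  unfolding hom_GL_pullback_iff[OF A B] pullback_hom_def
proof (intro conjI ballI allI impI)
  note F' = F[unfolded hom_Gm_iff[OF A B]]
  {
    fix g assume "g \<in> GL r"
    then show "F (det g) \<in> carrier_mat m n" using F' GL_det by blast
  }
  fix i j assume ij: "i < m" "j < n"
  then have reg: "regular_Gm (\<lambda>z. F z $$ (i, j))" using F' by blast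
  then show "regular_GL r (\<lambda>g. F (det g) $$ (i, j))" by (rule regular_Gm_pullback)
  fix X g :: "complex mat" assume X: "X \<in> carrier_mat r r" and g: "g \<in> GL r"
  have "livf_Gm (\<lambda>w. F w $$ (i, j)) (det g) + (\<Sum>l<m. B $$ (i, l) * F (det g) $$ (l, j)) = (\<Sum>l<n. F (det g) $$ (i, l) * A $$ (l, j))"
    using F' ij GL_det[OF g] by blast
  then have "livf_Gm (\<lambda>w. F w $$ (i, j)) (det g) = (\<Sum>l<n. F (det g) $$ (i, l) * A $$ (l, j)) - (\<Sum>l<m. B $$ (i, l) * F (det g) $$ (l, j))"
    by (simp only: eq_diff_eq)
  then show "livf r X (\<lambda>h. F (det h) $$ (i, j)) g
      = trace r X * ((\<Sum>l<n. F (det g) $$ (i, l) * A $$ (l, j)) - (\<Sum>l<m. B $$ (i, l) * F (det g) $$ (l, j)))"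
    unfolding livf_pullback[OF reg g X] by (simp only:)
qed

section \<open>A section of the determinant, and restriction of morphisms to it\<close>

definition diag_first :: "nat \<Rightarrow> complex \<Rightarrow> complex mat" where
  "diag_first r z = mat r r (\<lambda>(i, j). if i = j then if i = 0 then z else 1 else 0)"

definition unit_mat :: "nat \<Rightarrow> nat \<Rightarrow> nat \<Rightarrow> complex mat" where
  "unit_mat r i j = mat r r (\<lambda>p. if p = (i, j) then 1 else 0)"

lemma unit_mat_carrier [simp]: "unit_mat r i j \<in> carrier_mat r r"
  by (simp add: unit_mat_def)

lemma trace_unit_mat: "i < r \<Longrightarrow> trace r (unit_mat r i j) = (if i = j then 1 else 0)"
  by (auto simp: trace_def unit_mat_def sum.If_cases cong: if_cong intro!: sum.neutral)

lemma diag_first_carrier [simp]: "diag_first r z \<in> carrier_mat r r"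
  by (simp add: diag_first_def)

lemma det_diag_first: "r \<ge> 1 \<Longrightarrow> det (diag_first r z) = z"
proof -
  assume "r \<ge> 1"
  have "det (diag_first r z) = prod_list (diag_mat (diag_first r z))"
    by (intro det_upper_triangular) (auto simp: diag_first_def upper_triangular_def)
  also have "\<dots> = (\<Prod>i = 0..<r. diag_first r z $$ (i, i))"
    by (simp add: prod_list_diag_prod diag_first_def)
  also have "\<dots> = (\<Prod>i = 0..<r. if i = 0 then z else 1)" by (intro prod.cong) (auto simp: diag_first_def)
  also have "\<dots> = z" using \<open>r \<ge> 1\<close> by (simp add: prod.If_cases)
  finally show ?thesis .
qed

lemma diag_first_line: "diag_first r (z + t) = diag_first r z + t \<cdot>\<^sub>m unit_mat r 0 0"
  by (intro eq_matI) (auto simp: diag_first_def unit_mat_def)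

lemma diag_first_translate:
  assumes "r \<ge> 1" shows "diag_first r z + t \<cdot>\<^sub>m (diag_first r z * unit_mat r 0 0) = diag_first r (z + t * z)"
proof -
  have "diag_first r z * unit_mat r 0 0 = z \<cdot>\<^sub>m unit_mat r 0 0"
  proof (intro eq_matI)
    fix i j assume "i < dim_row (z \<cdot>\<^sub>m unit_mat r 0 0)" "j < dim_col (z \<cdot>\<^sub>m unit_mat r 0 0)"
    then have ij: "i < r" "j < r" by (auto simp: unit_mat_def)
    have "(diag_first r z * unit_mat r 0 0) $$ (i, j) = (\<Sum>l<r. diag_first r z $$ (i, l) * unit_mat r 0 0 $$ (l, j))"
      by (rule mult_mat_entry[OF _ _ ij]) auto
    also have "\<dots> = (\<Sum>l<r. if l = i then (if i = 0 then z else 1) * unit_mat r 0 0 $$ (i, j) else 0)"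
      using ij by (intro sum.cong) (auto simp: diag_first_def)
    also have "\<dots> = (if i = 0 then z else 1) * unit_mat r 0 0 $$ (i, j)" using ij by simp
    finally show "(diag_first r z * unit_mat r 0 0) $$ (i, j) = (z \<cdot>\<^sub>m unit_mat r 0 0) $$ (i, j)"
      using ij by (auto simp: unit_mat_def)
  qed (auto simp: unit_mat_def diag_first_def)
  then show ?thesis unfolding diag_first_line by (intro eq_matI) (auto simp: unit_mat_def)
qed

lemma diag_first_GL: "r \<ge> 1 \<Longrightarrow> z \<noteq> 0 \<Longrightarrow> diag_first r z \<in> GL r"
  by (simp add: GL_def det_diag_first)

lemma diag_first_1: "diag_first r 1 = 1\<^sub>m r"
  by (intro eq_matI) (auto simp: diag_first_def)

text \<open>Along the section, the left-invariant field of E_11 is z d/dz and its trace is 1, so the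
  equation over GL_r specializes to the one over G_m.\<close>

lemma hom_Gm_restrict:
  assumes r: "r \<ge> 1" and A: "obj_Gm n A" and B: "obj_Gm m B"
    and G: "hom_GL r n (pullback_obj r A) m (pullback_obj r B) G"
  shows "hom_Gm n A m B (\<lambda>z. G (diag_first r z))"
  unfolding hom_Gm_iff[OF A B]
proof (intro conjI allI impI)
  note G' = G[unfolded hom_GL_pullback_iff[OF A B]]
  fix z :: complex assume "z \<noteq> 0"
  then show "G (diag_first r z) \<in> carrier_mat m n" using G' diag_first_GL[OF r] by blast
next
  note G' = G[unfolded hom_GL_pullback_iff[OF A B]]
  have reg: "regular_Gm (\<lambda>z. G (diag_first r z) $$ (i, j))" if ij: "i < m" "j < n" for i j
  proof -
    obtain p k where p: "p \<in> poly_fun r" "\<And>g. g \<in> GL r \<Longrightarrow> G g $$ (i, j) = p g / det g ^ k"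
      using G' ij unfolding regular_GL_def by blast
    obtain q where q: "\<And>t. p (diag_first r 0 + t \<cdot>\<^sub>m unit_mat r 0 0) = poly q t"
      using poly_fun_line[OF p(1) diag_first_carrier unit_mat_carrier] by blast
    have "G (diag_first r z) $$ (i, j) = poly q z / z ^ k" if "z \<noteq> 0" for z
      using p(2)[OF diag_first_GL[OF r that]] q[of z] diag_first_line[of r 0 z] by (simp add: det_diag_first[OF r])
    then show ?thesis unfolding regular_Gm_def by blast
  qed
  {
    fix i j assume "i < m" "j < n"
    then show "regular_Gm (\<lambda>z. G (diag_first r z) $$ (i, j))" by (rule reg)
  }
  fix z :: complex and i j assume z: "z \<noteq> 0" and ij: "i < m" "j < n"
  let ?X = "unit_mat r 0 0"
  obtain D where D: "((\<lambda>z. G (diag_first r z) $$ (i, j)) has_field_derivative D) (at z)"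
    "livf_Gm (\<lambda>z. G (diag_first r z) $$ (i, j)) z = z * D"
    using livf_Gm_deriv[OF reg[OF ij] z] by blast
  have "((\<lambda>t. G (diag_first r (z + t * z)) $$ (i, j)) has_field_derivative D * z) (at 0)"
  proof (rule DERIV_chain2[of "\<lambda>z. G (diag_first r z) $$ (i, j)"])
    show "((\<lambda>z. G (diag_first r z) $$ (i, j)) has_field_derivative D) (at (z + 0 * z))" using D(1) by simp
    show "((\<lambda>t. z + t * z) has_field_derivative z) (at 0)" by (auto intro!: derivative_eq_intros)
  qed
  then have "livf r ?X (\<lambda>g. G g $$ (i, j)) (diag_first r z) = D * z"
    by (intro livf_eqI) (simp add: diag_first_translate[OF r])
  moreover have "livf r ?X (\<lambda>g. G g $$ (i, j)) (diag_first r z)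
     = trace r ?X * ((\<Sum>l<n. G (diag_first r z) $$ (i, l) * A $$ (l, j)) - (\<Sum>l<m. B $$ (i, l) * G (diag_first r z) $$ (l, j)))"
    using G' ij diag_first_GL[OF r z] unit_mat_carrier by blast
  moreover have "trace r ?X = 1" using r by (simp add: trace_unit_mat)
  ultimately show "livf_Gm (\<lambda>z. G (diag_first r z) $$ (i, j)) z + (\<Sum>l<m. B $$ (i, l) * G (diag_first r z) $$ (l, j))
      = (\<Sum>l<n. G (diag_first r z) $$ (i, l) * A $$ (l, j))"
    using D(2) by (simp add: algebra_simps)
qed

section \<open>Uniqueness of solutions with given value at the identity\<close>

text \<open>If all \<open>p s\<close> vanish through degree l, then so does \<open>R s\<close>, and
  the coefficient of degree l on the left is d_0 (l + 1) times the next coefficient of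
  \<open>p s\<close>. The hypothesis on \<open>R\<close> holds for linear combinations with constant
  coefficients.\<close>

lemma poly_ode_unique:
  fixes p R :: "'s \<Rightarrow> complex poly"
  assumes "coeff d 0 \<noteq> 0"
    and ode: "\<And>s. s \<in> S \<Longrightarrow> d * pderiv (p s) = e * R s"
    and R: "\<And>s k. s \<in> S \<Longrightarrow> (\<And>s'. s' \<in> S \<Longrightarrow> coeff (p s') k = 0) \<Longrightarrow> coeff (R s) k = 0"
    and init: "\<And>s. s \<in> S \<Longrightarrow> coeff (p s) 0 = 0"
    and "s \<in> S"
  shows "p s = 0"
proof -
  have "coeff (p s) k = 0" if "s \<in> S" for s k
    using that
  proof (induction k arbitrary: s rule: less_induct)
    case (less k)
    show ?case
    proof (cases k)
      case 0
      then show ?thesis using init less.prems by simp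
    next
      case (Suc l)
      have "coeff (R s) i = 0" if "i \<le> l" for i
        using R[OF less.prems, of i] less.IH[of i] that Suc by auto
      then have "coeff (e * R s) l = 0" by (simp add: coeff_mult)
      then have "0 = coeff (d * pderiv (p s)) l" using ode less.prems by simp
      also have "\<dots> = (\<Sum>i\<in>{0}. coeff d i * coeff (pderiv (p s)) (l - i))"
        unfolding coeff_mult using less.IH[OF _ less.prems] Suc
        by (intro sum.mono_neutral_right) (auto simp: coeff_pderiv)
      finally show ?thesis using assms(1) Suc by (simp add: coeff_pderiv del: of_nat_Suc)
    qed
  qed
  then show ?thesis using assms(5) by (intro poly_eqI) simp
qed

lemma regular_GL_common_line:
  assumes "finite S" "\<And>s. s \<in> S \<Longrightarrow> regular_GL r (f s)" "G \<in> carrier_mat r r" "Y \<in> carrier_mat r r"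
    and d: "\<And>t. det (G + t \<cdot>\<^sub>m Y) = poly d t"
  shows "\<exists>p K. \<forall>s\<in>S. \<forall>t. poly d t \<noteq> 0 \<longrightarrow> f s (G + t \<cdot>\<^sub>m Y) = poly (p s) t / poly d t ^ K"
proof -
  have "\<exists>p k. \<forall>t. poly d t \<noteq> 0 \<longrightarrow> f s (G + t \<cdot>\<^sub>m Y) = poly p t / poly d t ^ k" if "s \<in> S" for s
    using regular_GL_line[OF assms(2)[OF that] assms(3,4) d] by metis
  then obtain p k where p: "\<And>s t. s \<in> S \<Longrightarrow> poly d t \<noteq> 0 \<Longrightarrow> f s (G + t \<cdot>\<^sub>m Y) = poly (p s) t / poly d t ^ k s"
    by metis
  define K where "K = Max (k ` S)"
  have "f s (G + t \<cdot>\<^sub>m Y) = poly (p s * d ^ (K - k s)) t / poly d t ^ K" if "s \<in> S" "poly d t \<noteq> 0" for s t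
  proof -
    have "k s \<le> K" unfolding K_def using that assms(1) by auto
    then have "poly d t ^ K = poly d t ^ k s * poly d t ^ (K - k s)" by (simp flip: power_add)
    then show ?thesis using p[OF that] that(2) by (simp add: poly_power)
  qed
  then show ?thesis by (intro exI[of _ "\<lambda>s. p s * d ^ (K - k s)"] exI[of _ K]) simp
qed

text \<open>The line from 1 to g may cross det = 0, so values cannot simply be propagated along it.
  Instead the numerators of the restricted functions are shown to be zero polynomials by their
  expansion at t = 0, where the determinant is not zero; this then reaches t = 1.\<close>

lemma linear_ode_unique:
  assumes "finite S" and reg: "\<And>s. s \<in> S \<Longrightarrow> regular_GL r (u s)"
    and ode: "\<And>s g X. s \<in> S \<Longrightarrow> g \<in> GL r \<Longrightarrow> X \<in> carrier_mat r r \<Longrightarrow>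
      livf r X (u s) g = trace r X * (\<Sum>s'\<in>S. c s s' * u s' g)"
    and init: "\<And>s. s \<in> S \<Longrightarrow> u s (1\<^sub>m r) = 0"
    and "s \<in> S" "g \<in> GL r"
  shows "u s g = 0"
proof -
  define Y where "Y = g - 1\<^sub>m r"
  define \<gamma> where "\<gamma> t = 1\<^sub>m r + t \<cdot>\<^sub>m Y" for t
  have g: "g \<in> carrier_mat r r" using GL_carrier assms by blast
  have Y: "Y \<in> carrier_mat r r" using g by (simp add: Y_def minus_carrier_mat)
  have \<gamma>0: "\<gamma> 0 = 1\<^sub>m r" and \<gamma>1: "\<gamma> 1 = g" using g by (auto simp: \<gamma>_def Y_def intro!: eq_matI)
  have \<gamma>: "\<gamma> t \<in> carrier_mat r r" for t using Y by (simp add: \<gamma>_def)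
  have \<gamma>_add: "\<gamma> t + x \<cdot>\<^sub>m Y = \<gamma> (t + x)" for t x
    using Y by (intro eq_matI) (auto simp: \<gamma>_def algebra_simps)
  obtain d :: "complex poly" where d: "\<And>t. det (\<gamma> t) = poly d t"
    unfolding \<gamma>_def using det_line[OF one_carrier_mat Y] by blast
  have GL: "\<gamma> t \<in> GL r \<longleftrightarrow> poly d t \<noteq> 0" for t using \<gamma> d by (simp add: GL_def)
  obtain p K where p: "\<And>s t. s \<in> S \<Longrightarrow> poly d t \<noteq> 0 \<Longrightarrow> u s (\<gamma> t) = poly (p s) t / poly d t ^ K"
    using regular_GL_common_line[where f = u, OF assms(1) reg one_carrier_mat Y d[unfolded \<gamma>_def], folded \<gamma>_def] by blast
  have d0: "poly d 0 \<noteq> 0" using d[of 0] \<gamma>0 by simp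
  \<comment> \<open>Differentiating p / d^K, with d' = d tr X, turns the system into d p' = d' R;
    the summand with \<open>K\<close> stems from the denominator.\<close>
  define R where "R s = smult (of_nat K) (p s) + (\<Sum>s'\<in>S. smult (c s s') (p s'))" for s
  have eq: "poly (d * pderiv (p s)) t = poly (pderiv d * R s) t" if s: "s \<in> S" and t: "poly d t \<noteq> 0" for s t
  proof -
    \<comment> \<open>X is the inverse of \<open>\<gamma> t\<close> times \<open>Y\<close>, so its
      left-invariant field at \<open>\<gamma> t\<close> points along the line.\<close>
    obtain X where X: "X \<in> carrier_mat r r" "\<gamma> t * X = Y"
    proof (rule that)
      have "\<gamma> t * (inverse (det (\<gamma> t)) \<cdot>\<^sub>m (adj_mat (\<gamma> t) * Y)) = inverse (det (\<gamma> t)) \<cdot>\<^sub>m ((\<gamma> t * adj_mat (\<gamma> t)) * Y)"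
        unfolding assoc_mult_mat[OF \<gamma> adj_mat(1)[OF \<gamma>] Y]
        by (rule mult_smult_distrib[OF \<gamma>]) (rule mult_carrier_mat[OF adj_mat(1)[OF \<gamma>] Y])
      also have "\<dots> = Y" unfolding adj_mat(2)[OF \<gamma>] using Y t d
        by (intro eq_matI) (auto simp: mult_smult_assoc_mat[of _ r r _ r])
      finally show "\<gamma> t * (inverse (det (\<gamma> t)) \<cdot>\<^sub>m (adj_mat (\<gamma> t) * Y)) = Y" .
      show "inverse (det (\<gamma> t)) \<cdot>\<^sub>m (adj_mat (\<gamma> t) * Y) \<in> carrier_mat r r"
        by (intro smult_carrier_mat mult_carrier_mat[OF adj_mat(1)[OF \<gamma>] Y])
    qed
    have shift_deriv: "(f has_field_derivative D) (at t)" if "((\<lambda>x. f (t + x)) has_field_derivative D) (at 0)" for f :: "complex \<Rightarrow> complex" and D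
      using that DERIV_shift[of f D 0 t] by (simp add: add.commute)
    have "((\<lambda>x. det (\<gamma> (t + x))) has_field_derivative poly d t * trace r X) (at 0)"
      using det_translate_deriv[OF \<gamma> X(1), of t] unfolding X(2) \<gamma>_add d .
    then have "(poly d has_field_derivative poly d t * trace r X) (at t)"
      unfolding d by (rule shift_deriv)
    then have tr: "poly d t * trace r X = poly (pderiv d) t" using poly_DERIV DERIV_unique by blast
    have "((\<lambda>x. u s (\<gamma> (t + x))) has_field_derivative livf r X (u s) (\<gamma> t)) (at 0)"
      using livf_deriv[OF reg[OF s] _ X(1), of "\<gamma> t"] GL t unfolding X(2) \<gamma>_add by blast
    then have "((\<lambda>x. u s (\<gamma> x)) has_field_derivative livf r X (u s) (\<gamma> t)) (at t)" by (rule shift_deriv)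
    moreover have ev: "\<forall>\<^sub>F x in nhds t. u s (\<gamma> x) = poly (p s) x / poly d x ^ K"
    proof (rule eventually_mono)
      have "open {x. poly d x \<noteq> 0}" by (intro open_Collect_neq continuous_intros)
      then show "\<forall>\<^sub>F x in nhds t. x \<in> {x. poly d x \<noteq> 0}" using t by (intro eventually_nhds_in_open) auto
    qed (use p s in auto)
    ultimately have "((\<lambda>x. poly (p s) x / poly d x ^ K) has_field_derivative livf r X (u s) (\<gamma> t)) (at t)"
      by (simp add: DERIV_cong_ev[OF refl ev refl])
    moreover have "((\<lambda>x. poly (p s) x / poly d x ^ K) has_field_derivative
      (poly (pderiv (p s)) t * poly d t ^ K - poly (p s) t * (of_nat K * (poly (pderiv d) t * poly d t ^ (K - Suc 0)))) / (poly d t ^ K * poly d t ^ K)) (at t)"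
      using t by (intro DERIV_divide DERIV_power poly_DERIV) simp
    ultimately have L: "livf r X (u s) (\<gamma> t) =
      (poly (pderiv (p s)) t * poly d t ^ K - poly (p s) t * (of_nat K * (poly (pderiv d) t * poly d t ^ (K - Suc 0)))) / (poly d t ^ K * poly d t ^ K)"
      using DERIV_unique by blast
    have "livf r X (u s) (\<gamma> t) = trace r X * (\<Sum>s'\<in>S. c s s' * (poly (p s') t / poly d t ^ K))"
      using ode[OF s _ X(1), of "\<gamma> t"] GL t p by (simp cong: sum.cong)
    then have "livf r X (u s) (\<gamma> t) * (poly d t * poly d t ^ K) = poly (pderiv d) t * (\<Sum>s'\<in>S. c s s' * poly (p s') t)"
      using t by (simp add: tr[symmetric] sum_divide_distrib[symmetric])
    moreover have "livf r X (u s) (\<gamma> t) * (poly d t * poly d t ^ K) = poly d t * poly (pderiv (p s)) t - of_nat K * poly (p s) t * poly (pderiv d) t"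
      unfolding L using t by (cases K) (simp_all add: field_simps)
    ultimately show ?thesis unfolding R_def by (simp add: poly_sum algebra_simps)
  qed
  have "d * pderiv (p s) = pderiv d * R s" if "s \<in> S" for s
  proof -
    \<comment> \<open>The extra factor \<open>d\<close> covers the zeros of the determinant, where
      the equation is not known; it is cancelled as a nonzero polynomial.\<close>
    have "poly (d * (d * pderiv (p s) - pderiv d * R s)) t = 0" for t using eq[OF that, of t] by auto
    then have "d * (d * pderiv (p s) - pderiv d * R s) = 0" by (metis poly_all_0_iff_0)
    then show ?thesis using d0 by auto
  qed
  then have "p s = 0"
  proof (rule poly_ode_unique[rotated, where S = S])
    fix s k assume "s \<in> S" "\<And>s'. s' \<in> S \<Longrightarrow> coeff (p s') k = 0"
    then show "coeff (R s) k = 0" by (simp add: R_def coeff_sum)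
  next
    fix s assume s: "s \<in> S"
    show "coeff (p s) 0 = 0" using p[OF s d0] init[OF s] d0 \<gamma>0 by (simp add: poly_0_coeff_0)
  qed (use assms d0 in \<open>auto simp: poly_0_coeff_0\<close>)
  then show ?thesis using p[OF assms(5), of 1] assms(6) \<gamma>1 GL[of 1] by simp
qed

lemma livf_diff:
  assumes "regular_GL r f" "regular_GL r h" "g \<in> GL r" "X \<in> carrier_mat r r"
  shows "livf r X (\<lambda>g. f g - h g) g = livf r X f g - livf r X h g"
  by (intro livf_eqI DERIV_diff livf_deriv assms)

lemma hom_GL_pullback_unique:
  assumes A: "obj_Gm n A" and B: "obj_Gm m B"
    and F: "hom_GL r n (pullback_obj r A) m (pullback_obj r B) F"
    and G: "hom_GL r n (pullback_obj r A) m (pullback_obj r B) G"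
    and "F (1\<^sub>m r) = G (1\<^sub>m r)" and g: "g \<in> GL r"
  shows "F g = G g"
proof -
  note F' = F[unfolded hom_GL_pullback_iff[OF A B]] and G' = G[unfolded hom_GL_pullback_iff[OF A B]]
  let ?u = "\<lambda>(i, j) g. F g $$ (i, j) - G g $$ (i, j)"
  let ?S = "{..<m} \<times> {..<n}"
  \<comment> \<open>The matrix, in entry coordinates, of the operator V -> V A - B V, which governs
    the difference of two morphisms.\<close>
  define c :: "nat \<times> nat \<Rightarrow> nat \<times> nat \<Rightarrow> complex" where
    "c = (\<lambda>(i, j) (k, l). (if i = k then A $$ (l, j) else 0) - (if j = l then B $$ (i, k) else 0))"
  have zero: "?u s g = 0" if "s \<in> ?S" for s
  proof (rule linear_ode_unique[where S = ?S and c = c and r = r])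
    fix s assume "s \<in> ?S"
    then show "regular_GL r (?u s)" using F' G' by (auto intro!: regular_GL_diff)
  next
    fix s :: "nat \<times> nat" and g X :: "complex mat" assume s: "s \<in> ?S" and gX: "g \<in> GL r" "X \<in> carrier_mat r r"
    obtain i j where ij: "s = (i, j)" "i < m" "j < n" using s by (cases s) auto
    have contract: "(\<Sum>s'\<in>?S. c (i, j) s' * v s') = (\<Sum>l<n. A $$ (l, j) * v (i, l)) - (\<Sum>k<m. B $$ (i, k) * v (k, j))" for v
    proof -
      have "(\<Sum>s'\<in>?S. c (i, j) s' * v s')
         = (\<Sum>k<m. \<Sum>l<n. (if k = i then A $$ (l, j) * v (k, l) else 0) - (if l = j then B $$ (i, k) * v (k, l) else 0))"
        unfolding sum.cartesian_product' by (intro sum.cong refl) (simp add: c_def left_diff_distrib)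
      also have "\<dots> = (\<Sum>k<m. if k = i then \<Sum>l<n. A $$ (l, j) * v (k, l) else 0) - (\<Sum>k<m. B $$ (i, k) * v (k, j))"
        unfolding sum_subtractf using ij by (intro arg_cong2[of _ _ _ _ "(-)"] sum.cong) auto
      finally show ?thesis using ij by simp
    qed
    have rhs: "(\<Sum>s'\<in>?S. c s s' * ?u s' g) = (\<Sum>l<n. A $$ (l, j) * ?u (i, l) g) - (\<Sum>k<m. B $$ (i, k) * ?u (k, j) g)"
      unfolding ij(1) by (rule contract)
    have "livf r X (?u s) g = livf r X (\<lambda>h. F h $$ (i, j)) g - livf r X (\<lambda>h. G h $$ (i, j)) g"
      unfolding ij(1) case_prod_conv by (rule livf_diff) (use F' G' ij gX in blast)+
    also have "livf r X (\<lambda>h. F h $$ (i, j)) g = trace r X * ((\<Sum>l<n. F g $$ (i, l) * A $$ (l, j)) - (\<Sum>l<m. B $$ (i, l) * F g $$ (l, j)))"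
      using F' ij gX by blast
    also have "livf r X (\<lambda>h. G h $$ (i, j)) g = trace r X * ((\<Sum>l<n. G g $$ (i, l) * A $$ (l, j)) - (\<Sum>l<m. B $$ (i, l) * G g $$ (l, j)))"
      using G' ij gX by blast
    finally show "livf r X (?u s) g = trace r X * (\<Sum>s'\<in>?S. c s s' * ?u s' g)"
      unfolding rhs case_prod_conv by (simp add: sum_subtractf algebra_simps)
  qed (use that g assms(5) in auto)
  show ?thesis
    using F' G' g zero by (subst mat_eq_carrier_iff[of _ m n]) auto
qed

lemma hom_GL_pullback_full:
  assumes r: "r \<ge> 1" and A: "obj_Gm n A" and B: "obj_Gm m B"
    and G: "hom_GL r n (pullback_obj r A) m (pullback_obj r B) G"
  shows "\<exists>F. hom_Gm n A m B F \<and> (\<forall>g\<in>GL r. G g = pullback_hom F g)"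
proof (intro exI conjI ballI)
  show F: "hom_Gm n A m B (\<lambda>z. G (diag_first r z))" by (rule hom_Gm_restrict[OF assms])
  fix g assume "g \<in> GL r"
  then show "G g = pullback_hom (\<lambda>z. G (diag_first r z)) g"
    by (rule hom_GL_pullback_unique[OF A B G hom_GL_pullback[OF A B F], rotated])
      (simp add: pullback_hom_def diag_first_1)
qed

lemma pullback_obj_tensor:
  assumes A: "obj_Gm n A" and B: "obj_Gm m B" and X: "X \<in> carrier_mat r r"
  shows "pullback_obj r (tensor_Gm n A m B) X = tensor_GL n (pullback_obj r A) m (pullback_obj r B) X"
proof -
  have [simp]: "dim_row A = n" "dim_col A = n" "dim_row B = m" "dim_col B = m" using A B by (auto simp: obj_Gm_def)
  have "i div m < n" "i mod m < m" if "i < n * m" for i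
  proof -
    show "i div m < n" using that by (rule less_mult_imp_div_less)
    have "m > 0" using that by (cases m) auto
    then show "i mod m < m" by simp
  qed
  then show ?thesis using X
    by (intro eq_matI) (auto simp: tensor_GL_def tensor_Gm_def pullback_obj_trace kron_def algebra_simps)
qed

section \<open>Essential surjectivity\<close>

lemma obj_GL_carrier: "obj_GL r n a \<Longrightarrow> X \<in> carrier_mat r r \<Longrightarrow> a X \<in> carrier_mat n n"
  by (simp add: obj_GL_def)

lemma obj_GL_linear:
  "obj_GL r n a \<Longrightarrow> X \<in> carrier_mat r r \<Longrightarrow> Y \<in> carrier_mat r r \<Longrightarrow> a (c \<cdot>\<^sub>m X + d \<cdot>\<^sub>m Y) = c \<cdot>\<^sub>m a X + d \<cdot>\<^sub>m a Y"
  by (simp add: obj_GL_def)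

lemma mat_neg_add_eq_0:
  assumes "U \<in> carrier_mat n n" "V \<in> carrier_mat n n" "- U + V = 0\<^sub>m n n"
  shows "U = (V :: 'a::ring mat)"
proof (rule eq_matI)
  fix i j assume "i < dim_row V" "j < dim_col V"
  then show "U $$ (i, j) = V $$ (i, j)"
    using arg_cong[OF assms(3), of "\<lambda>M. M $$ (i, j)"] assms(1,2) by (simp add: eq_neg_iff_add_eq_0[symmetric])
qed (use assms in auto)

lemma obj_GL_bracket:
  assumes a: "obj_GL r n a" and X: "X \<in> carrier_mat r r" and Y: "Y \<in> carrier_mat r r"
  shows "a (X * Y - Y * X) = a X * a Y - a Y * a X"
proof (rule mat_neg_add_eq_0)
  have "X * Y - Y * X \<in> carrier_mat r r" using X Y by (intro minus_carrier_mat mult_carrier_mat)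
  then show "a (X * Y - Y * X) \<in> carrier_mat n n" by (rule obj_GL_carrier[OF a])
  show "a X * a Y - a Y * a X \<in> carrier_mat n n"
    using obj_GL_carrier[OF a] X Y by (intro minus_carrier_mat mult_carrier_mat)
qed (use assms in \<open>simp add: obj_GL_def\<close>)

lemma obj_GL_zero:
  assumes a: "obj_GL r n a"
  shows "a (0\<^sub>m r r) = 0\<^sub>m n n"
proof -
  have "0 \<cdot>\<^sub>m 0\<^sub>m r r + 0 \<cdot>\<^sub>m 0\<^sub>m r r = (0\<^sub>m r r :: complex mat)" by (intro eq_matI) auto
  then have "a (0\<^sub>m r r) = 0 \<cdot>\<^sub>m a (0\<^sub>m r r) + 0 \<cdot>\<^sub>m a (0\<^sub>m r r)"
    using obj_GL_linear[OF a, of "0\<^sub>m r r" "0\<^sub>m r r" 0 0] by simp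
  also have "\<dots> = 0\<^sub>m n n" using obj_GL_carrier[OF a, of "0\<^sub>m r r"] by (intro eq_matI) auto
  finally show ?thesis .
qed

lemma obj_GL_diff:
  assumes a: "obj_GL r n a" and X: "X \<in> carrier_mat r r" and Y: "Y \<in> carrier_mat r r"
  shows "a (X - Y) = a X - a Y"
proof -
  have "X - Y = 1 \<cdot>\<^sub>m X + (-1) \<cdot>\<^sub>m Y" using X Y by (intro eq_matI) auto
  then have "a (X - Y) = 1 \<cdot>\<^sub>m a X + (-1) \<cdot>\<^sub>m a Y" using obj_GL_linear[OF a X Y] by simp
  also have "\<dots> = a X - a Y" using obj_GL_carrier[OF a X] obj_GL_carrier[OF a Y] by (intro eq_matI) auto
  finally show ?thesis .
qed

lemma obj_GL_expand:
  assumes a: "obj_GL r n a" and X: "X \<in> carrier_mat r r" and uv: "u < n" "v < n"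
  shows "a X $$ (u, v) = (\<Sum>z\<in>{..<r} \<times> {..<r}. X $$ z * a (unit_mat r (fst z) (snd z)) $$ (u, v))"
proof -
  let ?L = "{..<r} \<times> {..<r}"
  define X' where "X' S = mat r r (\<lambda>z. if z \<in> S then X $$ z else 0)" for S
  have "a (X' S) $$ (u, v) = (\<Sum>z\<in>S. X $$ z * a (unit_mat r (fst z) (snd z)) $$ (u, v))" if "finite S" "S \<subseteq> ?L" for S
    using that
  proof (induction S rule: finite_induct)
    case empty
    have "X' {} = 0\<^sub>m r r" by (auto simp: X'_def)
    then show ?case using obj_GL_zero[OF a] uv by simp
  next
    case (insert z S)
    let ?E = "unit_mat r (fst z) (snd z)"
    have c: "X' S \<in> carrier_mat r r" by (simp add: X'_def)
    have "X' (insert z S) = 1 \<cdot>\<^sub>m X' S + X $$ z \<cdot>\<^sub>m ?E"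
      using insert by (intro eq_matI) (auto simp: X'_def unit_mat_def)
    then have "a (X' (insert z S)) = 1 \<cdot>\<^sub>m a (X' S) + X $$ z \<cdot>\<^sub>m a ?E"
      using obj_GL_linear[OF a c unit_mat_carrier] by simp
    then have "a (X' (insert z S)) $$ (u, v) = a (X' S) $$ (u, v) + X $$ z * a ?E $$ (u, v)"
      using obj_GL_carrier[OF a c] obj_GL_carrier[OF a unit_mat_carrier, of "fst z" "snd z"] uv by simp
    then show ?case using insert by simp
  qed
  from this[of ?L] have "a (X' ?L) $$ (u, v) = (\<Sum>z\<in>?L. X $$ z * a (unit_mat r (fst z) (snd z)) $$ (u, v))" by simp
  moreover have "X' ?L = X" using X by (intro eq_matI) (auto simp: X'_def)
  ultimately show ?thesis by simp
qed

lemma unit_mat_mult: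
  assumes "i < r" "j < r" "p < r" "q < r"
  shows "unit_mat r i j * unit_mat r p q = (if j = p then unit_mat r i q else 0\<^sub>m r r)"
proof (rule eq_matI)
  fix k l assume "k < dim_row (if j = p then unit_mat r i q else 0\<^sub>m r r)" "l < dim_col (if j = p then unit_mat r i q else 0\<^sub>m r r)"
  then have kl: "k < r" "l < r" by (auto simp: unit_mat_def split: if_splits)
  have "(unit_mat r i j * unit_mat r p q) $$ (k, l) = (\<Sum>s<r. unit_mat r i j $$ (k, s) * unit_mat r p q $$ (s, l))"
    by (rule mult_mat_entry[OF _ _ kl]) auto
  also have "\<dots> = (\<Sum>s<r. if s = j then (if k = i \<and> j = p \<and> l = q then 1 else 0) else 0)"
    using kl by (intro sum.cong) (auto simp: unit_mat_def)
  also have "\<dots> = (if j = p then unit_mat r i q else 0\<^sub>m r r) $$ (k, l)" using kl assms by (auto simp: unit_mat_def)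
  finally show "(unit_mat r i j * unit_mat r p q) $$ (k, l) = (if j = p then unit_mat r i q else 0\<^sub>m r r) $$ (k, l)" .
qed (auto simp: unit_mat_def)

lemma of_mat_bracket:
  assumes a: "obj_GL r n a" and ran: "i < r" "j < r" "p < r" "q < r"
  defines "b \<equiv> \<lambda>i j. of_mat n (a (unit_mat r i j))"
  shows "b i j * b p q = b p q * b i j + (if j = p then b i q else 0) - (if i = q then b p j else 0)"
proof -
  let ?E = "unit_mat r"
  have c: "a (?E i j) \<in> carrier_mat n n" for i j using obj_GL_carrier[OF a] by simp
  have d: "(if s then ?E i j else 0\<^sub>m r r) \<in> carrier_mat r r" for s i j by simp
  have "b i j * b p q - b p q * b i j = of_mat n (a (?E i j * ?E p q - ?E p q * ?E i j))"
    unfolding obj_GL_bracket[OF a unit_mat_carrier unit_mat_carrier] b_def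
    by (subst of_mat_diff[of _ n]) (auto simp: c of_mat_mult[OF c c] intro!: mult_carrier_mat[OF c c])
  also have "\<dots> = of_mat n (a (if j = p then ?E i q else 0\<^sub>m r r)) - of_mat n (a (if q = i then ?E p j else 0\<^sub>m r r))"
    unfolding unit_mat_mult[OF ran] unit_mat_mult[OF ran(3,4,1,2)] obj_GL_diff[OF a d d]
    by (rule of_mat_diff) (use obj_GL_carrier[OF a d] in blast)+
  also have "\<dots> = (if j = p then b i q else 0) - (if i = q then b p j else 0)"
    by (auto simp: b_def obj_GL_zero[OF a] of_mat_0)
  finally show ?thesis by (simp add: algebra_simps)
qed

text \<open>E_ij has eigenvalue 2 under commutation with E_ii - E_jj, and in finite dimension an
  eigenvector for a nonzero eigenvalue is nilpotent. A maximum gives one exponent for all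
  pairs.\<close>

lemma unit_mat_nilpotent:
  assumes a: "obj_GL r n a"
  obtains N where "\<And>i j. i < r \<Longrightarrow> j < r \<Longrightarrow> i \<noteq> j \<Longrightarrow> of_mat n (a (unit_mat r i j)) ^ Suc N = 0"
proof -
  define b where "b i j = of_mat n (a (unit_mat r i j))" for i j
  have "\<exists>N. b i j ^ Suc N = 0" if ij: "i < r" "j < r" "i \<noteq> j" for i j
    unfolding b_def
  proof (rule of_mat_nilpotent)
    show "a (unit_mat r i j) \<in> carrier_mat n n" using obj_GL_carrier[OF a] by simp
    show "(b i i - b j j) * of_mat n (a (unit_mat r i j)) = of_mat n (a (unit_mat r i j)) * (b i i - b j j) + 2 *\<^sub>R of_mat n (a (unit_mat r i j))"
      using of_mat_bracket[OF a ij(1,1,1,2)] of_mat_bracket[OF a ij(2,2,1,2)] ij(3)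
      by (simp add: b_def algebra_simps scaleR_2)
  qed simp
  then obtain N where N: "\<And>i j. i < r \<Longrightarrow> j < r \<Longrightarrow> i \<noteq> j \<Longrightarrow> b i j ^ Suc (N i j) = 0" by metis
  define M where "M = Max ((\<lambda>(i, j). N i j) ` ({..<r} \<times> {..<r}))"
  have "b i j ^ Suc M = 0" if ij: "i < r" "j < r" "i \<noteq> j" for i j
  proof (rule power_zero_le[OF N[OF ij]])
    have "N i j \<le> M" unfolding M_def using ij by (intro Max_ge) force+
    then show "Suc (N i j) \<le> Suc M" by simp
  qed
  then show thesis using that unfolding b_def by blast
qed

section \<open>Existence of a polynomial solution\<close>

lemma poly_fun_wsum:
  assumes "\<And>z. z \<in> {..<r} \<times> {..<r} \<Longrightarrow> (\<lambda>g. Y g z) \<in> poly_fun r"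
  shows "(\<lambda>g. wsum r k (Y g) \<psi>) \<in> poly_fun r"
  by (induction k arbitrary: \<psi>) (auto intro!: poly_fun.intros poly_fun_sum assms)

lemma poly_fun_divide_const: "f \<in> poly_fun r \<Longrightarrow> (\<lambda>g. f g / c) \<in> poly_fun r"
  using poly_fun.mult[OF _ poly_fun.const[of "inverse c"]] by (simp add: divide_inverse)

lemma polynomial_trivialization:
  assumes r: "r \<ge> 1" and a: "obj_GL r n a"
  obtains K F where
    "\<And>i j. i < n \<Longrightarrow> j < n \<Longrightarrow> (\<lambda>g. F g $$ (i, j)) \<in> poly_fun r"
    "hom_GL r n (pullback_obj r (a (unit_mat r 0 0) + of_nat K \<cdot>\<^sub>m 1\<^sub>m n)) n a F" "F (1\<^sub>m r) = 1\<^sub>m n"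
proof -
  define b where "b i j = of_mat n (a (unit_mat r i j))" for i j
  obtain N where N: "\<And>i j. i < r \<Longrightarrow> j < r \<Longrightarrow> i \<noteq> j \<Longrightarrow> b i j ^ Suc N = 0"
    unfolding b_def using unit_mat_nilpotent[OF a] by blast
  define K where "K = 2 * N + r * Suc N"
  define A where "A = a (unit_mat r 0 0) + of_nat K \<cdot>\<^sub>m 1\<^sub>m n"
  have aE: "a (unit_mat r i j) \<in> carrier_mat n n" for i j using obj_GL_carrier[OF a] by simp
  have A: "obj_Gm n A" using aE by (simp add: A_def obj_Gm_def)
  have A_entry: "A $$ (i, j) = a (unit_mat r 0 0) $$ (i, j) + (if i = j then of_nat K else 0)" if "i < n" "j < n" for i j
    using aE that by (simp add: A_def)
  \<comment> \<open>The initial value is the identity matrix, which in \<open>linop\<close> is a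
    projection commuting with the image of every matrix.\<close>
  interpret R: gl_rep r N K b "of_mat n (1\<^sub>m n)"
  proof
    fix i j p q assume "i < r" "j < r" "p < r" "q < r"
    then show "b i j * b p q = b p q * b i j + (if j = p then b i q else 0) - (if i = q then b p j else 0)"
      unfolding b_def by (rule of_mat_bracket[OF a])
  next
    show "b 0 0 * of_mat n (1\<^sub>m n) = of_mat n (1\<^sub>m n) * b 0 0"
      unfolding b_def of_mat_one_left of_mat_one_right ..
  qed (use r N in \<open>auto simp: K_def\<close>)
  obtain m where m: "\<And>k w. k > m \<Longrightarrow> R.D k w = 0" using R.D_eventually_0 by blast
  define Y where "Y g z = g $$ z - 1\<^sub>m r $$ z" for g :: "complex mat" and z :: "nat \<times> nat"
  \<comment> \<open>All coefficients from degree \<open>Suc m\<close> on vanish, so this truncation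
    meets the requirement of \<open>sol_deriv\<close>.\<close>
  define f where "f u v g = R.sol (Suc m) (entry u v) (Y g)" for u v g
  define F where "F g = mat n n (\<lambda>(u, v). f u v g)" for g
  have poly: "f u v \<in> poly_fun r" for u v
  proof -
    have "(\<lambda>g. Y g z) \<in> poly_fun r" if z: "z \<in> {..<r} \<times> {..<r}" for z
    proof -
      obtain i j where "z = (i, j)" "i < r" "j < r" using z by (cases z) auto
      then show ?thesis unfolding Y_def
        using poly_fun.add[OF poly_fun.entry[of i r j] poly_fun.const[of "- 1\<^sub>m r $$ z"]] by simp
    qed
    then have "(\<lambda>g. R.sol (Suc m) (entry u v) (Y g)) \<in> poly_fun r"
      unfolding R.sol_def by (intro poly_fun_sum poly_fun_divide_const poly_fun_wsum)
    then show ?thesis unfolding f_def .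
  qed
  have F_entry: "F g $$ (u, v) = f u v g" if "u < n" "v < n" for u v g using that by (simp add: F_def)
  \<comment> \<open>Each entry of the action is a linear combination of entries, so the scalar
    equations for the functionals \<open>entry u v\<close> close up into the matrix equation of a
    morphism.\<close>
  have act: "entry u v (R.act i j x) = (\<Sum>s<n. (if i = j then A $$ (s, v) else 0) * entry u s x)
      + (\<Sum>s<n. - a (unit_mat r i j) $$ (u, s) * entry s v x)" if uv: "u < n" "v < n" for u v i j x
  proof -
    have K: "entry u v (x * of_nat K) = of_nat K * entry u v x"
    proof -
      have "x * of_nat K = real K *\<^sub>R x" by (simp add: scaleR_conv_of_real mult_of_nat_commute)
      then show ?thesis by simp
    qed
    have "entry u v (x * (b 0 0 + of_nat K)) = (\<Sum>s<n. entry u s x * a (unit_mat r 0 0) $$ (s, v)) + of_nat K * entry u v x"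
      by (simp add: distrib_left K b_def entry_mult_of_mat[OF uv(2)])
    also have "of_nat K * entry u v x = (\<Sum>s<n. if s = v then of_nat K * entry u s x else 0)" using uv by simp
    also have "(\<Sum>s<n. entry u s x * a (unit_mat r 0 0) $$ (s, v)) + \<dots> = (\<Sum>s<n. A $$ (s, v) * entry u s x)"
      unfolding sum.distrib[symmetric] using uv by (intro sum.cong) (auto simp: A_entry algebra_simps)
    finally have "entry u v (x * (b 0 0 + of_nat K)) = (\<Sum>s<n. A $$ (s, v) * entry u s x)" .
    then show ?thesis
      by (simp add: R.act_def b_def entry_of_mat_mult[OF uv(1)] sum_negf)
  qed
  have deriv: "livf r X (\<lambda>g. F g $$ (u, v)) g + (\<Sum>s<n. a X $$ (u, s) * F g $$ (s, v))
      = (\<Sum>s<n. F g $$ (u, s) * pullback_obj r A X $$ (s, v))"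
    if X: "X \<in> carrier_mat r r" and g: "g \<in> GL r" and uv: "u < n" "v < n" for X g u v
  proof -
    let ?L = "{..<r} \<times> {..<r}"
    note gc = GL_carrier[OF g]
    have g0: "g + 0 \<cdot>\<^sub>m (g * X) = g" using gc X by (intro eq_matI) auto
    have "((\<lambda>t. R.sol (Suc m) (entry u v) (Y (g + t \<cdot>\<^sub>m (g * X)))) has_field_derivative
        (\<Sum>z\<in>?L. X $$ z * R.sol (Suc m) (\<lambda>x. entry u v (R.act (fst z) (snd z) x)) (Y (g + 0 \<cdot>\<^sub>m (g * X))))) (at 0)"
    proof (rule R.sol_deriv)
      fix p q assume pq: "p < r" "q < r"
      have "(g * X) $$ (p, q) = (\<Sum>i<r. (1\<^sub>m r $$ (p, i) + Y g (p, i)) * X $$ (i, q))"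
        unfolding mult_mat_entry[OF gc X pq] by (simp add: Y_def)
      also have "\<dots> = (\<Sum>i<r. if i = p then X $$ (i, q) else 0) + (\<Sum>i<r. Y g (p, i) * X $$ (i, q))"
        unfolding sum.distrib[symmetric] using pq by (intro sum.cong) (auto simp: algebra_simps)
      also have "\<dots> = X $$ (p, q) + (\<Sum>i<r. Y (g + 0 \<cdot>\<^sub>m (g * X)) (p, i) * X $$ (i, q))"
        using pq by (simp add: g0)
      finally have e: "(g * X) $$ (p, q) = X $$ (p, q) + (\<Sum>i<r. Y (g + 0 \<cdot>\<^sub>m (g * X)) (p, i) * X $$ (i, q))" .
      have "Y (g + t \<cdot>\<^sub>m (g * X)) (p, q) = Y g (p, q) + t * (g * X) $$ (p, q)" for t
        using pq gc X by (simp add: Y_def)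
      then show "((\<lambda>t. Y (g + t \<cdot>\<^sub>m (g * X)) (p, q)) has_field_derivative
          X $$ (p, q) + (\<Sum>i<r. Y (g + 0 \<cdot>\<^sub>m (g * X)) (p, i) * X $$ (i, q))) (at 0)"
        unfolding e[symmetric] by (auto intro!: derivative_eq_intros)
    qed (use m in auto)
    then have "livf r X (f u v) g = (\<Sum>z\<in>?L. X $$ z * R.sol (Suc m) (\<lambda>x. entry u v (R.act (fst z) (snd z) x)) (Y g))"
      unfolding g0 by (intro livf_eqI) (simp add: f_def)
    also have "\<dots> = (\<Sum>z\<in>?L. X $$ z * ((\<Sum>s<n. (if fst z = snd z then A $$ (s, v) else 0) * f u s g)
        + (\<Sum>s<n. - a (unit_mat r (fst z) (snd z)) $$ (u, s) * f s v g)))"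
      unfolding act[OF uv] R.sol_add R.sol_sum f_def ..
    also have "\<dots> = (\<Sum>z\<in>?L. if fst z = snd z then X $$ z * (\<Sum>s<n. A $$ (s, v) * f u s g) else 0)
        - (\<Sum>z\<in>?L. \<Sum>s<n. X $$ z * a (unit_mat r (fst z) (snd z)) $$ (u, s) * f s v g)"
      unfolding sum_subtractf[symmetric]
      by (intro sum.cong refl) (auto simp: sum_distrib_left sum_negf mult_ac right_diff_distrib)
    also have "(\<Sum>z\<in>?L. if fst z = snd z then X $$ z * (\<Sum>s<n. A $$ (s, v) * f u s g) else 0)
        = trace r X * (\<Sum>s<n. A $$ (s, v) * f u s g)"
      by (simp add: sum.cartesian_product' trace_def sum_distrib_right cong: if_cong)
    also have "(\<Sum>z\<in>?L. \<Sum>s<n. X $$ z * a (unit_mat r (fst z) (snd z)) $$ (u, s) * f s v g)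
        = (\<Sum>s<n. a X $$ (u, s) * f s v g)"
      unfolding sum.swap[of _ "{..<n}" ?L]
      by (intro sum.cong refl) (simp add: obj_GL_expand[OF a X uv(1)] sum_distrib_right)
    finally have L: "livf r X (f u v) g = trace r X * (\<Sum>s<n. A $$ (s, v) * f u s g) - (\<Sum>s<n. a X $$ (u, s) * f s v g)" .
    have "(\<lambda>g. F g $$ (u, v)) = f u v" using F_entry uv by auto
    then show ?thesis
      using uv X by (simp add: L F_entry pullback_obj_entry[OF A] sum_distrib_left mult_ac)
  qed
  show thesis
  proof (rule that[of F K])
    show "(\<lambda>g. F g $$ (i, j)) \<in> poly_fun r" if "i < n" "j < n" for i j
      using poly[of i j] F_entry[OF that] by simp
    then have "regular_GL r (\<lambda>g. F g $$ (i, j))" if "i < n" "j < n" for i j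
      using that regular_GL_poly_fun by blast
    then have "hom_GL r n (pullback_obj r A) n a F"
      by (subst hom_GL_iff) (use deriv pullback_obj_carrier[OF A] obj_GL_carrier[OF a] in \<open>auto simp: F_def\<close>)
    then show "hom_GL r n (pullback_obj r (a (unit_mat r 0 0) + of_nat K \<cdot>\<^sub>m 1\<^sub>m n)) n a F" unfolding A_def .
    have "Y (1\<^sub>m r) = (\<lambda>z. 0)" by (simp add: Y_def fun_eq_iff)
    then show "F (1\<^sub>m r) = 1\<^sub>m n"
      by (intro eq_matI) (auto simp: F_def f_def R.sol_at_0)
  qed
qed

section \<open>Composition, duality and the inverse morphism\<close>

lemma livf_mult:
  assumes "regular_GL r f" "regular_GL r h" "g \<in> GL r" "X \<in> carrier_mat r r"
  shows "livf r X (\<lambda>g. f g * h g) g = livf r X f g * h g + f g * livf r X h g"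
proof (rule livf_eqI)
  have "g + 0 \<cdot>\<^sub>m (g * X) = g" using GL_carrier[OF assms(3)] assms(4) by (intro eq_matI) auto
  then show "((\<lambda>t. f (g + t \<cdot>\<^sub>m (g * X)) * h (g + t \<cdot>\<^sub>m (g * X))) has_field_derivative
      livf r X f g * h g + f g * livf r X h g) (at 0)"
    using DERIV_mult[OF livf_deriv[OF assms(1,3,4)] livf_deriv[OF assms(2,3,4)]] by (simp add: mult.commute)
qed

lemma livf_sum:
  assumes "\<And>s. s \<in> S \<Longrightarrow> regular_GL r (f s)" "g \<in> GL r" "X \<in> carrier_mat r r"
  shows "livf r X (\<lambda>g. \<Sum>s\<in>S. f s g) g = (\<Sum>s\<in>S. livf r X (f s) g)"
  by (intro livf_eqI DERIV_sum livf_deriv assms)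

lemma hom_GL_id:
  assumes "obj_Gm n A"
  shows "hom_GL r n (pullback_obj r A) n (pullback_obj r A) (\<lambda>g. 1\<^sub>m n)"
  unfolding hom_GL_pullback_iff[OF assms assms]
proof (intro conjI ballI allI impI)
  fix X g :: "complex mat" and i j assume "i < n" "j < n"
  moreover have "livf r X (\<lambda>h. 1\<^sub>m n $$ (i, j)) g = 0" by (rule livf_eqI) simp
  ultimately show "livf r X (\<lambda>h. 1\<^sub>m n $$ (i, j)) g
      = trace r X * ((\<Sum>l<n. 1\<^sub>m n $$ (i, l) * A $$ (l, j)) - (\<Sum>l<n. A $$ (i, l) * 1\<^sub>m n $$ (l, j)))"
    by (simp add: if_distrib if_distribR cong: if_cong)
qed (auto intro: regular_GL_const)

lemma hom_GL_comp:
  assumes a: "\<And>X. X \<in> carrier_mat r r \<Longrightarrow> a X \<in> carrier_mat n n"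
    and b: "\<And>X. X \<in> carrier_mat r r \<Longrightarrow> b X \<in> carrier_mat m m"
    and c: "\<And>X. X \<in> carrier_mat r r \<Longrightarrow> c X \<in> carrier_mat k k"
    and F: "hom_GL r n a k c F" and G: "hom_GL r k c m b G"
  shows "hom_GL r n a m b (\<lambda>g. G g * F g)"
proof -
  have F': "\<And>g. g \<in> GL r \<Longrightarrow> F g \<in> carrier_mat k n" "\<And>i j. i < k \<Longrightarrow> j < n \<Longrightarrow> regular_GL r (\<lambda>g. F g $$ (i, j))"
    "\<And>X g i j. X \<in> carrier_mat r r \<Longrightarrow> g \<in> GL r \<Longrightarrow> i < k \<Longrightarrow> j < n \<Longrightarrow>
      livf r X (\<lambda>h. F h $$ (i, j)) g = (\<Sum>l<n. F g $$ (i, l) * a X $$ (l, j)) - (\<Sum>l<k. c X $$ (i, l) * F g $$ (l, j))"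
    using F hom_GL_iff[of r a n c k F, OF a c] by (auto simp: eq_diff_eq)
  have G': "\<And>g. g \<in> GL r \<Longrightarrow> G g \<in> carrier_mat m k" "\<And>i j. i < m \<Longrightarrow> j < k \<Longrightarrow> regular_GL r (\<lambda>g. G g $$ (i, j))"
    "\<And>X g i j. X \<in> carrier_mat r r \<Longrightarrow> g \<in> GL r \<Longrightarrow> i < m \<Longrightarrow> j < k \<Longrightarrow>
      livf r X (\<lambda>h. G h $$ (i, j)) g = (\<Sum>l<k. G g $$ (i, l) * c X $$ (l, j)) - (\<Sum>l<m. b X $$ (i, l) * G g $$ (l, j))"
    using G hom_GL_iff[of r c k b m G, OF c b] by (auto simp: eq_diff_eq)
  have entry: "(G g * F g) $$ (i, j) = (\<Sum>s<k. G g $$ (i, s) * F g $$ (s, j))" if "g \<in> GL r" "i < m" "j < n" for g i j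
    using mult_mat_entry[OF G'(1) F'(1)] that by blast
  have reg: "regular_GL r (\<lambda>g. G g $$ (i, s) * F g $$ (s, j))" if "i < m" "s < k" "j < n" for i s j
    using that by (intro regular_GL_mult F' G')
  show ?thesis
  proof (subst hom_GL_iff, goal_cases)
    case 3
    show ?case
    proof (intro conjI ballI allI impI)
      show "G g * F g \<in> carrier_mat m n" if "g \<in> GL r" for g using F'(1) G'(1) that by (auto intro: mult_carrier_mat)
    next
      fix i j assume ij: "i < m" "j < n"
      have "regular_GL r (\<lambda>g. \<Sum>s<k. G g $$ (i, s) * F g $$ (s, j))" using ij by (auto intro: regular_GL_sum reg)
      then show "regular_GL r (\<lambda>g. (G g * F g) $$ (i, j))" by (rule regular_GL_cong) (simp add: entry ij)
    next
      fix X g :: "complex mat" and i j assume X: "X \<in> carrier_mat r r" and g: "g \<in> GL r" and ij: "i < m" "j < n"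
      have "livf r X (\<lambda>h. (G h * F h) $$ (i, j)) g = livf r X (\<lambda>h. \<Sum>s<k. G h $$ (i, s) * F h $$ (s, j)) g"
        using g X ij by (intro livf_cong entry)
      also have "\<dots> = (\<Sum>s<k. livf r X (\<lambda>h. G h $$ (i, s)) g * F g $$ (s, j) + G g $$ (i, s) * livf r X (\<lambda>h. F h $$ (s, j)) g)"
        using ij g X by (subst livf_sum) (auto intro!: sum.cong livf_mult reg F' G')
      also have "\<dots> = (\<Sum>s<k. (\<Sum>l<k. G g $$ (i, l) * c X $$ (l, s)) * F g $$ (s, j)) - (\<Sum>s<k. (\<Sum>l<m. b X $$ (i, l) * G g $$ (l, s)) * F g $$ (s, j))
          + (\<Sum>s<k. G g $$ (i, s) * (\<Sum>l<n. F g $$ (s, l) * a X $$ (l, j))) - (\<Sum>s<k. G g $$ (i, s) * (\<Sum>l<k. c X $$ (s, l) * F g $$ (l, j)))"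
        unfolding sum_subtractf[symmetric] sum.distrib[symmetric]
        using ij g X by (intro sum.cong) (auto simp: F' G' algebra_simps)
      also have "(\<Sum>s<k. (\<Sum>l<k. G g $$ (i, l) * c X $$ (l, s)) * F g $$ (s, j)) = (\<Sum>s<k. G g $$ (i, s) * (\<Sum>l<k. c X $$ (s, l) * F g $$ (l, j)))"
        unfolding sum_distrib_left sum_distrib_right by (subst sum.swap) (simp add: mult.assoc)
      also have "(\<Sum>s<k. (\<Sum>l<m. b X $$ (i, l) * G g $$ (l, s)) * F g $$ (s, j)) = (\<Sum>l<m. b X $$ (i, l) * (G g * F g) $$ (l, j))"
        unfolding sum_distrib_right using ij g by (subst sum.swap) (simp add: entry sum_distrib_left mult.assoc)
      also have "(\<Sum>s<k. G g $$ (i, s) * (\<Sum>l<n. F g $$ (s, l) * a X $$ (l, j))) = (\<Sum>l<n. (G g * F g) $$ (i, l) * a X $$ (l, j))"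
        unfolding sum_distrib_left using ij g by (subst sum.swap) (simp add: entry sum_distrib_right mult.assoc)
      finally show "livf r X (\<lambda>h. (G h * F h) $$ (i, j)) g + (\<Sum>l<m. b X $$ (i, l) * (G g * F g) $$ (l, j))
          = (\<Sum>l<n. (G g * F g) $$ (i, l) * a X $$ (l, j))" by simp
    qed
  qed (use a b in auto)
qed

lemma obj_GL_dual:
  assumes a: "obj_GL r n a"
  shows "obj_GL r n (\<lambda>X. - transpose_mat (a X))"
  unfolding obj_GL_def
proof (intro conjI ballI allI)
  note ca = obj_GL_carrier[OF a]
  fix X :: "complex mat" assume X: "X \<in> carrier_mat r r"
  show "- transpose_mat (a X) \<in> carrier_mat n n" using ca[OF X] by simp
  fix Y :: "complex mat" assume Y: "Y \<in> carrier_mat r r"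
  {
    fix c d
    show "- transpose_mat (a (c \<cdot>\<^sub>m X + d \<cdot>\<^sub>m Y)) = c \<cdot>\<^sub>m (- transpose_mat (a X)) + d \<cdot>\<^sub>m (- transpose_mat (a Y))"
      unfolding obj_GL_linear[OF a X Y] using ca[OF X] ca[OF Y] by (intro eq_matI) auto
  }
  define x y where "x = a X" and "y = a Y"
  have c: "x \<in> carrier_mat n n" "y \<in> carrier_mat n n" using ca X Y by (auto simp: x_def y_def)
  then have ct: "- transpose_mat x \<in> carrier_mat n n" "- transpose_mat y \<in> carrier_mat n n" by auto
  have p: "x * y \<in> carrier_mat n n" "y * x \<in> carrier_mat n n"
    "- transpose_mat x * - transpose_mat y \<in> carrier_mat n n" "- transpose_mat y * - transpose_mat x \<in> carrier_mat n n"
    using c ct by (auto intro: mult_carrier_mat)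
  show "- (- transpose_mat (a (X * Y - Y * X))) + (- transpose_mat (a X) * - transpose_mat (a Y) - - transpose_mat (a Y) * - transpose_mat (a X)) = 0\<^sub>m n n"
    unfolding obj_GL_bracket[OF a X Y] x_def[symmetric] y_def[symmetric]
  proof (rule eq_matI)
    fix i j assume "i < dim_row (0\<^sub>m n n :: complex mat)" "j < dim_col (0\<^sub>m n n :: complex mat)"
    then have ij: "i < n" "j < n" by auto
    have "(- transpose_mat x * - transpose_mat y) $$ (i, j) = (\<Sum>l<n. x $$ (l, i) * y $$ (j, l))"
      "(- transpose_mat y * - transpose_mat x) $$ (i, j) = (\<Sum>l<n. y $$ (l, i) * x $$ (j, l))"
      unfolding mult_mat_entry[OF ct ij] mult_mat_entry[OF ct(2,1) ij] using c ij by auto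
    moreover have "(x * y) $$ (j, i) = (\<Sum>l<n. x $$ (j, l) * y $$ (l, i))" "(y * x) $$ (j, i) = (\<Sum>l<n. y $$ (j, l) * x $$ (l, i))"
      using mult_mat_entry[OF c ij(2,1)] mult_mat_entry[OF c(2,1) ij(2,1)] .
    ultimately show "(- (- transpose_mat (x * y - y * x)) + (- transpose_mat x * - transpose_mat y - - transpose_mat y * - transpose_mat x)) $$ (i, j) = 0\<^sub>m n n $$ (i, j)"
      using ij c by (simp add: carrier_matD mult.commute del: index_mult_mat(1))
  qed (use p in auto)
qed

text \<open>Dividing by a power of det twists by a multiple of the trace; this is what absorbs the
  two integral shifts made to avoid poles.\<close>

lemma livf_divide_det:
  assumes f: "regular_GL r f" and g: "g \<in> GL r" and X: "X \<in> carrier_mat r r"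
  shows "livf r X (\<lambda>g. f g / det g ^ m) g = (livf r X f g - of_nat m * trace r X * f g) / det g ^ m"
proof (rule livf_eqI)
  have g0: "g + 0 \<cdot>\<^sub>m (g * X) = g" using GL_carrier[OF g] X by (intro eq_matI) auto
  have d: "det g \<noteq> 0" using GL_det[OF g] .
  have "((\<lambda>t. f (g + t \<cdot>\<^sub>m (g * X)) / det (g + t \<cdot>\<^sub>m (g * X)) ^ m) has_field_derivative
      (livf r X f g * det g ^ m - f g * (of_nat m * (det g * trace r X * det g ^ (m - Suc 0)))) / (det g ^ m * det g ^ m)) (at 0)"
    using DERIV_divide[OF livf_deriv[OF f g X] DERIV_power[OF det_translate_deriv[OF GL_carrier[OF g] X], of m]] d
    by (simp only: g0) simp
  also have "(livf r X f g * det g ^ m - f g * (of_nat m * (det g * trace r X * det g ^ (m - Suc 0)))) / (det g ^ m * det g ^ m)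
      = (livf r X f g - of_nat m * trace r X * f g) / det g ^ m"
    using d by (cases m) (simp_all add: field_simps)
  finally show "((\<lambda>t. f (g + t \<cdot>\<^sub>m (g * X)) / det (g + t \<cdot>\<^sub>m (g * X)) ^ m) has_field_derivative
      (livf r X f g - of_nat m * trace r X * f g) / det g ^ m) (at 0)" .
qed

text \<open>Invertibility of \<open>F\<close> is not examined directly: a morphism \<open>G\<close>
  back is built from a solution for the dual. Then \<open>G g * F g\<close> is an endomorphism of a
  pullback with value 1 at the identity, and uniqueness makes it 1 everywhere.\<close>

lemma hom_GL_pullback_ess_surj:
  assumes r: "r \<ge> 1" and a: "obj_GL r n a"
  shows "\<exists>A F G. obj_Gm n A \<and> hom_GL r n (pullback_obj r A) n a F \<and> hom_GL r n a n (pullback_obj r A) G \<and>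
    (\<forall>g\<in>GL r. G g * F g = 1\<^sub>m n \<and> F g * G g = 1\<^sub>m n)"
proof -
  define E where "E = unit_mat r 0 0"
  define a' where "a' X = - transpose_mat (a X)" for X
  have a': "obj_GL r n a'" unfolding a'_def by (rule obj_GL_dual[OF a])
  obtain K F where F: "hom_GL r n (pullback_obj r (a E + of_nat K \<cdot>\<^sub>m 1\<^sub>m n)) n a F" "F (1\<^sub>m r) = 1\<^sub>m n"
    unfolding E_def by (rule polynomial_trivialization[OF r a]) blast
  obtain L H where H: "\<And>i j. i < n \<Longrightarrow> j < n \<Longrightarrow> (\<lambda>g. H g $$ (i, j)) \<in> poly_fun r"
    "hom_GL r n (pullback_obj r (a' E + of_nat L \<cdot>\<^sub>m 1\<^sub>m n)) n a' H" "H (1\<^sub>m r) = 1\<^sub>m n"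
    unfolding E_def by (rule polynomial_trivialization[OF r a']) blast
  define A B where "A = a E + of_nat K \<cdot>\<^sub>m 1\<^sub>m n" and "B = a' E + of_nat L \<cdot>\<^sub>m 1\<^sub>m n"
  have aE: "a E \<in> carrier_mat n n" using obj_GL_carrier[OF a] by (simp add: E_def)
  have A: "obj_Gm n A" and B: "obj_Gm n B" using aE by (auto simp: A_def B_def a'_def obj_Gm_def)
  \<comment> \<open>The transpose of \<open>B\<close> is (K + L) - A. Hence division by det^(K + L)
    is exactly the twist that makes the transpose of \<open>H\<close> a morphism into the pullback
    of \<open>A\<close>.\<close>
  have AB: "B $$ (l, i) = of_nat (K + L) * (if l = i then 1 else 0) - A $$ (i, l)" if "i < n" "l < n" for i l
    using that aE by (auto simp: A_def B_def a'_def)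
  have H': "\<And>g. g \<in> GL r \<Longrightarrow> H g \<in> carrier_mat n n"
    "\<And>X g i j. X \<in> carrier_mat r r \<Longrightarrow> g \<in> GL r \<Longrightarrow> i < n \<Longrightarrow> j < n \<Longrightarrow>
      livf r X (\<lambda>h. H h $$ (i, j)) g + (\<Sum>l<n. a' X $$ (i, l) * H g $$ (l, j)) = (\<Sum>l<n. H g $$ (i, l) * pullback_obj r B X $$ (l, j))"
    using H(2) hom_GL_iff[of r "pullback_obj r B" n a' n H, OF pullback_obj_carrier[OF B] obj_GL_carrier[OF a']]
    unfolding B_def[symmetric] by blast+
  define G where "G g = mat n n (\<lambda>(i, j). H g $$ (j, i) / det g ^ (K + L))" for g
  have G: "hom_GL r n a n (pullback_obj r A) G"
  proof (subst hom_GL_iff, goal_cases)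
    case 3
    show ?case
    proof (intro conjI ballI allI impI)
      show "G g \<in> carrier_mat n n" for g by (simp add: G_def)
      show "regular_GL r (\<lambda>g. G g $$ (i, j))" if "i < n" "j < n" for i j
        using H(1)[OF that(2,1)] that unfolding regular_GL_def G_def by auto
      fix X g :: "complex mat" and i j assume X: "X \<in> carrier_mat r r" and g: "g \<in> GL r" and ij: "i < n" "j < n"
      let ?d = "det g ^ (K + L)"
      have e1: "(\<Sum>l<n. a' X $$ (j, l) * H g $$ (l, i)) = - (\<Sum>l<n. H g $$ (l, i) * a X $$ (l, j))"
        using ij obj_GL_carrier[OF a X] by (simp add: a'_def sum_negf mult.commute)
      have e2: "(\<Sum>l<n. H g $$ (j, l) * pullback_obj r B X $$ (l, i))
          = trace r X * (\<Sum>l<n. H g $$ (j, l) * B $$ (l, i))"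
        using ij X by (simp add: pullback_obj_entry[OF B] sum_distrib_left mult_ac)
      have e3: "(\<Sum>l<n. H g $$ (j, l) * B $$ (l, i)) = of_nat (K + L) * H g $$ (j, i) - (\<Sum>l<n. A $$ (i, l) * H g $$ (j, l))"
      proof -
        have "(\<Sum>l<n. H g $$ (j, l) * B $$ (l, i)) = (\<Sum>l<n. (if l = i then of_nat (K + L) * H g $$ (j, i) else 0) - A $$ (i, l) * H g $$ (j, l))"
          using ij by (intro sum.cong) (auto simp: AB algebra_simps)
        then show ?thesis using ij by (simp add: sum_subtractf)
      qed
      have "livf r X (\<lambda>h. H h $$ (j, i)) g - of_nat (K + L) * trace r X * H g $$ (j, i)
          = (\<Sum>l<n. H g $$ (l, i) * a X $$ (l, j)) - trace r X * (\<Sum>l<n. A $$ (i, l) * H g $$ (j, l))"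
        using H'(2)[OF X g ij(2,1)] unfolding e1 e2 e3 by (simp add: right_diff_distrib diff_eq_eq mult.assoc mult.left_commute)
      moreover have "livf r X (\<lambda>h. G h $$ (i, j)) g = (livf r X (\<lambda>h. H h $$ (j, i)) g - of_nat (K + L) * trace r X * H g $$ (j, i)) / ?d"
        using livf_divide_det[OF regular_GL_poly_fun[OF H(1)[OF ij(2,1)]] g X, of "K + L"] ij by (simp add: G_def)
      ultimately show "livf r X (\<lambda>h. G h $$ (i, j)) g + (\<Sum>l<n. pullback_obj r A X $$ (i, l) * G g $$ (l, j)) = (\<Sum>l<n. G g $$ (i, l) * a X $$ (l, j))"
        using ij X by (simp add: G_def pullback_obj_entry[OF A] diff_divide_distrib sum_divide_distrib sum_distrib_left mult.assoc)
    qed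
  qed (use obj_GL_carrier[OF a] pullback_obj_carrier[OF A] in auto)
  have F: "hom_GL r n (pullback_obj r A) n a F" "F (1\<^sub>m r) = 1\<^sub>m n" using F unfolding A_def by auto
  have "G (1\<^sub>m r) = 1\<^sub>m n" by (intro eq_matI) (auto simp: G_def H(3))
  then have one: "G (1\<^sub>m r) * F (1\<^sub>m r) = 1\<^sub>m n" using F(2) by simp
  have comp: "hom_GL r n (pullback_obj r A) n (pullback_obj r A) (\<lambda>g. G g * F g)"
    by (rule hom_GL_comp[OF _ _ _ F(1) G]) (use obj_GL_carrier[OF a] pullback_obj_carrier[OF A] in blast)+
  have GF: "G g * F g = 1\<^sub>m n" if "g \<in> GL r" for g
    by (rule hom_GL_pullback_unique[OF A A comp hom_GL_id[OF A] one that])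
  moreover have "F g * G g = 1\<^sub>m n" if g: "g \<in> GL r" for g
  proof (rule mat_mult_left_right_inverse[OF _ _ GF[OF g]])
    show "G g \<in> carrier_mat n n" "F g \<in> carrier_mat n n" using F(1) G g by (auto simp: hom_GL_def)
  qed
  ultimately show ?thesis using A F(1) G by blast
qed

theorem theorem4p3:
  fixes r :: nat
  assumes "r \<ge> 1"
  shows
    \<comment> \<open>det^* is a functor: objects and morphisms go to objects and morphisms\<close>
    "(\<forall>n A. obj_Gm n A \<longrightarrow> obj_GL r n (pullback_obj r A))
     \<and> (\<forall>n A m B F. obj_Gm n A \<longrightarrow> obj_Gm m B \<longrightarrow> hom_Gm n A m B F \<longrightarrow>
          hom_GL r n (pullback_obj r A) m (pullback_obj r B) (pullback_hom F))
     \<comment> \<open>faithful\<close>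
     \<and> (\<forall>n A m B F F'. obj_Gm n A \<longrightarrow> obj_Gm m B \<longrightarrow> hom_Gm n A m B F \<longrightarrow> hom_Gm n A m B F' \<longrightarrow>
          (\<forall>g \<in> GL r. pullback_hom F g = pullback_hom F' g) \<longrightarrow> (\<forall>z. z \<noteq> 0 \<longrightarrow> F z = F' z))
     \<comment> \<open>full\<close>
     \<and> (\<forall>n A m B G. obj_Gm n A \<longrightarrow> obj_Gm m B \<longrightarrow>
          hom_GL r n (pullback_obj r A) m (pullback_obj r B) G \<longrightarrow>
          (\<exists>F. hom_Gm n A m B F \<and> (\<forall>g \<in> GL r. G g = pullback_hom F g)))
     \<comment> \<open>essentially surjective\<close>
     \<and> (\<forall>n a. obj_GL r n a \<longrightarrow>
          (\<exists>A F G. obj_Gm n A \<and> hom_GL r n (pullback_obj r A) n a F \<and> hom_GL r n a n (pullback_obj r A) G \<and>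
             (\<forall>g \<in> GL r. G g * F g = 1\<^sub>m n \<and> F g * G g = 1\<^sub>m n)))
     \<comment> \<open>compatible with the tensor structure (tensor products and unit)\<close>
     \<and> (\<forall>n A m B. obj_Gm n A \<longrightarrow> obj_Gm m B \<longrightarrow>
          (\<forall>X \<in> carrier_mat r r. pullback_obj r (tensor_Gm n A m B) X
                                 = tensor_GL n (pullback_obj r A) m (pullback_obj r B) X))
     \<and> (\<forall>X \<in> carrier_mat r r. pullback_obj r (0\<^sub>m 1 1) X = 0\<^sub>m 1 1)
     \<and> (\<forall>F G. \<forall>g \<in> GL r. pullback_hom (tensor_hom_Gm F G) g
                          = tensor_hom_GL (pullback_hom F) (pullback_hom G) g)"
proof -
  \<comment> \<open>Every nonzero z is a determinant, namely that of
    \<open>diag_first r z\<close>.\<close>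
  have faithful: "F z = F' z" if "\<forall>g\<in>GL r. pullback_hom F g = pullback_hom F' g" "z \<noteq> 0" for F F' z
    using that(1)[rule_format, OF diag_first_GL[OF assms that(2)]] by (simp add: pullback_hom_def det_diag_first[OF assms])
  have unit: "pullback_obj r (0\<^sub>m 1 1) X = 0\<^sub>m 1 1" if "X \<in> carrier_mat r r" for X
    using that by (intro eq_matI) (auto simp: pullback_obj_trace)
  show ?thesis
    by (intro conjI allI impI ballI obj_GL_pullback hom_GL_pullback hom_GL_pullback_full[OF assms]
        hom_GL_pullback_ess_surj[OF assms] pullback_obj_tensor unit)
      (auto simp: pullback_hom_def tensor_hom_Gm_def tensor_hom_GL_def intro: faithful)
qed

end
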